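(* Assume that Assumption 1 and Assumption 2 (both stated in the context) hold. Then there is an algorithm which, given any $N$ and $X\in\mathcal{B}_N$, computes the tangle $\tau(X)\in S_N$ in time $\mathcal{O}(N^2)$.
   Context: For an integer $N\ge 0$, take upper nodes $1,\dots,N$ and lower nodes $1',\dots,N'$ arranged in two rows. A tangle is a set of $N$ edges such that each node is in exactly one edge (a perfect matching of the $2N$ nodes). The composition $X\circ Y$ is obtained by stacking $X$ on top of $Y$, identifying lower node $i'$ of $X$ with upper node $i$ of $Y$, tracing paths, and discarding internal loops. The Brauer monoid $\mathcal{B}_N$ is the monoid of all tangles, with identity $I_N=\{(i,i'):1\le i\le N\}$. It is generated by the primes, for $1\le i\le N-1$: the $T$-prime $T_i$, obtained from $I_N$ by replacing $(i,i'),(i+1,(i+1)')$ with $(i,(i+1)'),(i+1,i')$; and the $U$-prime $U_i$, obtained from $I_N$ by replacing these two edges with $(i,i+1),(i',(i+1)')$. $S_N$ is the submonoid generated by the $T_i$ (the symmetric group). A factorization of $X$ is a word in the primes whose composition is $X$ (the empty word is a factorization of $I_N$); it is minimal if no shorter word has the same composition. Two edges cross if they intersect in the diagram of the tangle drawn inside the rectangle with the minimum number of crossings (equivalently, their endpoints interleave in the cyclic order $1,\dots,N,N',\dots,1'$); the number of crossings of a tangle is the number of crossing pairs of edges. For a word $F$ in the primes, $\tau(F)$ is the word obtained by replacing each $U_i$ by $T_i$ and keeping each $T_i$. For a tangle $X$, $\tau(X)\in S_N$ is the tangle obtained by composing $\tau(F)$, where $F$ is a minimal factorization of $X$; the result is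 independent of the choice of $F$. Rewriting rules on words. Delete rules (applied left to right): $T_iT_i\to$ empty word; $U_iU_i\to U_i$; $T_iU_i\to U_i$; $U_iT_i\to U_i$; and for $|i-j|=1$: $U_iU_jU_i\to U_i$; $U_iT_jU_i\to U_i$; $T_iU_jU_i\to T_jU_i$; $U_iU_jT_i\to U_iT_j$; $U_iT_jT_i\to U_iU_j$; $T_iT_jU_i\to U_jU_i$. Braid rules, for $|i-j|=1$: $T_iT_jT_i= T_jT_iT_j$; $T_iU_jT_i= T_jU_iT_j$. Swap rules, for $|i-j|>1$: any prime of index $i$ commutes with any prime of index $j$. Assumption 1: for every $N$, every factorization in $\mathcal{B}_N$ can be transformed into a minimal one by a sequence of delete, braid and swap rules (the length never needs to be increased). Assumption 2: if a tangle $X$ has $k$ crossings, then there exists a minimal factorization of $X$ with exactly $k$ $T$-primes, and no factorization of $X$ has fewer $T$-primes. Running time counts elementary operations on node labels as constant time. *)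

theory Defs
  imports Complex_Main "HOL-Library.Landau_Symbols"
begin

section \<open>Tangles\<close>

text \<open>\<open>Up i\<close> is the upper node \<open>i\<close>, \<open>Lo i\<close> the lower node \<open>i'\<close>; edges are two-element sets of nodes.\<close>

datatype node = Up nat | Lo nat

type_synonym tangle = "node set set"

definition nodes :: "nat \<Rightarrow> node set" where
  "nodes N = Up ` {1..N} \<union> Lo ` {1..N}"

definition is_tangle :: "nat \<Rightarrow> tangle \<Rightarrow> bool" where
  "is_tangle N X \<longleftrightarrow> (\<forall>e\<in>X. e \<subseteq> nodes N \<and> card e = 2) \<and> (\<forall>v\<in>nodes N. \<exists>!e. e \<in> X \<and> v \<in> e)"

text \<open>Stacking \<open>X\<close> on top of \<open>Y\<close> gives a diagram with three rows of points; \<open>(r, i)\<close> is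
  the \<open>i\<close>-th point of row \<open>r\<close>. The middle row 1 consists of the lower nodes of \<open>X\<close>,
  identified with the upper nodes of \<open>Y\<close>. Paths between points of the outer rows become
  edges; loops only visit the middle row and disappear.\<close>

fun top_pos :: "node \<Rightarrow> nat \<times> nat" where
  "top_pos (Up i) = (0, i)"
| "top_pos (Lo i) = (1, i)"

fun bot_pos :: "node \<Rightarrow> nat \<times> nat" where
  "bot_pos (Up i) = (1, i)"
| "bot_pos (Lo i) = (2, i)"

fun outer_pos :: "node \<Rightarrow> nat \<times> nat" where
  "outer_pos (Up i) = (0, i)"
| "outer_pos (Lo i) = (2, i)"

definition stack_links :: "tangle \<Rightarrow> tangle \<Rightarrow> ((nat \<times> nat) \<times> (nat \<times> nat)) set" where
  "stack_links X Y =
     {(top_pos a, top_pos b) | a b. {a, b} \<in> X} \<union> {(bot_pos a, bot_pos b) | a b. {a, b} \<in> Y}"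

definition compose :: "tangle \<Rightarrow> tangle \<Rightarrow> tangle" where
  "compose X Y = {{a, b} | a b. a \<noteq> b \<and> (outer_pos a, outer_pos b) \<in> (stack_links X Y)\<^sup>*}"

definition id_tangle :: "nat \<Rightarrow> tangle" where
  "id_tangle N = {{Up i, Lo i} | i. i \<in> {1..N}}"

definition T_tangle :: "nat \<Rightarrow> nat \<Rightarrow> tangle" where
  "T_tangle N i = id_tangle N - {{Up i, Lo i}, {Up (i + 1), Lo (i + 1)}}
     \<union> {{Up i, Lo (i + 1)}, {Up (i + 1), Lo i}}"

definition U_tangle :: "nat \<Rightarrow> nat \<Rightarrow> tangle" where
  "U_tangle N i = id_tangle N - {{Up i, Lo i}, {Up (i + 1), Lo (i + 1)}}
     \<union> {{Up i, Up (i + 1)}, {Lo i, Lo (i + 1)}}"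

inductive_set sym_tangles :: "nat \<Rightarrow> tangle set" for N where
  "id_tangle N \<in> sym_tangles N"
| "1 \<le> i \<Longrightarrow> i \<le> N - 1 \<Longrightarrow> T_tangle N i \<in> sym_tangles N"
| "X \<in> sym_tangles N \<Longrightarrow> Y \<in> sym_tangles N \<Longrightarrow> compose X Y \<in> sym_tangles N"

section \<open>Crossings\<close>

text \<open>Position of a node in the cyclic order \<open>1, \<dots>, N, N', \<dots>, 1'\<close>.\<close>

fun cyc_pos :: "nat \<Rightarrow> node \<Rightarrow> nat" where
  "cyc_pos N (Up i) = i"
| "cyc_pos N (Lo i) = 2 * N + 1 - i"

definition crosses :: "nat \<Rightarrow> node set \<Rightarrow> node set \<Rightarrow> bool" where
  "crosses N e f \<longleftrightarrow> (\<exists>a b c d.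
      (e = {a, c} \<and> f = {b, d} \<or> f = {a, c} \<and> e = {b, d}) \<and>
      cyc_pos N a < cyc_pos N b \<and> cyc_pos N b < cyc_pos N c \<and> cyc_pos N c < cyc_pos N d)"

definition crossings :: "nat \<Rightarrow> tangle \<Rightarrow> nat" where
  "crossings N X = card {{e, f} | e f. e \<in> X \<and> f \<in> X \<and> crosses N e f}"

section \<open>Words and factorizations\<close>

datatype letter = is_T: T (idx: nat) | U (idx: nat)

type_synonym word = "letter list"

definition is_word :: "nat \<Rightarrow> word \<Rightarrow> bool" where
  "is_word N F \<longleftrightarrow> (\<forall>p\<in>set F. 1 \<le> idx p \<and> idx p \<le> N - 1)"

fun prime_tangle :: "nat \<Rightarrow> letter \<Rightarrow> tangle" where
  "prime_tangle N (T i) = T_tangle N i"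
| "prime_tangle N (U i) = U_tangle N i"

definition word_tangle :: "nat \<Rightarrow> word \<Rightarrow> tangle" where
  "word_tangle N F = foldr (\<lambda>p Y. compose (prime_tangle N p) Y) F (id_tangle N)"

definition factorization :: "nat \<Rightarrow> word \<Rightarrow> tangle \<Rightarrow> bool" where
  "factorization N F X \<longleftrightarrow> is_word N F \<and> word_tangle N F = X"

definition minimal_factorization :: "nat \<Rightarrow> word \<Rightarrow> tangle \<Rightarrow> bool" where
  "minimal_factorization N F X \<longleftrightarrow>
     factorization N F X \<and> (\<forall>G. factorization N G X \<longrightarrow> length F \<le> length G)"

definition T_count :: "word \<Rightarrow> nat" where
  "T_count F = length (filter is_T F)"

definition tau_word :: "word \<Rightarrow> word" where
  "tau_word F = map (\<lambda>p. T (idx p)) F"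

definition tau :: "nat \<Rightarrow> tangle \<Rightarrow> tangle" where
  "tau N X = word_tangle N (tau_word (SOME F. minimal_factorization N F X))"

section \<open>Rewriting\<close>

definition adj :: "nat \<Rightarrow> nat \<Rightarrow> bool" where
  "adj i j \<longleftrightarrow> \<bar>int i - int j\<bar> = 1"

inductive delete_rule :: "word \<Rightarrow> word \<Rightarrow> bool" where
  "delete_rule [T i, T i] []"
| "delete_rule [U i, U i] [U i]"
| "delete_rule [T i, U i] [U i]"
| "delete_rule [U i, T i] [U i]"
| "adj i j \<Longrightarrow> delete_rule [U i, U j, U i] [U i]"
| "adj i j \<Longrightarrow> delete_rule [U i, T j, U i] [U i]"
| "adj i j \<Longrightarrow> delete_rule [T i, U j, U i] [T j, U i]"
| "adj i j \<Longrightarrow> delete_rule [U i, U j, T i] [U i, T j]"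
| "adj i j \<Longrightarrow> delete_rule [U i, T j, T i] [U i, U j]"
| "adj i j \<Longrightarrow> delete_rule [T i, T j, U i] [U j, U i]"

text \<open>The next two relations are symmetric, so each equation can be used in both directions.\<close>

inductive braid_rule :: "word \<Rightarrow> word \<Rightarrow> bool" where
  "adj i j \<Longrightarrow> braid_rule [T i, T j, T i] [T j, T i, T j]"
| "adj i j \<Longrightarrow> braid_rule [T i, U j, T i] [T j, U i, T j]"

inductive swap_rule :: "word \<Rightarrow> word \<Rightarrow> bool" where
  "\<bar>int (idx p) - int (idx q)\<bar> > 1 \<Longrightarrow> swap_rule [p, q] [q, p]"

inductive rewrite_step :: "word \<Rightarrow> word \<Rightarrow> bool" where
  "delete_rule l r \<or> braid_rule l r \<or> swap_rule l r \<Longrightarrow> rewrite_step (A @ l @ B) (A @ r @ B)"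

definition assumption1 :: bool where
  "assumption1 \<longleftrightarrow> (\<forall>N F. is_word N F \<longrightarrow>
     (\<exists>G. rewrite_step\<^sup>*\<^sup>* F G \<and> minimal_factorization N G (word_tangle N F)))"

definition assumption2 :: bool where
  "assumption2 \<longleftrightarrow> (\<forall>N X. is_tangle N X \<longrightarrow>
     (\<exists>F. minimal_factorization N F X \<and> T_count F = crossings N X) \<and>
     (\<forall>F. factorization N F X \<longrightarrow> crossings N X \<le> T_count F))"

section \<open>Algorithms and running time\<close>

text \<open>A unit-cost random access machine, as a while language over natural-number variables and
  unbounded arrays. Every operation costs one time unit. All numbers that are
  stored, and all addresses that are written, must be at most the word bound \<open>W\<close> (otherwise there
  is no execution), so that the unit cost cannot be abused by packing data into large numbers.\<close>

type_synonym name = string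

datatype aexp = Lit nat | Var name | Read name aexp | Plus aexp aexp | Minus aexp aexp

datatype bexp = Less aexp aexp | Equal aexp aexp | Neg bexp | Conj bexp bexp

datatype com =
    Skip
  | Assign name aexp
  | Write name aexp aexp
  | Seq com com
  | Cond bexp com com
  | While bexp com

record state =
  var :: "name \<Rightarrow> nat"
  arr :: "name \<Rightarrow> nat \<Rightarrow> nat"

text \<open>\<open>Minus\<close> is truncated subtraction.\<close>

fun aval :: "aexp \<Rightarrow> state \<Rightarrow> nat" where
  "aval (Lit n) s = n"
| "aval (Var x) s = var s x"
| "aval (Read a e) s = arr s a (aval e s)"
| "aval (Plus e f) s = aval e s + aval f s"
| "aval (Minus e f) s = aval e s - aval f s"

fun bval :: "bexp \<Rightarrow> state \<Rightarrow> bool" where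
  "bval (Less e f) s = (aval e s < aval f s)"
| "bval (Equal e f) s = (aval e s = aval f s)"
| "bval (Neg b) s = (\<not> bval b s)"
| "bval (Conj b c) s = (bval b s \<and> bval c s)"

fun acost :: "aexp \<Rightarrow> nat" where
  "acost (Lit n) = 1"
| "acost (Var x) = 1"
| "acost (Read a e) = 1 + acost e"
| "acost (Plus e f) = 1 + acost e + acost f"
| "acost (Minus e f) = 1 + acost e + acost f"

fun bcost :: "bexp \<Rightarrow> nat" where
  "bcost (Less e f) = 1 + acost e + acost f"
| "bcost (Equal e f) = 1 + acost e + acost f"
| "bcost (Neg b) = 1 + bcost b"
| "bcost (Conj b c) = 1 + bcost b + bcost c"

text \<open>\<open>exec W c s t s'\<close>: with word bound \<open>W\<close>, the program \<open>c\<close> started in \<open>s\<close> halts in \<open>s'\<close> after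
  exactly \<open>t\<close> time units.\<close>

inductive exec :: "nat \<Rightarrow> com \<Rightarrow> state \<Rightarrow> nat \<Rightarrow> state \<Rightarrow> bool" for W where
  exec_Skip: "exec W Skip s 1 s"
| exec_Assign: "aval e s \<le> W \<Longrightarrow>
    exec W (Assign x e) s (1 + acost e) (s\<lparr>var := (var s)(x := aval e s)\<rparr>)"
| exec_Write: "aval i s \<le> W \<Longrightarrow> aval e s \<le> W \<Longrightarrow>
    exec W (Write a i e) s (1 + acost i + acost e)
      (s\<lparr>arr := (arr s)(a := (arr s a)(aval i s := aval e s))\<rparr>)"
| exec_Seq: "exec W c s t s' \<Longrightarrow> exec W d s' t' s'' \<Longrightarrow> exec W (Seq c d) s (t + t') s''"
| exec_CondTrue: "bval b s \<Longrightarrow> exec W c s t s' \<Longrightarrow> exec W (Cond b c d) s (1 + bcost b + t) s'"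
| exec_CondFalse: "\<not> bval b s \<Longrightarrow> exec W d s t s' \<Longrightarrow> exec W (Cond b c d) s (1 + bcost b + t) s'"
| exec_WhileFalse: "\<not> bval b s \<Longrightarrow> exec W (While b c) s (1 + bcost b) s"
| exec_WhileTrue: "bval b s \<Longrightarrow> exec W c s t s' \<Longrightarrow> exec W (While b c) s' t' s'' \<Longrightarrow>
    exec W (While b c) s (1 + bcost b + t + t') s''"

text \<open>A tangle is given to the machine, and returned by it, as its table of partners: node \<open>i\<close>
  has label \<open>i\<close>, node \<open>i'\<close> has label \<open>N + i\<close>, and cell \<open>k\<close> of the table holds the label of the
  node joined to the node labelled \<open>k\<close>.\<close>

fun label :: "nat \<Rightarrow> node \<Rightarrow> nat" where
  "label N (Up i) = i"
| "label N (Lo i) = N + i"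

definition partner :: "tangle \<Rightarrow> node \<Rightarrow> node" where
  "partner X v = (THE w. {v, w} \<in> X)"

definition table :: "nat \<Rightarrow> tangle \<Rightarrow> nat \<Rightarrow> nat" where
  "table N X k =
     (if k \<in> {1..N} then label N (partner X (Up k))
      else if k \<in> {N + 1..2 * N} then label N (partner X (Lo (k - N)))
      else 0)"

definition input_state :: "nat \<Rightarrow> tangle \<Rightarrow> state" where
  "input_state N X = \<lparr>var = (\<lambda>x. 0)(''N'' := N), arr = (\<lambda>a k. 0)(''in'' := table N X)\<rparr>"

definition output_is :: "nat \<Rightarrow> state \<Rightarrow> tangle \<Rightarrow> bool" where
  "output_is N s Y \<longleftrightarrow> (\<forall>k\<in>{1..2 * N}. arr s ''out'' k = table N Y k)"

end

theory Submission
  imports Defs "HOL-Combinatorics.Permutations"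
begin

text \<open>Number the nodes of the boundary of the rectangle cyclically by \<open>1, \<dots>, 2N\<close>, so that a tangle is a
  fixed-point free involution \<open>f\<close>. For a line from the \<open>p\<close>-th gap of the upper row to the \<open>q\<close>-th gap of
  the lower row let \<open>leaving p q\<close> be the number of edges that it must cross, and let
  \<open>through p q = max (leaving p q) \<bar>p - q\<bar>\<close>. Then \<open>\<tau>(X)\<close> is the permutation whose crossing numbers are the
  numbers \<open>through p q\<close> of \<open>X\<close>: it sends \<open>p\<close> to \<open>q\<close> iff the mixed second difference of \<open>through\<close> at
  \<open>(p, q)\<close> is positive, and a row by row computation of \<open>through\<close> takes constant time per entry.

  Upper bound on the length: as long as \<open>X\<close> has a hook, there are two non-crossing edges such that every
  line between them has \<open>leaving p q < \<bar>p - q\<bar>\<close>. Making these edges cross does not change \<open>through\<close>, and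
  a factorization of the new tangle can be turned into one of \<open>X\<close> that is not longer. The process ends
  in a permutation \<open>w\<close>, so \<open>X\<close> has a factorization of length at most the number of inversions of \<open>w\<close>.

  Lower bound: the Demazure product \<open>v\<close> of a factorization \<open>F\<close> has at most as many inversions as \<open>F\<close> has
  letters, and its crossing numbers bound those of \<open>X\<close>, so \<open>w \<le> v\<close> in the Bruhat order. If \<open>F\<close> is minimal,
  then \<open>w = v\<close> and no letter is lost in the product, which is therefore the composition of \<open>\<tau>(F)\<close>.\<close>

section \<open>Permutations and the Bruhat order\<close>

text \<open>The maximum has a simple origin. If every edge runs from top to bottom, a line from gap
  p to gap q has p upper and q lower nodes on its left, and at least |p - q| edges must cross it.
  Hooks can undercut this number, so \<open>through\<close> is a lower bound for the crossing
  numbers of every permutation that dominates X; that some permutation attains it everywhere is the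
  nontrivial point. For a permutation the number of crossings with the line is 2 r(p, q) - p + q,
  where r is the rank function of the Bruhat order. This ties cuts to lengths of words and makes the
  permutation readable from second differences. The obstacle is that \<open>tau\<close> is defined
  through an unspecified minimal factorization, so a claim about all minimal words is needed instead
  of one convenient word; the lower bound on the length must therefore come with its equality case.
  Lower node i' has cyclic number 2N + 1 - i, which makes the left side of every line an arc of the
  circle.\<close>

abbreviation adj_swap :: "nat \<Rightarrow> nat \<Rightarrow> nat" where
  "adj_swap i \<equiv> transpose i (Suc i)"

definition perm_rank :: "(nat \<Rightarrow> nat) \<Rightarrow> nat \<Rightarrow> nat \<Rightarrow> nat" where
  "perm_rank w p q = card {j \<in> {1..p}. q < w j}"

lemma perm_rank_0 [simp]: "perm_rank w 0 q = 0"
  by (simp add: perm_rank_def)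

lemma perm_rank_Suc: "perm_rank w (Suc p) q = perm_rank w p q + (if q < w (Suc p) then 1 else 0)"
proof -
  have "{j \<in> {1..Suc p}. q < w j} =
      (if q < w (Suc p) then insert (Suc p) {j \<in> {1..p}. q < w j} else {j \<in> {1..p}. q < w j})"
    by (auto simp: le_Suc_eq)
  then show ?thesis
    by (simp add: perm_rank_def)
qed

text \<open>The transposition of i and i + 1 maps {1..p} to itself unless p = i, so only row i of
  the rank table can change.\<close>

lemma perm_rank_swap:
  assumes "p \<noteq> i" "1 \<le> i"
  shows "perm_rank (w \<circ> adj_swap i) p q = perm_rank w p q"
proof -
  have "bij_betw (adj_swap i) {j \<in> {1..p}. q < (w \<circ> adj_swap i) j} {j \<in> {1..p}. q < w j}"
    by (rule bij_betw_byWitness[where f' = "adj_swap i"]) (use assms in \<open>auto simp: transpose_def\<close>)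
  then show ?thesis
    unfolding perm_rank_def by (rule bij_betw_same_card)
qed

lemma perm_rank_two_rows:
  assumes "1 \<le> i"
  shows "perm_rank w i q = perm_rank w (i - 1) q + (if q < w i then 1 else 0)"
    and "perm_rank w (Suc i) q = perm_rank w (i - 1) q + (if q < w i then 1 else 0) + (if q < w (Suc i) then 1 else 0)"
  using assms by (cases i; simp add: perm_rank_Suc)+

text \<open>Consecutive rows differ by 0 or 1 in each column, so row i is confined by its two
  neighbours. An ascent at i takes the least row that they allow, and a descent, in the next lemma,
  the largest one.\<close>

lemma perm_rank_ascent:
  assumes "1 \<le> i" "w i < w (Suc i)"
  shows "perm_rank w i q = max (perm_rank w (i - 1) q) (perm_rank w (Suc i) q - 1)"
  using assms by (auto simp: perm_rank_two_rows)

lemma perm_rank_descent: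
  assumes "1 \<le> i" "w (Suc i) < w i"
  shows "perm_rank w i q = min (Suc (perm_rank w (i - 1) q)) (perm_rank w (Suc i) q)"
  using assms by (auto simp: perm_rank_two_rows)

section \<open>Length of a permutation\<close>

definition inversions :: "nat \<Rightarrow> (nat \<Rightarrow> nat) \<Rightarrow> (nat \<times> nat) set" where
  "inversions N w = {(x, y). 1 \<le> x \<and> x < y \<and> y \<le> N \<and> w y < w x}"

definition inv_count :: "nat \<Rightarrow> (nat \<Rightarrow> nat) \<Rightarrow> nat" where
  "inv_count N w = card (inversions N w)"

lemma finite_inversions: "finite (inversions N w)"
  by (rule finite_subset[of _ "{1..N} \<times> {1..N}"]) (auto simp: inversions_def)

text \<open>\<open>adj_swap i\<close> preserves the order of every pair of positions other than i
  and i + 1. It therefore carries the old inversions to new ones, and the pair (i, i + 1) is the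
  only addition.\<close>

lemma inv_count_swap:
  assumes i: "1 \<le> i" "i < N" and asc: "w i < w (Suc i)"
  shows "inv_count N (w \<circ> adj_swap i) = Suc (inv_count N w)"
proof -
  let ?m = "map_prod (adj_swap i) (adj_swap i)"
  have mono: "(adj_swap i x < adj_swap i y) = (x < y)" if "x \<noteq> y" "{x, y} \<noteq> {i, Suc i}" for x y
    using that by (auto simp: transpose_def split: if_splits)
  have range: "1 \<le> adj_swap i x \<longleftrightarrow> 1 \<le> x" "adj_swap i x \<le> N \<longleftrightarrow> x \<le> N" for x
    using i by (auto simp: transpose_def)
  have key: "(x, y) \<in> inversions N (w \<circ> adj_swap i) \<longleftrightarrow> (x, y) = (i, Suc i) \<or> (adj_swap i x, adj_swap i y) \<in> inversions N w" for x y
  proof (cases "{x, y} = {i, Suc i}")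
    case True
    then show ?thesis using i asc by (auto simp: inversions_def doubleton_eq_iff)
  next
    case False
    show ?thesis
    proof (cases "x = y")
      case True
      then show ?thesis by (auto simp: inversions_def)
    next
      case neq: False
      have "(x, y) \<noteq> (i, Suc i)" using False by auto
      then show ?thesis using mono[OF neq False] range by (auto simp: inversions_def)
    qed
  qed
  have "inversions N (w \<circ> adj_swap i) = insert (i, Suc i) (?m ` inversions N w)"
  proof (rule set_eqI, clarify)
    fix x y
    have "(adj_swap i x, adj_swap i y) \<in> inversions N w \<longleftrightarrow> (x, y) \<in> ?m ` inversions N w"
      by (force simp: image_iff)
    then show "(x, y) \<in> inversions N (w \<circ> adj_swap i) \<longleftrightarrow> (x, y) \<in> insert (i, Suc i) (?m ` inversions N w)"
      using key by auto
  qed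
  moreover have "(i, Suc i) \<notin> ?m ` inversions N w"
    by (auto simp: inversions_def image_iff transpose_def split: if_splits)
  moreover have "inj ?m"
    by (intro prod.inj_map inj_on_inverseI[where g = "adj_swap i"]) auto
  ultimately show ?thesis
    by (simp add: inv_count_def finite_inversions card_image inj_on_subset[of ?m UNIV])
qed

lemma inv_count_swap_descent:
  assumes "1 \<le> i" "i < N" "w (Suc i) < w i"
  shows "inv_count N w = Suc (inv_count N (w \<circ> adj_swap i))"
  using inv_count_swap[of i N "w \<circ> adj_swap i"] assms by (simp add: comp_assoc)

lemma increasing_permutes_id:
  assumes w: "w permutes {1..N}" and asc: "\<And>i. 1 \<le> i \<Longrightarrow> i < N \<Longrightarrow> w i < w (Suc i)"
  shows "w = id"
proof
  fix k
  have ge: "k \<le> w k" if "1 \<le> k" "k \<le> N" for k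
    using that
  proof (induction k)
    case (Suc k)
    show ?case
    proof (cases "k = 0")
      case True
      then show ?thesis using permutes_in_image[OF w, of 1] Suc.prems by auto
    next
      case False
      then show ?thesis using Suc asc[of k] by auto
    qed
  qed simp
  have le: "w k \<le> k" if "1 \<le> k" "k \<le> N" for k
    using that(2,1)
  proof (induction k rule: inc_induct)
    case base
    then show ?case using permutes_in_image[OF w, of N] by auto
  next
    case (step k)
    then show ?case using asc[of k] by auto
  qed
  show "w k = id k"
    using ge[of k] le[of k] permutes_not_in[OF w, of k] by (cases "k \<in> {1..N}") auto
qed

lemma swap_permutes:
  assumes "w permutes {1..N}" "1 \<le> i" "i < N"
  shows "w \<circ> adj_swap i permutes {1..N}"
  using assms by (intro permutes_compose permutes_swap_id) auto

text \<open>Rank 0 at the diagonal cells (p, p) means that each {1..p} is mapped into itself. A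
  descent at i would then squeeze i + 1 values into {1..i}.\<close>

lemma permutes_perm_rank_le_id:
  assumes u: "u permutes {1..N}" and le: "\<And>p q. p \<le> N \<Longrightarrow> perm_rank u p q \<le> perm_rank id p q"
  shows "u = id"
proof -
  have below: "u j \<le> p" if "1 \<le> j" "j \<le> p" "p \<le> N" for j p
  proof -
    have "perm_rank id p p = 0" by (auto simp: perm_rank_def)
    then have "perm_rank u p p = 0" using le[of p p] that by simp
    then have "{j \<in> {1..p}. p < u j} = {}" by (simp add: perm_rank_def)
    then show ?thesis using that by force
  qed
  show ?thesis
  proof (rule increasing_permutes_id[OF u])
    fix i assume i: "1 \<le> i" "i < N"
    show "u i < u (Suc i)"
    proof (rule ccontr)
      assume "\<not> u i < u (Suc i)"
      then have "u (Suc i) \<le> i" using below[of i i] i by simp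
      then have "u ` {1..Suc i} \<subseteq> {1..i}"
        using below[of _ i] i permutes_in_image[OF u] by (force simp: le_Suc_eq)
      then have "card (u ` {1..Suc i}) \<le> i"
        using card_mono[of "{1..i}"] by fastforce
      then show False
        using permutes_inj_on[OF u] by (simp add: card_image)
    qed
  qed
qed

text \<open>The rank functions describe the Bruhat order, so this is its strict monotonicity under
  length. The induction uses the lifting property at a descent of \<open>v\<close>.\<close>

lemma inv_count_mono_perm_rank:
  assumes "u permutes {1..N}" "v permutes {1..N}" "\<And>p q. p \<le> N \<Longrightarrow> perm_rank u p q \<le> perm_rank v p q"
  shows "inv_count N u \<le> inv_count N v \<and> (inv_count N u = inv_count N v \<longrightarrow> u = v)"
  using assms
proof (induction "inv_count N v" arbitrary: u v rule: less_induct)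
  case less
  note u = less.prems(1) and v = less.prems(2) and le = less.prems(3)
  show ?case
  proof (cases "\<exists>i. 1 \<le> i \<and> i < N \<and> v (Suc i) < v i")
    case False
    have "v i < v (Suc i)" if "1 \<le> i" "i < N" for i
      using False that inj_eq[OF permutes_inj[OF v], of i "Suc i"] by force
    then have "v = id" by (rule increasing_permutes_id[OF v])
    then show ?thesis using permutes_perm_rank_le_id[OF u] le by simp
  next
    case True
    then obtain i where i: "1 \<le> i" "i < N" "v (Suc i) < v i" by blast
    let ?v = "v \<circ> adj_swap i"
    have asc: "?v i < ?v (Suc i)" using i by simp
    have cv: "inv_count N v = Suc (inv_count N ?v)" using inv_count_swap_descent i by blast
    have pv: "?v permutes {1..N}" using swap_permutes v i by blast
    \<comment> \<open>\<open>?v\<close> ascends at i, so its row i is the least one compatible with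
      rows i - 1 and i + 1, which it shares with v.\<close>
    have rowv: "perm_rank ?v i q = max (perm_rank v (i - 1) q) (perm_rank v (Suc i) q - 1)" for q
      using perm_rank_ascent[of i ?v q] i asc perm_rank_swap[of "i - 1" i v q] perm_rank_swap[of "Suc i" i v q] by simp
    consider "u i < u (Suc i)" | "u (Suc i) < u i"
      using inj_eq[OF permutes_inj[OF u], of i "Suc i"] by force
    then show ?thesis
    proof cases
      case 1
      \<comment> \<open>Only v descends at i, so u is already below \<open>?v\<close>; the length of
        u is then strictly smaller than that of v, and the equality case is void.\<close>
      have "perm_rank u p q \<le> perm_rank ?v p q" if "p \<le> N" for p q
      proof (cases "p = i")
        case True
        have "max (perm_rank u (i - 1) q) (perm_rank u (Suc i) q - 1) \<le> max (perm_rank v (i - 1) q) (perm_rank v (Suc i) q - 1)"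
          using i le by (intro max.mono diff_le_mono) auto
        then show ?thesis
          using rowv[of q] perm_rank_ascent[of i u q] i 1 True by metis
      next
        case False
        then show ?thesis using le[OF that] perm_rank_swap[of p i v q] i by simp
      qed
      then have "inv_count N u \<le> inv_count N ?v"
        using less.hyps[OF _ u pv] cv by simp
      then show ?thesis using cv by simp
    next
      case 2
      let ?u = "u \<circ> adj_swap i"
      have cu: "inv_count N u = Suc (inv_count N ?u)" using inv_count_swap_descent i 2 by blast
      have pu: "?u permutes {1..N}" using swap_permutes u i by blast
      have rowu: "perm_rank ?u i q = max (perm_rank u (i - 1) q) (perm_rank u (Suc i) q - 1)" for q
        using perm_rank_ascent[of i ?u q] i 2 perm_rank_swap[of "i - 1" i u q] perm_rank_swap[of "Suc i" i u q] by simp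
      have "perm_rank ?u p q \<le> perm_rank ?v p q" if "p \<le> N" for p q
      proof (cases "p = i")
        case True
        have "max (perm_rank u (i - 1) q) (perm_rank u (Suc i) q - 1) \<le> max (perm_rank v (i - 1) q) (perm_rank v (Suc i) q - 1)"
          using i le by (intro max.mono diff_le_mono) auto
        then show ?thesis
          using rowu[of q] rowv[of q] True by metis
      next
        case False
        then show ?thesis using le[OF that] perm_rank_swap[of p i v q] perm_rank_swap[of p i u q] i by simp
      qed
      then have *: "inv_count N ?u \<le> inv_count N ?v \<and> (inv_count N ?u = inv_count N ?v \<longrightarrow> ?u = ?v)"
        using less.hyps[OF _ pu pv] cv by simp
      have "u = v" if "?u = ?v"
      proof -
        have "?u \<circ> adj_swap i = ?v \<circ> adj_swap i" using that by simp
        then show ?thesis by (simp add: comp_assoc)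
      qed
      then show ?thesis using * cu cv by auto
    qed
  qed
qed

section \<open>Matchings of a circle and cuts\<close>

text \<open>The involution is a total function that fixes everything outside 1..2N, so that two
  matchings with the same edges are equal as functions.\<close>

definition matching :: "nat \<Rightarrow> (nat \<Rightarrow> nat) \<Rightarrow> bool" where
  "matching N f \<longleftrightarrow> (\<forall>k. f (f k) = k) \<and> (\<forall>k. f k = k \<longleftrightarrow> k \<notin> {1..2 * N})"

lemma matching_invol [simp]: "matching N f \<Longrightarrow> f (f k) = k"
  by (simp add: matching_def)

lemma matching_fixed: "matching N f \<Longrightarrow> f k = k \<longleftrightarrow> k \<notin> {1..2 * N}"
  by (simp add: matching_def)

lemma matching_eq_iff: "matching N f \<Longrightarrow> f x = f y \<longleftrightarrow> x = y"
  by (metis matching_invol)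

lemma matching_in: "matching N f \<Longrightarrow> f k \<in> {1..2 * N} \<longleftrightarrow> k \<in> {1..2 * N}"
  by (metis matching_fixed matching_invol)

text \<open>One operation serves three purposes: the effect of a U-prime, the resolution of a
  crossing, and the merging of two parallel edges. The branch that returns f covers the case where a
  U-prime merely closes a loop.\<close>

definition reconnect :: "(nat \<Rightarrow> nat) \<Rightarrow> nat \<Rightarrow> nat \<Rightarrow> nat \<Rightarrow> nat" where
  "reconnect f a b = (if a = b \<or> f a = b then f else f(a := b, b := a, f a := f b, f b := f a))"

lemma reconnect_apply:
  assumes "matching N f" "a \<in> {1..2 * N}" "b \<in> {1..2 * N}" "a \<noteq> b" "f a \<noteq> b"
  shows "reconnect f a b k = (if k = a then b else if k = b then a else if k = f a then f b
    else if k = f b then f a else f k)"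
proof -
  have "f a \<noteq> a" "f b \<noteq> b" "f b \<noteq> a"
    using assms(2-5) matching_fixed[OF assms(1)] matching_invol[OF assms(1)] by auto
  moreover have "f a \<noteq> f b"
    using assms(4) matching_eq_iff[OF assms(1)] by blast
  ultimately show ?thesis using assms(4,5) by (simp add: reconnect_def)
qed

lemma reconnect_simps:
  assumes "matching N f" "a \<in> {1..2 * N}" "b \<in> {1..2 * N}" "a \<noteq> b" "f a \<noteq> b"
  shows "reconnect f a b a = b" "reconnect f a b b = a" "reconnect f a b (f a) = f b"
    "reconnect f a b (f b) = f a" "k \<notin> {a, b, f a, f b} \<Longrightarrow> reconnect f a b k = f k"
proof -
  have "f a \<noteq> a" "f b \<noteq> b" "f b \<noteq> a" "f a \<noteq> f b"
    using assms matching_fixed[OF assms(1)] matching_eq_iff[OF assms(1)] by auto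
  then show "reconnect f a b a = b" "reconnect f a b b = a" "reconnect f a b (f a) = f b"
    "reconnect f a b (f b) = f a" "k \<notin> {a, b, f a, f b} \<Longrightarrow> reconnect f a b k = f k"
    using assms by (simp_all add: reconnect_apply)
qed

lemma reconnect_matching:
  assumes "matching N f" "a \<in> {1..2 * N}" "b \<in> {1..2 * N}"
  shows "matching N (reconnect f a b)"
proof (cases "a = b \<or> f a = b")
  case True
  then show ?thesis using assms by (auto simp: reconnect_def)
next
  case False
  then have ne: "a \<noteq> b" "f a \<noteq> b" by auto
  note rs = reconnect_simps[OF assms ne]
  have rg: "f a \<in> {1..2 * N}" "f b \<in> {1..2 * N}" using assms matching_in by blast+
  have ne': "f a \<noteq> f b" using ne matching_eq_iff[OF assms(1)] by blast
  have "reconnect f a b (reconnect f a b k) = k \<and> (reconnect f a b k = k \<longleftrightarrow> k \<notin> {1..2 * N})" for k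
  proof (cases "k \<in> {a, b, f a, f b}")
    case True
    then show ?thesis using rs(1-4) ne ne' rg assms(2,3) by (elim insertE emptyE) simp_all
  next
    case other: False
    have "f k \<notin> {a, b, f a, f b}"
      using other matching_invol[OF assms(1)] by (metis insertE insertI1 insertI2 emptyE)
    then show ?thesis using other rs(5) matching_invol[OF assms(1)] matching_fixed[OF assms(1)] by simp
  qed
  then show ?thesis unfolding matching_def by blast
qed

lemma reconnect_commute:
  assumes "matching N f" "a \<in> {1..2 * N}" "b \<in> {1..2 * N}"
  shows "reconnect f a b = reconnect f b a"
proof (cases "a = b \<or> f a = b")
  case True
  then show ?thesis using assms by (auto simp: reconnect_def)
next
  case False
  then have ne: "a \<noteq> b" "f a \<noteq> b" "b \<noteq> a" "f b \<noteq> a" using assms by auto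
  note rs = reconnect_simps[OF assms ne(1,2)] reconnect_simps[OF assms(1,3,2) ne(3,4)]
  show ?thesis
  proof
    fix k
    show "reconnect f a b k = reconnect f b a k"
    proof (cases "k \<in> {a, b, f a, f b}")
      case True
      then show ?thesis using rs(1-4,6-9) by (elim insertE emptyE) simp_all
    next
      case False
      then show ?thesis using rs(5,10) by simp
    qed
  qed
qed

text \<open>Together with symmetry in a and b this leaves exactly two ways to reconnect a given pair
  of edges.\<close>

lemma reconnect_partners:
  assumes "matching N f" "a \<in> {1..2 * N}" "b \<in> {1..2 * N}"
  shows "reconnect f (f a) (f b) = reconnect f a b"
proof (cases "a = b \<or> f a = b")
  case True
  then show ?thesis using assms by (auto simp: reconnect_def)
next
  case False
  then have ne: "a \<noteq> b" "f a \<noteq> b" "f a \<noteq> f b" "f (f a) \<noteq> f b"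
    using matching_invol[OF assms(1)] matching_eq_iff[OF assms(1)] by metis+
  have rg: "f a \<in> {1..2 * N}" "f b \<in> {1..2 * N}" using assms matching_in by blast+
  note rs = reconnect_simps[OF assms ne(1,2)] reconnect_simps[OF assms(1) rg ne(3,4)]
  note rs' = rs[unfolded matching_invol[OF assms(1)]]
  show ?thesis
  proof
    fix k
    show "reconnect f (f a) (f b) k = reconnect f a b k"
    proof (cases "k \<in> {a, b, f a, f b}")
      case True
      then show ?thesis using rs'(1-4,6-9) by (elim insertE emptyE) simp_all
    next
      case False
      then show ?thesis using rs'(5,10) by simp
    qed
  qed
qed

section \<open>Edges leaving a set, and lines across the rectangle\<close>

definition cut_size :: "(nat \<Rightarrow> nat) \<Rightarrow> nat set \<Rightarrow> nat" where
  "cut_size f S = card {k \<in> S. f k \<notin> S}"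

lemma cut_split:
  assumes "finite S" "finite A"
  shows "cut_size f S = card {k \<in> S - A. f k \<notin> S} + (\<Sum>k\<in>A. of_bool (k \<in> S \<and> f k \<notin> S))"
proof -
  have "{k \<in> S. f k \<notin> S} = {k \<in> S - A. f k \<notin> S} \<union> {k \<in> A. k \<in> S \<and> f k \<notin> S}"
    by auto
  then have "cut_size f S = card {k \<in> S - A. f k \<notin> S} + card {k \<in> A. k \<in> S \<and> f k \<notin> S}"
    unfolding cut_size_def using assms by (simp only:) (subst card_Un_disjoint; auto)
  also have "card {k \<in> A. k \<in> S \<and> f k \<notin> S} = (\<Sum>k\<in>A. of_bool (k \<in> S \<and> f k \<notin> S))"
    using assms by (simp add: sum_of_bool_eq Int_def conj_ac)
  finally show ?thesis .
qed

text \<open>A balance kept free of subtraction: nodes other than the four ends contribute equally to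
  both cuts, so it suffices to compare the two edges removed with the two inserted.\<close>

lemma cut_reconnect:
  assumes f: "matching N f" "a \<in> {1..2 * N}" "b \<in> {1..2 * N}" "a \<noteq> b" "f a \<noteq> b"
    and S: "finite S"
  shows "cut_size (reconnect f a b) S + of_bool ((a \<in> S) \<noteq> (f a \<in> S)) + of_bool ((b \<in> S) \<noteq> (f b \<in> S))
    = cut_size f S + of_bool ((a \<in> S) \<noteq> (b \<in> S)) + of_bool ((f a \<in> S) \<noteq> (f b \<in> S))"
proof -
  let ?A = "{a, b, f a, f b}"
  let ?g = "reconnect f a b"
  note rs = reconnect_simps[OF f]
  have ne: "b \<notin> {a}" "f a \<notin> {a, b}" "f b \<notin> {a, b, f a}"
    using f(4,5) matching_fixed[OF f(1)] f(2,3) matching_eq_iff[OF f(1)] matching_invol[OF f(1)] by auto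
  have sum4: "(\<Sum>k\<in>?A. h k) = h a + h b + h (f a) + h (f b)" for h :: "nat \<Rightarrow> nat"
    using ne by (simp add: insert_commute)
  have "{k \<in> S - ?A. ?g k \<notin> S} = {k \<in> S - ?A. f k \<notin> S}"
    using rs(5) by auto
  then have "cut_size ?g S + (of_bool (a \<in> S \<and> f a \<notin> S) + of_bool (b \<in> S \<and> f b \<notin> S)
       + of_bool (f a \<in> S \<and> a \<notin> S) + of_bool (f b \<in> S \<and> b \<notin> S)) =
     cut_size f S + (of_bool (a \<in> S \<and> b \<notin> S) + of_bool (b \<in> S \<and> a \<notin> S)
       + of_bool (f a \<in> S \<and> f b \<notin> S) + of_bool (f b \<in> S \<and> f a \<notin> S))"
    using cut_split[OF S, of ?A f] cut_split[OF S, of ?A ?g]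
    by (simp only: sum4 rs(1-4) matching_invol[OF f(1)] finite.intros simp_thms)
  then show ?thesis
    by (cases "a \<in> S"; cases "b \<in> S"; cases "f a \<in> S"; cases "f b \<in> S"; simp)
qed

lemma cut_conj:
  assumes "\<And>k. s (s k) = k" "\<And>k. s k \<in> S \<longleftrightarrow> k \<in> S"
  shows "cut_size (\<lambda>k. s (f (s k))) S = cut_size f S"
proof -
  have "bij_betw s {k \<in> S. s (f (s k)) \<notin> S} {k \<in> S. f k \<notin> S}"
    by (rule bij_betw_byWitness[where f' = s]) (use assms in auto)
  then show ?thesis unfolding cut_size_def by (rule bij_betw_same_card)
qed

lemma cut_complement:
  assumes "matching N f" "S \<subseteq> {1..2 * N}"
  shows "cut_size f ({1..2 * N} - S) = cut_size f S"
proof -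
  have "bij_betw f {k \<in> {1..2 * N} - S. f k \<notin> {1..2 * N} - S} {k \<in> S. f k \<notin> S}"
  proof (rule bij_betw_byWitness[where f' = f])
    show "f ` {k \<in> S. f k \<notin> S} \<subseteq> {k \<in> {1..2 * N} - S. f k \<notin> {1..2 * N} - S}"
      using assms(2) matching_in[OF assms(1)] matching_invol[OF assms(1)] by (auto simp del: atLeastAtMost_iff)
  qed (use matching_in[OF assms(1)] matching_invol[OF assms(1)] in \<open>auto simp del: atLeastAtMost_iff\<close>)
  then show ?thesis unfolding cut_size_def by (rule bij_betw_same_card)
qed

lemma cut_insert:
  assumes "\<And>k. f (f k) = k" "v \<notin> S" "f v \<noteq> v" "finite S"
  shows "int (cut_size f (insert v S)) = int (cut_size f S) + (if f v \<in> S then - 1 else 1)"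
proof (cases "f v \<in> S")
  case True
  have "{k \<in> S. f k \<notin> S} = insert (f v) {k \<in> insert v S. f k \<notin> insert v S}"
    using assms True by auto
  moreover have "f v \<notin> {k \<in> insert v S. f k \<notin> insert v S}"
    using assms by auto
  ultimately show ?thesis using True assms(4) by (simp add: cut_size_def)
next
  case False
  have "{k \<in> insert v S. f k \<notin> insert v S} = insert v {k \<in> S. f k \<notin> S}"
    using assms False by auto
  then show ?thesis using False assms by (simp add: cut_size_def)
qed

text \<open>An edge inside S keeps both of its ends from counting. The missing 2 is what pushes a
  line beside a hook strictly below |p - q|.\<close>

lemma cut_le_with_edge:
  assumes "finite S" "a \<in> S" "f a \<in> S" "f a \<noteq> a" "f (f a) = a"
  shows "cut_size f S + 2 \<le> card S"
proof -
  have "cut_size f S \<le> card (S - {a, f a})"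
    unfolding cut_size_def by (rule card_mono) (use assms in auto)
  moreover have "card (S - {a, f a}) = card S - 2" "2 \<le> card S"
    using assms card_mono[of S "{a, f a}"] by (simp_all add: card_Diff_subset)
  ultimately show ?thesis by linarith
qed

text \<open>The nodes to the left of the line from upper gap p to lower gap q: an arc of the circle
  through the junction of 2N and 1.\<close>

definition side :: "nat \<Rightarrow> nat \<Rightarrow> nat \<Rightarrow> nat set" where
  "side N p q = {1..p} \<union> {2 * N + 1 - q..2 * N}"

definition leaving :: "nat \<Rightarrow> (nat \<Rightarrow> nat) \<Rightarrow> nat \<Rightarrow> nat \<Rightarrow> int" where
  "leaving N f p q = int (cut_size f (side N p q))"

lemma leaving_nonneg: "0 \<le> leaving N f p q"
  by (simp add: leaving_def)

lemma leaving_0: "leaving N f 0 0 = 0"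
  by (simp add: leaving_def side_def cut_size_def)

text \<open>When the line moves past a node, the edge at this node stops leaving if its partner is
  already on the left, and starts to leave otherwise. The steps of exactly 1 give the Lipschitz
  bounds as well as the parity.\<close>

lemma leaving_Suc_upper:
  assumes "matching N f" "p < N" "q \<le> N"
  shows "leaving N f (Suc p) q = leaving N f p q + (if f (Suc p) \<in> side N p q then - 1 else 1)"
proof -
  have "side N (Suc p) q = insert (Suc p) (side N p q)" "Suc p \<notin> side N p q"
    using assms by (auto simp: side_def)
  then show ?thesis
    unfolding leaving_def using assms cut_insert[of f "Suc p" "side N p q"] matching_fixed[of N f "Suc p"]
    by (simp add: side_def)
qed

lemma leaving_Suc_lower:
  assumes "matching N f" "p \<le> N" "q < N"
  shows "leaving N f p (Suc q) = leaving N f p q + (if f (2 * N - q) \<in> side N p q then - 1 else 1)"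
proof -
  have "side N p (Suc q) = insert (2 * N - q) (side N p q)" "2 * N - q \<notin> side N p q"
    using assms by (auto simp: side_def)
  then show ?thesis
    unfolding leaving_def using assms cut_insert[of f "2 * N - q" "side N p q"] matching_fixed[of N f "2 * N - q"]
    by (simp add: side_def)
qed

lemma leaving_lipschitz_upper:
  assumes "matching N f" "q \<le> N" "p \<le> p'" "p' \<le> N"
  shows "\<bar>leaving N f p' q - leaving N f p q\<bar> \<le> int p' - int p"
  using assms(3,4)
proof (induction p' rule: dec_induct)
  case (step n)
  then show ?case using leaving_Suc_upper[OF assms(1), of n q] assms by (auto split: if_splits)
qed simp

lemma leaving_lipschitz_lower:
  assumes "matching N f" "p \<le> N" "q \<le> q'" "q' \<le> N"
  shows "\<bar>leaving N f p q' - leaving N f p q\<bar> \<le> int q' - int q"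
  using assms(3,4)
proof (induction q' rule: dec_induct)
  case (step n)
  then show ?case using leaving_Suc_lower[OF assms(1), of p n] assms by (auto split: if_splits)
qed simp

lemma leaving_lipschitz:
  assumes "matching N f" "p \<le> N" "q \<le> N" "p' \<le> N" "q' \<le> N"
  shows "leaving N f p' q' \<le> leaving N f p q + \<bar>int p' - int p\<bar> + \<bar>int q' - int q\<bar>"
proof -
  have "\<bar>leaving N f p' q' - leaving N f p q'\<bar> \<le> \<bar>int p' - int p\<bar>"
    using leaving_lipschitz_upper[OF assms(1,5), of p p'] leaving_lipschitz_upper[OF assms(1,5), of p' p] assms
    by (cases "p \<le> p'") auto
  moreover have "\<bar>leaving N f p q' - leaving N f p q\<bar> \<le> \<bar>int q' - int q\<bar>"
    using leaving_lipschitz_lower[OF assms(1,2), of q q'] leaving_lipschitz_lower[OF assms(1,2), of q' q] assms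
    by (cases "q \<le> q'") auto
  ultimately show ?thesis by linarith
qed

lemma leaving_parity:
  assumes "matching N f" "p \<le> N" "q \<le> N"
  shows "even (leaving N f p q + int p + int q)"
  using assms(2)
proof (induction p)
  case 0
  show ?case using assms(3)
  proof (induction q)
    case (Suc q)
    then show ?case using leaving_Suc_lower[OF assms(1), of 0 q] by (auto split: if_splits)
  qed (simp add: leaving_0)
next
  case (Suc p)
  then show ?case using leaving_Suc_upper[OF assms(1), of p q] assms by (auto split: if_splits)
qed

definition through :: "nat \<Rightarrow> (nat \<Rightarrow> nat) \<Rightarrow> nat \<Rightarrow> nat \<Rightarrow> int" where
  "through N f p q = max (leaving N f p q) \<bar>int p - int q\<bar>"

definition perm_matching :: "nat \<Rightarrow> (nat \<Rightarrow> nat) \<Rightarrow> nat \<Rightarrow> nat" where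
  "perm_matching N w k =
     (if k \<in> {1..N} then 2 * N + 1 - w k else if k \<in> {N + 1..2 * N} then inv w (2 * N + 1 - k) else k)"

lemma permutes_bounds:
  assumes "w permutes {1..N}" "1 \<le> k" "k \<le> N"
  shows "1 \<le> w k" "w k \<le> N" "1 \<le> inv w k" "inv w k \<le> N"
  using permutes_in_image[OF assms(1), of k] permutes_in_image[OF permutes_inv[OF assms(1)], of k] assms
  by auto

lemma perm_matching_matching:
  assumes "w permutes {1..N}"
  shows "matching N (perm_matching N w)"
  unfolding matching_def
proof (intro conjI allI)
  fix k
  consider "k \<in> {1..N}" | "k \<in> {N + 1..2 * N}" | "k \<notin> {1..2 * N}" by fastforce
  then have "perm_matching N w (perm_matching N w k) = k \<and> (perm_matching N w k = k \<longleftrightarrow> k \<notin> {1..2 * N})"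
  proof cases
    case 1
    then have "1 \<le> w k" "w k \<le> N" using permutes_bounds[OF assms] by auto
    then have "2 * N + 1 - w k \<in> {N + 1..2 * N}" "2 * N + 1 - (2 * N + 1 - w k) = w k" by auto
    then show ?thesis
      using 1 permutes_inverses[OF assms] by (simp add: perm_matching_def)
  next
    case 2
    then have "inv w (2 * N + 1 - k) \<in> {1..N}"
      using permutes_in_image[OF permutes_inv[OF assms], of "2 * N + 1 - k"] by auto
    then show ?thesis
      using 2 permutes_inverses[OF assms] by (simp add: perm_matching_def)
  next
    case 3
    then show ?thesis by (auto simp: perm_matching_def)
  qed
  then show "perm_matching N w (perm_matching N w k) = k" "(perm_matching N w k = k) = (k \<notin> {1..2 * N})"
    by auto
qed

text \<open>Let r be the rank. Then r of the p upper nodes on the left lead to the right. The other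
  p - r occupy as many of the q lower nodes on the left, so q - p + r lower nodes lead to the
  right.\<close>

lemma leaving_perm_matching:
  assumes w: "w permutes {1..N}" and pq: "p \<le> N" "q \<le> N"
  shows "leaving N (perm_matching N w) p q = 2 * int (perm_rank w p q) - int p + int q"
  using pq(1)
proof (induction p)
  case 0
  show ?case using pq(2)
  proof (induction q)
    case (Suc q)
    have "perm_matching N w (2 * N - q) = inv w (Suc q)"
      using Suc.prems by (auto simp: perm_matching_def Suc_diff_le)
    moreover have "inv w (Suc q) \<notin> side N 0 q"
      using permutes_bounds[OF w, of "Suc q"] Suc.prems by (auto simp: side_def)
    ultimately show ?case
      using Suc leaving_Suc_lower[OF perm_matching_matching[OF w], of 0 q] by simp
  qed (simp add: leaving_0)
next
  case (Suc p)
  have "perm_matching N w (Suc p) = 2 * N + 1 - w (Suc p)"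
    using Suc.prems by (simp add: perm_matching_def)
  moreover have "2 * N + 1 - w (Suc p) \<in> side N p q \<longleftrightarrow> w (Suc p) \<le> q"
    using permutes_bounds[OF w, of "Suc p"] Suc.prems pq by (auto simp: side_def)
  ultimately show ?case
    using Suc pq leaving_Suc_upper[OF perm_matching_matching[OF w], of p q] by (simp add: perm_rank_Suc)
qed

text \<open>On the borders q = 0 and p = 0 every node of the left side leads across, which gives the
  values p and q. The Lipschitz bound carries both estimates to (p, q).\<close>

lemma perm_matching_ge:
  assumes w: "w permutes {1..N}" and pq: "p \<le> N" "q \<le> N"
  shows "\<bar>int p - int q\<bar> \<le> leaving N (perm_matching N w) p q"
proof -
  have "{j \<in> {1..p}. 0 < w j} = {1..p}"
    using permutes_bounds(1)[OF w] pq by force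
  then have "perm_rank w p 0 = p" by (simp add: perm_rank_def)
  then have "leaving N (perm_matching N w) p 0 = int p"
    using leaving_perm_matching[OF w, of p 0] pq by simp
  moreover have "leaving N (perm_matching N w) 0 q = int q"
    using leaving_perm_matching[OF w, of 0 q] pq by simp
  ultimately show ?thesis
    using leaving_lipschitz[OF perm_matching_matching[OF w], of p q p 0]
      leaving_lipschitz[OF perm_matching_matching[OF w], of p q 0 q] pq by simp
qed

section \<open>Words acting on matchings\<close>

text \<open>A letter is stacked on top, so it concerns only the positions i and i + 1 of the upper
  row: T_i exchanges their labels, U_i joins them and their former partners.\<close>

fun act :: "letter \<Rightarrow> (nat \<Rightarrow> nat) \<Rightarrow> nat \<Rightarrow> nat" where
  "act (T i) f = (\<lambda>k. adj_swap i (f (adj_swap i k)))"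
| "act (U i) f = reconnect f i (Suc i)"

definition word_matching :: "nat \<Rightarrow> word \<Rightarrow> nat \<Rightarrow> nat" where
  "word_matching N F = foldr act F (perm_matching N id)"

lemma word_matching_simps [simp]:
  "word_matching N [] = perm_matching N id"
  "word_matching N (l # F) = act l (word_matching N F)"
  by (simp_all add: word_matching_def)

lemma is_word_simps [simp]:
  "is_word N []"
  "is_word N (l # F) \<longleftrightarrow> 1 \<le> idx l \<and> idx l < N \<and> is_word N F"
  by (auto simp: is_word_def)

lemma sw_in: "1 \<le> i \<Longrightarrow> i < N \<Longrightarrow> adj_swap i k \<in> {1..2 * N} \<longleftrightarrow> k \<in> {1..2 * N}"
  by (auto simp: transpose_def)

lemma act_matching:
  assumes f: "matching N f" and l: "1 \<le> idx l" "idx l < N"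
  shows "matching N (act l f)"
proof (cases l)
  case (T i)
  have "adj_swap i (f (adj_swap i k)) = k \<longleftrightarrow> k \<notin> {1..2 * N}" for k
    using matching_fixed[OF f, of "adj_swap i k"] sw_in[of i N k] T l
    by (metis letter.sel(1) transpose_involutory)
  then show ?thesis using T f by (simp add: matching_def)
next
  case (U i)
  then show ?thesis using f l by (simp add: reconnect_matching)
qed

lemma word_matching_matching: "is_word N F \<Longrightarrow> matching N (word_matching N F)"
  by (induction F) (simp_all add: act_matching perm_matching_matching permutes_id)

text \<open>A line that starts at a gap other than i has i and i + 1 on the same side. Conjugation
  then preserves the cut. After U_i the edge between i and i + 1 does not leave, and the edge
  between the former partners leaves only if one of the old edges did.\<close>

lemma leaving_act:
  assumes f: "matching N f" and l: "1 \<le> idx l" "idx l < N" and p: "p \<noteq> idx l" "p \<le> N" "q \<le> N"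
  shows "leaving N (act l f) p q \<le> leaving N f p q"
proof (cases l)
  case (T i)
  have "adj_swap i k \<in> side N p q \<longleftrightarrow> k \<in> side N p q" for k
    using T l p by (auto simp: side_def transpose_def)
  then have "cut_size (\<lambda>k. adj_swap i (f (adj_swap i k))) (side N p q) = cut_size f (side N p q)"
    by (intro cut_conj) auto
  then show ?thesis using T by (simp add: leaving_def)
next
  case (U i)
  have i: "i \<in> {1..2 * N}" "Suc i \<in> {1..2 * N}" "i \<noteq> Suc i" using U l by auto
  show ?thesis
  proof (cases "f i = Suc i")
    case True
    then show ?thesis using U by (simp add: reconnect_def)
  next
    case False
    have "i \<in> side N p q \<longleftrightarrow> Suc i \<in> side N p q"
      using U l p by (auto simp: side_def)
    then have "cut_size (reconnect f i (Suc i)) (side N p q) \<le> cut_size f (side N p q)"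
      using cut_reconnect[OF f i False, of "side N p q"]
      by (auto simp: side_def of_bool_def split: if_splits)
    then show ?thesis using U by (simp add: leaving_def)
  qed
qed

text \<open>Multiplication in the 0-Hecke monoid: a transposition that would shorten v is absorbed.
  It stands to the right of v because a letter on top is applied first.\<close>

definition demazure :: "nat \<Rightarrow> (nat \<Rightarrow> nat) \<Rightarrow> nat \<Rightarrow> nat" where
  "demazure i v = (if v i < v (Suc i) then v \<circ> adj_swap i else v)"

text \<open>Outside row i the letter does not raise any cut. In row i the Demazure product has a
  descent, so its rank there is the largest one that the neighbouring rows allow, and the Lipschitz
  bound keeps the new matching below it.\<close>

lemma leaving_act_demazure:
  assumes f: "matching N f" and v: "v permutes {1..N}" and l: "1 \<le> idx l" "idx l < N"
    and le: "\<And>p q. p \<le> N \<Longrightarrow> q \<le> N \<Longrightarrow> leaving N f p q \<le> leaving N (perm_matching N v) p q"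
    and pq: "p \<le> N" "q \<le> N"
  shows "leaving N (act l f) p q \<le> leaving N (perm_matching N (demazure (idx l) v)) p q"
proof -
  let ?i = "idx l" and ?v = "demazure (idx l) v"
  have v': "?v permutes {1..N}"
    using swap_permutes v l by (simp add: demazure_def)
  have row: "leaving N (act l f) p q \<le> 2 * int (perm_rank ?v p q) - int p + int q"
    if "p \<noteq> ?i" "p \<le> N" for p
  proof -
    have "perm_rank ?v p q = perm_rank v p q"
      using perm_rank_swap[OF that(1) l(1)] by (simp add: demazure_def)
    then show ?thesis
      using leaving_act[OF f l that pq(2)] le[OF that(2) pq(2)] leaving_perm_matching[OF v that(2) pq(2)] by simp
  qed
  have "leaving N (act l f) p q \<le> 2 * int (perm_rank ?v p q) - int p + int q"
  proof (cases "p = ?i")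
    case True
    have "?i - 1 \<noteq> ?i" "?i - 1 \<le> N" using l by auto
    note below = row[OF this]
    have "?v (Suc ?i) < ?v ?i"
      using inj_eq[OF permutes_inj[OF v], of ?i "Suc ?i"] by (auto simp: demazure_def)
    then have "perm_rank ?v ?i q = min (Suc (perm_rank ?v (?i - 1) q)) (perm_rank ?v (Suc ?i) q)"
      using perm_rank_descent l(1) by blast
    moreover have "leaving N (act l f) ?i q \<le> leaving N (act l f) (?i - 1) q + 1"
      "leaving N (act l f) ?i q \<le> leaving N (act l f) (Suc ?i) q + 1"
      using leaving_lipschitz[OF act_matching[OF f l], of "?i - 1" q ?i q]
        leaving_lipschitz[OF act_matching[OF f l], of "Suc ?i" q ?i q] l pq by auto
    ultimately show ?thesis
      using below row[of "Suc ?i"] l True by (auto simp: of_nat_diff min_def Suc_le_eq)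
  next
    case False
    then show ?thesis using row pq by blast
  qed
  then show ?thesis using leaving_perm_matching[OF v' pq] by simp
qed

lemma act_T_perm_matching:
  assumes v: "v permutes {1..N}" and i: "1 \<le> i" "i < N"
  shows "act (T i) (perm_matching N v) = perm_matching N (v \<circ> adj_swap i)"
proof
  fix k
  have inv: "inv (v \<circ> adj_swap i) x = adj_swap i (inv v x)" for x
    using permutes_inverses[OF v] permutes_inverses[OF swap_permutes[OF v i]]
    by (metis comp_apply transpose_involutory)
  consider "k \<in> {1..N}" | "k \<in> {N + 1..2 * N}" | "k \<notin> {1..2 * N}" by fastforce
  then show "act (T i) (perm_matching N v) k = perm_matching N (v \<circ> adj_swap i) k"
  proof cases
    case 1
    then have k: "adj_swap i k \<in> {1..N}" using i by (auto simp: transpose_def)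
    then have "v (adj_swap i k) \<le> N" using permutes_bounds[OF v] by auto
    then show ?thesis using 1 k i by (auto simp: perm_matching_def transpose_def)
  next
    case 2
    then have "adj_swap i k = k" using i by (auto simp: transpose_def)
    then show ?thesis using 2 inv by (auto simp: perm_matching_def)
  next
    case 3
    then have "adj_swap i k = k" using i by (auto simp: transpose_def)
    then show ?thesis using 3 by (auto simp: perm_matching_def)
  qed
qed

text \<open>v is the Demazure product of the indices of F. If it has as many inversions as F has
  letters, no letter was absorbed, and v is the ordinary product of transpositions, to which
  \<open>tau_word F\<close> composes.\<close>

lemma word_below_demazure:
  assumes "is_word N F"
  shows "\<exists>v. v permutes {1..N} \<and> inv_count N v \<le> length F
    \<and> (\<forall>p q. p \<le> N \<longrightarrow> q \<le> N \<longrightarrow>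
        leaving N (word_matching N F) p q \<le> leaving N (perm_matching N v) p q)
    \<and> (inv_count N v = length F \<longrightarrow> word_matching N (tau_word F) = perm_matching N v)"
  using assms
proof (induction F)
  case Nil
  have "inversions N id = {}" by (auto simp: inversions_def)
  then show ?case
    by (intro exI[of _ id]) (simp add: permutes_id inv_count_def tau_word_def flip: id_def)
next
  case (Cons l F)
  then obtain v where v: "v permutes {1..N}" "inv_count N v \<le> length F"
    "\<And>p q. p \<le> N \<Longrightarrow> q \<le> N \<Longrightarrow> leaving N (word_matching N F) p q \<le> leaving N (perm_matching N v) p q"
    "inv_count N v = length F \<Longrightarrow> word_matching N (tau_word F) = perm_matching N v"
    by auto
  have l: "1 \<le> idx l" "idx l < N" and F: "is_word N F" using Cons.prems by auto
  let ?v = "demazure (idx l) v"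
  have "?v permutes {1..N}"
    using swap_permutes v(1) l by (simp add: demazure_def)
  moreover have "inv_count N ?v \<le> Suc (length F)"
    "inv_count N ?v = Suc (length F) \<longrightarrow> ?v = v \<circ> adj_swap (idx l) \<and> inv_count N v = length F"
    using v(2) inv_count_swap[OF l] by (auto simp: demazure_def)
  moreover have "word_matching N (tau_word (l # F)) = act (T (idx l)) (word_matching N (tau_word F))"
    by (simp add: tau_word_def)
  ultimately show ?case
    using leaving_act_demazure[OF word_matching_matching[OF F] v(1) l v(3)] v(4)
      act_T_perm_matching[OF v(1) l] by (intro exI[of _ ?v]) simp
qed

text \<open>Existence of reduced words: removing a descent by a transposition lowers the number of
  inversions by one.\<close>

lemma perm_matching_word:
  assumes "v permutes {1..N}"
  shows "\<exists>F. is_word N F \<and> length F = inv_count N v \<and> word_matching N F = perm_matching N v"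
  using assms
proof (induction "inv_count N v" arbitrary: v)
  case 0
  have "v i < v (Suc i)" if "1 \<le> i" "i < N" for i
    using inv_count_swap_descent[OF that, of v] 0 inj_eq[OF permutes_inj[OF 0(2)], of i "Suc i"] by force
  then have "v = id" by (rule increasing_permutes_id[OF 0(2)])
  then show ?case using 0 by (intro exI[of _ "[]"]) (simp flip: id_def)
next
  case (Suc n)
  have "\<exists>i. 1 \<le> i \<and> i < N \<and> v (Suc i) < v i"
  proof (rule ccontr)
    assume "\<not> ?thesis"
    then have "v i < v (Suc i)" if "1 \<le> i" "i < N" for i
      using that inj_eq[OF permutes_inj[OF Suc.prems], of i "Suc i"] by force
    then have "v = id" by (rule increasing_permutes_id[OF Suc.prems])
    moreover have "inversions N id = {}" by (auto simp: inversions_def)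
    ultimately show False using Suc.hyps(2) by (simp add: inv_count_def)
  qed
  then obtain i where i: "1 \<le> i" "i < N" "v (Suc i) < v i" by blast
  let ?v = "v \<circ> adj_swap i"
  have pv: "?v permutes {1..N}" using swap_permutes[OF Suc.prems i(1,2)] .
  have cv: "inv_count N v = Suc (inv_count N ?v)" by (rule inv_count_swap_descent[OF i])
  then have "n = inv_count N ?v" using Suc.hyps(2) by simp
  then obtain F where F: "is_word N F" "length F = inv_count N ?v" "word_matching N F = perm_matching N ?v"
    using Suc.hyps(1) pv by blast
  have "act (T i) (perm_matching N ?v) = perm_matching N v"
    using act_T_perm_matching[OF pv i(1,2)] by (simp add: comp_assoc)
  then show ?case
    using F i cv by (intro exI[of _ "T i # F"]) simp
qed

section \<open>Crossings and their two resolutions\<close>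

definition strictly_between :: "nat \<Rightarrow> nat \<Rightarrow> nat \<Rightarrow> bool" where
  "strictly_between x y z \<longleftrightarrow> x < z \<and> z < y \<or> y < z \<and> z < x"

text \<open>Interleaving of the edges at a and b. The linear order of 1..2N may be used because
  interleaving on a circle does not depend on where the circle is cut open.\<close>

definition crossing_at :: "(nat \<Rightarrow> nat) \<Rightarrow> nat \<Rightarrow> nat \<Rightarrow> bool" where
  "crossing_at f a b \<longleftrightarrow> strictly_between a (f a) b \<noteq> strictly_between a (f a) (f b)"

lemma crossing_at_partners:
  assumes "matching N f"
  shows "crossing_at f (f a) b = crossing_at f a b" "crossing_at f a (f b) = crossing_at f a b"
  using matching_invol[OF assms] by (auto simp: crossing_at_def strictly_between_def)

lemma crossing_at_sym:
  assumes "matching N f" "a \<noteq> b" "f a \<noteq> b" "crossing_at f a b"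
  shows "crossing_at f b a"
proof -
  have "f a \<noteq> f b" "f b \<noteq> a" using matching_eq_iff[OF assms(1)] matching_invol[OF assms(1)] assms(2,3) by metis+
  then show ?thesis
    using assms(2-4) unfolding crossing_at_def strictly_between_def by linarith
qed

text \<open>T_i is conjugation by a relabelling, and reconnecting commutes with relabelling.\<close>

lemma act_T_reconnect:
  assumes f: "matching N f" and i: "1 \<le> i" "i < N" and ab: "a \<in> {1..2 * N}" "b \<in> {1..2 * N}"
  shows "act (T i) (reconnect f (adj_swap i a) (adj_swap i b)) = reconnect (act (T i) f) a b"
proof -
  let ?g = "act (T i) f"
  have g: "matching N ?g" using act_matching[OF f, of "T i"] i by simp
  have eq: "f (adj_swap i x) = adj_swap i y \<longleftrightarrow> ?g x = y" "adj_swap i x = f (adj_swap i y) \<longleftrightarrow> x = ?g y" for x y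
    by (metis act.simps(1) transpose_involutory)+
  show ?thesis
  proof (cases "a = b \<or> ?g a = b")
    case True
    then show ?thesis using eq by (auto simp: reconnect_def)
  next
    case False
    have ab': "adj_swap i a \<in> {1..2 * N}" "adj_swap i b \<in> {1..2 * N}" using ab sw_in i by blast+
    have ne: "adj_swap i a \<noteq> adj_swap i b" "f (adj_swap i a) \<noteq> adj_swap i b" "a \<noteq> b" "?g a \<noteq> b"
      using False eq by (metis transpose_involutory, auto)
    note rf = reconnect_simps[OF f ab' ne(1,2)] and rg = reconnect_simps[OF g ab ne(3,4)]
    have swg: "adj_swap i (?g x) = f (adj_swap i x)" for x by simp
    show ?thesis
    proof
      fix k
      have "adj_swap i (reconnect f (adj_swap i a) (adj_swap i b) (adj_swap i k)) = reconnect ?g a b k"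
      proof (cases "k \<in> {a, b, ?g a, ?g b}")
        case True
        then show ?thesis
          by (elim insertE emptyE; simp only: rf(1-4) rg(1-4) swg transpose_involutory)
            (simp_all only: act.simps)
      next
        case other: False
        then have "adj_swap i k \<notin> {adj_swap i a, adj_swap i b, f (adj_swap i a), f (adj_swap i b)}"
          using swg by (metis insertE insertI1 insertI2 emptyE transpose_involutory)
        then show ?thesis using rf(5) rg(5)[OF other] by simp
      qed
      then show "act (T i) (reconnect f (adj_swap i a) (adj_swap i b)) k = reconnect ?g a b k"
        by simp
    qed
  qed
qed

text \<open>Since T_i is an involution, this also says that dropping a T-prime is one resolution of
  the pair of edges that it exchanges. Replacing it by a U-prime is the other one, by
  \<open>reconnect_act_T\<close>.\<close>

lemma act_T_eq_reconnect:
  assumes f: "matching N f" and i: "1 \<le> i" "i < N" and ne: "f i \<noteq> Suc i"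
  shows "act (T i) f = reconnect f i (f (Suc i))"
proof
  fix k
  have ii: "i \<in> {1..2 * N}" "Suc i \<in> {1..2 * N}" using i by auto
  have ne': "f (Suc i) \<noteq> i" "f i \<noteq> i" "f (Suc i) \<noteq> Suc i" "f i \<noteq> f (Suc i)"
    using ne matching_invol[OF f] matching_fixed[OF f] matching_eq_iff[OF f] ii by (metis, metis, metis, metis n_not_Suc_n)
  have rg: "f (Suc i) \<in> {1..2 * N}" using matching_in[OF f] ii by blast
  note rs = reconnect_simps[OF f ii(1) rg ne'(1)[symmetric] ne'(4), unfolded matching_invol[OF f]]
  show "act (T i) f k = reconnect f i (f (Suc i)) k"
  proof (cases "k \<in> {i, Suc i, f i, f (Suc i)}")
    case True
    then show ?thesis
      using rs(1-4) ne ne' matching_invol[OF f] by (elim insertE emptyE) (simp_all add: transpose_def)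
  next
    case False
    then have "f k \<notin> {i, Suc i}" using matching_invol[OF f] by (metis insertE insertI1 insertI2 emptyE)
    then show ?thesis using rs(5)[of k] False by (simp add: transpose_def)
  qed
qed

lemma act_T_act_T [simp]: "act (T i) (act (T i) f) = f"
  by (rule ext) simp

lemma reconnect_act_T:
  assumes f: "matching N f" and i: "1 \<le> i" "i < N" and ne: "f i \<noteq> Suc i"
  shows "reconnect (act (T i) f) i (Suc i) = act (U i) f"
proof
  fix k
  let ?h = "reconnect f (Suc i) i"
  have ii: "i \<in> {1..2 * N}" "Suc i \<in> {1..2 * N}" "Suc i \<noteq> i" using i by auto
  have h: "matching N ?h" by (rule reconnect_matching[OF f ii(2,1)])
  have ne': "f (Suc i) \<noteq> i" using ne matching_invol[OF f] by metis
  have hi: "?h i = Suc i" "?h (Suc i) = i" using reconnect_simps[OF f ii(2,1,3) ne'] by auto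
  have "reconnect (act (T i) f) i (Suc i) = act (T i) ?h"
    using act_T_reconnect[OF f i ii(1,2)] by simp
  moreover have "act (T i) ?h k = ?h k"
  proof (cases "k \<in> {i, Suc i}")
    case True
    then show ?thesis using hi by auto
  next
    case False
    then have "?h k \<notin> {i, Suc i}" using hi matching_invol[OF h] by (metis insertE insertI1 insertI2 emptyE)
    then show ?thesis using False by (simp add: transpose_def)
  qed
  moreover have "?h = act (U i) f"
    using reconnect_commute[OF f ii(2,1)] by simp
  ultimately show "reconnect (act (T i) f) i (Suc i) k = act (U i) f k" by simp
qed

section \<open>Uncrossing two edges\<close>

lemma strictly_between_xor: "c \<noteq> a \<Longrightarrow> c \<noteq> b \<Longrightarrow> strictly_between a b c \<longleftrightarrow> (c < a) \<noteq> (c < b)"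
  by (auto simp: strictly_between_def)

lemma strictly_between_sw:
  assumes "c \<noteq> a" "c \<noteq> b" "{c, a} \<noteq> {i, Suc i}" "{c, b} \<noteq> {i, Suc i}"
  shows "strictly_between (adj_swap i a) (adj_swap i b) (adj_swap i c) = strictly_between a b c"
proof -
  have mono: "(adj_swap i x < adj_swap i y) = (x < y)" if "x \<noteq> y" "{x, y} \<noteq> {i, Suc i}" for x y
    using that by (auto simp: transpose_def split: if_splits)
  show ?thesis
    using assms mono[of c a] mono[of a c] mono[of c b] mono[of b c]
    by (simp add: strictly_between_def insert_commute)
qed

text \<open>\<open>adj_swap i\<close> reverses no comparison except that of i with i + 1, so a
  crossing can be gained or lost only if both are ends of the two edges.\<close>

lemma crossing_at_sw:
  assumes f: "matching N f" and ab: "a \<noteq> b" "f a \<noteq> b"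
    and sep: "\<not> {i, Suc i} \<subseteq> {a, b, f a, f b}"
  shows "crossing_at (act (T i) f) (adj_swap i a) (adj_swap i b) = crossing_at f a b"
proof -
  have ne: "f b \<noteq> a" "f b \<noteq> f a" using ab matching_invol[OF f] by metis+
  have 1: "strictly_between (adj_swap i a) (adj_swap i (f a)) (adj_swap i b) = strictly_between a (f a) b"
    by (rule strictly_between_sw) (use sep ab in \<open>auto simp: doubleton_eq_iff\<close>)
  have 2: "strictly_between (adj_swap i a) (adj_swap i (f a)) (adj_swap i (f b)) = strictly_between a (f a) (f b)"
    by (rule strictly_between_sw) (use sep ne in \<open>auto simp: doubleton_eq_iff\<close>)
  show ?thesis using 1 2 by (simp add: crossing_at_def)
qed

lemma reconnect_disjoint_commute:
  assumes f: "matching N f" and ab: "a \<in> {1..2 * N}" "b \<in> {1..2 * N}" "a \<noteq> b" "f a \<noteq> b"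
    and cd: "c \<in> {1..2 * N}" "d \<in> {1..2 * N}" "c \<noteq> d" "f c \<noteq> d"
    and disj: "{a, b, f a, f b} \<inter> {c, d, f c, f d} = {}"
  shows "reconnect (reconnect f a b) c d = reconnect (reconnect f c d) a b"
proof -
  let ?g = "reconnect f a b" and ?h = "reconnect f c d"
  note ra = reconnect_simps[OF f ab] and rc = reconnect_simps[OF f cd]
  have g: "matching N ?g" and h: "matching N ?h"
    using reconnect_matching[OF f] ab cd by blast+
  have gc: "?g c = f c" "?g d = f d" and ha: "?h a = f a" "?h b = f b"
    using ra(5) rc(5) disj by blast+
  note rg = reconnect_simps[OF g cd(1-3), unfolded gc, OF cd(4)]
    and rh = reconnect_simps[OF h ab(1-3), unfolded ha, OF ab(4)]
  show ?thesis
  proof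
    fix k
    consider (a) "k \<in> {a, b, f a, f b}" | (c) "k \<in> {c, d, f c, f d}"
      | (o) "k \<notin> {a, b, f a, f b}" "k \<notin> {c, d, f c, f d}" by blast
    then show "reconnect ?g c d k = reconnect ?h a b k"
    proof cases
      case a
      then have "k \<notin> {c, d, f c, f d}" using disj by blast
      then have "reconnect ?g c d k = ?g k" by (rule rg(5))
      moreover have "?g k = reconnect ?h a b k"
        using a ra(1-4) rh(1-4) by (elim insertE emptyE) simp_all
      ultimately show ?thesis by simp
    next
      case c
      then have "k \<notin> {a, b, f a, f b}" using disj by blast
      then have "reconnect ?h a b k = ?h k" by (rule rh(5))
      moreover have "?h k = reconnect ?g c d k"
        using c rc(1-4) rg(1-4) by (elim insertE emptyE) simp_all
      ultimately show ?thesis by simp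
    next
      case o
      then show ?thesis using ra(5) rc(5) rg(5) rh(5) by simp
    qed
  qed
qed

text \<open>U_i glues the edges of f at i and i + 1 into one edge from x = \<open>f i\<close> to y =
  \<open>f (Suc i)\<close>. Joining x to b afterwards also joins y to the partner of b, and this can
  be prepared below U_i on either of the two glued pieces.\<close>

lemma reconnect_through_U:
  assumes f: "matching N f" and i: "1 \<le> i" "i < N" and ne: "f i \<noteq> Suc i"
    and b: "b \<in> {1..2 * N}" "b \<notin> {i, Suc i, f i, f (Suc i)}"
  shows "act (U i) (reconnect f (f i) b) = reconnect (act (U i) f) (f i) b"
    and "act (U i) (reconnect f (f (Suc i)) (f b)) = reconnect (act (U i) f) (f i) b"
proof -
  let ?x = "f i" and ?y = "f (Suc i)" and ?c = "f b"
  note fi = matching_invol[OF f] and fe = matching_eq_iff[OF f]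
  have ii: "i \<in> {1..2 * N}" "Suc i \<in> {1..2 * N}" "i \<noteq> Suc i" using i by auto
  have rg: "?x \<in> {1..2 * N}" "?y \<in> {1..2 * N}" "?c \<in> {1..2 * N}"
    using ii b matching_in[OF f] by blast+
  have yi: "?y \<noteq> i" using ne fi by metis
  have nf: "?x \<noteq> i" "?y \<noteq> Suc i" "?c \<noteq> b" using ii b matching_fixed[OF f] by blast+
  have xy: "?x \<noteq> ?y" using fe by simp
  have c: "?c \<notin> {i, Suc i, ?x, ?y}" using b(2) fi fe by (metis insert_iff empty_iff)
  let ?g = "act (U i) f"
  have g_def: "?g = reconnect f i (Suc i)" by simp
  have g: "matching N ?g" using act_matching[OF f, of "U i"] i by simp
  note rg1 = reconnect_simps[OF f ii ne, folded g_def]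
  have gb: "?g b = ?c" using rg1(5) b by blast
  have nx: "?x \<noteq> b" "?g ?x \<noteq> b" using b rg1(3) by auto
  note rt = reconnect_simps[OF g rg(1) b(1) nx, unfolded rg1(3) gb]
  have target: "reconnect ?g ?x b k = (if k = i then Suc i else if k = Suc i then i
      else if k = ?x then b else if k = b then ?x else if k = ?y then ?c else if k = ?c then ?y else f k)" for k
  proof (cases "k \<in> {?x, b, ?y, ?c}")
    case True
    then show ?thesis
      using rt(1-4) c b nf xy ne yi by (elim insertE emptyE) auto
  next
    case False
    then show ?thesis
      using rt(5)[OF False] rg1 by (cases "k \<in> {i, Suc i}") auto
  qed
  show "act (U i) (reconnect f ?x b) = reconnect ?g ?x b"
  proof
    fix k
    let ?h = "reconnect f ?x b"
    have nh: "?x \<noteq> b" "f ?x \<noteq> b" using b fi by auto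
    have h: "matching N ?h" by (rule reconnect_matching[OF f rg(1) b(1)])
    note rh = reconnect_simps[OF f rg(1) b(1) nh, unfolded fi]
    have hs: "?h (Suc i) = ?y" using rh(5) ne b(2) c ii by (metis insert_iff empty_iff)
    have nn: "?h i \<noteq> Suc i" using rh(3) c by simp
    note ru = reconnect_simps[OF h ii nn, unfolded rh(3) hs]
    have "reconnect ?h i (Suc i) k = reconnect ?g ?x b k"
    proof (cases "k \<in> {i, Suc i, ?c, ?y}")
      case True
      then show ?thesis
        unfolding target using ru(1-4) c b nf xy yi ne by (elim insertE emptyE) auto
    next
      case False
      then have "reconnect ?h i (Suc i) k = ?h k" by (rule ru(5))
      also have "?h k = reconnect ?g ?x b k"
        unfolding target using False rh b nf c xy by (cases "k \<in> {?x, b}") auto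
      finally show ?thesis .
    qed
    then show "act (U i) ?h k = reconnect ?g ?x b k" by simp
  qed
  show "act (U i) (reconnect f ?y ?c) = reconnect ?g ?x b"
  proof
    fix k
    let ?h = "reconnect f ?y ?c"
    have nh: "?y \<noteq> ?c" "f ?y \<noteq> ?c" using c fi by auto
    have h: "matching N ?h" by (rule reconnect_matching[OF f rg(2,3)])
    note rh = reconnect_simps[OF f rg(2,3) nh, unfolded fi]
    have hs: "?h i = ?x" using rh(5) yi b(2) c ii by (metis insert_iff empty_iff)
    have nn: "?h i \<noteq> Suc i" using hs ne by simp
    note ru = reconnect_simps[OF h ii nn, unfolded rh(3) hs]
    have "reconnect ?h i (Suc i) k = reconnect ?g ?x b k"
    proof (cases "k \<in> {i, Suc i, ?x, b}")
      case True
      then show ?thesis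
        unfolding target using ru(1-4) c b nf xy yi ne by (elim insertE emptyE) auto
    next
      case False
      then have "reconnect ?h i (Suc i) k = ?h k" by (rule ru(5))
      also have "?h k = reconnect ?g ?x b k"
        unfolding target using False rh b nf c xy by (cases "k \<in> {?y, ?c}") auto
      finally show ?thesis .
    qed
    then show "act (U i) ?h k = reconnect ?g ?x b k" by simp
  qed
qed

text \<open>If i and i + 1 are not both ends of the two edges, T_i only relabels and the crossing is
  resolved further down. Otherwise the crossing is the one made by T_i, and its two resolutions are
  the words with T_i replaced by U_i and with T_i dropped.\<close>

lemma uncross_T:
  assumes F: "is_word N F" and i: "1 \<le> i" "i < N"
    and IH: "\<And>a b. a \<in> {1..2 * N} \<Longrightarrow> b \<in> {1..2 * N} \<Longrightarrow> a \<noteq> b \<Longrightarrow> word_matching N F a \<noteq> b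
      \<Longrightarrow> crossing_at (word_matching N F) a b
      \<Longrightarrow> \<exists>G. is_word N G \<and> length G \<le> length F \<and> word_matching N G = reconnect (word_matching N F) a b"
    and g: "g = word_matching N (T i # F)"
    and ab: "a \<in> {1..2 * N}" "b \<in> {1..2 * N}" "a \<noteq> b" "g a \<noteq> b" and cr: "crossing_at g a b"
  shows "\<exists>G. is_word N G \<and> length G \<le> Suc (length F) \<and> word_matching N G = reconnect g a b"
proof -
  let ?f = "word_matching N F"
  have f: "matching N ?f" by (rule word_matching_matching[OF F])
  have gm: "matching N g" using word_matching_matching[of N "T i # F"] F i g by simp
  have gT: "g = act (T i) ?f" and fT: "?f = act (T i) g" using g act_T_act_T[of i ?f] by simp_all
  have ii: "i \<in> {1..2 * N}" "Suc i \<in> {1..2 * N}" using i by auto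
  note gi = matching_invol[OF gm] and ge = matching_eq_iff[OF gm]
  show ?thesis
  proof (cases "{i, Suc i} \<subseteq> {a, b, g a, g b}")
    case False
    have "crossing_at ?f (adj_swap i a) (adj_swap i b)"
      using crossing_at_sw[OF gm ab(3,4) False] cr fT by simp
    moreover have "adj_swap i a \<noteq> adj_swap i b" "?f (adj_swap i a) \<noteq> adj_swap i b"
      using ab(3,4) gT by (metis transpose_involutory, auto)
    ultimately obtain G where G: "is_word N G" "length G \<le> length F"
        "word_matching N G = reconnect ?f (adj_swap i a) (adj_swap i b)"
      using IH[of "adj_swap i a" "adj_swap i b"] sw_in[OF i] ab by blast
    have "word_matching N (T i # G) = reconnect g a b"
      using act_T_reconnect[OF f i ab(1,2)] G(3) gT by simp
    then show ?thesis using G i by (intro exI[of _ "T i # G"]) simp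
  next
    case True
    \<comment> \<open>An edge between neighbouring positions encloses no node, so it crosses
      nothing.\<close>
    have "g i \<noteq> Suc i"
    proof
      assume *: "g i = Suc i"
      then have "g (Suc i) = i" using gi by metis
      then have "{a, g a} = {i, Suc i} \<or> {b, g b} = {i, Suc i}" using True * gi by auto
      moreover have "crossing_at g b a" by (rule crossing_at_sym[OF gm ab(3,4) cr])
      ultimately show False using cr by (auto simp: crossing_at_def strictly_between_def doubleton_eq_iff)
    qed
    then have sn: "g (Suc i) \<noteq> i" "g i \<noteq> Suc i" using gi by metis+
    have fi: "?f i \<noteq> Suc i" using sn gT fT by (metis act.simps(1) transpose_apply_first transpose_apply_second)
    have c1: "reconnect g i (Suc i) = word_matching N (U i # F)"
      using reconnect_act_T[OF f i fi] gT by simp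
    have c2: "reconnect g i (g (Suc i)) = ?f"
      using act_T_eq_reconnect[OF gm i sn(2)] fT by simp
    note sym = reconnect_commute[OF gm] and par = reconnect_partners[OF gm]
    have rgab: "g a \<in> {1..2 * N}" "g b \<in> {1..2 * N}" using ab matching_in[OF gm] by blast+
    consider "i = a" | "i = g a" | "i = b" | "i = g b" using True by auto
    then have "reconnect g a b = reconnect g i (Suc i) \<or> reconnect g a b = reconnect g i (g (Suc i))"
    proof cases
      case 1
      then have "Suc i = b \<or> Suc i = g b" using True sn by auto
      then show ?thesis using 1 gi by auto
    next
      case 2
      then have "Suc i = b \<or> Suc i = g b" using True sn gi by auto
      then show ?thesis using 2 gi par[OF ab(1,2)] by auto
    next
      case 3
      then have "Suc i = a \<or> Suc i = g a" using True sn by auto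
      then show ?thesis using 3 gi sym[OF ab(1,2)] by auto
    next
      case 4
      then have "Suc i = a \<or> Suc i = g a" using True sn gi by auto
      then show ?thesis using 4 gi par[OF ab(1,2)] sym[OF rgab] by auto
    qed
    then show ?thesis
    proof
      assume "reconnect g a b = reconnect g i (Suc i)"
      then show ?thesis using c1 F i by (intro exI[of _ "U i # F"]) simp
    next
      assume "reconnect g a b = reconnect g i (g (Suc i))"
      then show ?thesis using c2 F by (intro exI[of _ F]) simp
    qed
  qed
qed

text \<open>The glued edge follows the piece from x to i and the piece from i + 1 to y. An edge that
  crosses it has to cross one of the pieces, because none of its ends can separate i from i +
  1.\<close>

lemma uncross_U_same_edge:
  assumes F: "is_word N F" and i: "1 \<le> i" "i < N" and ne: "word_matching N F i \<noteq> Suc i"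
    and IH: "\<And>a b. a \<in> {1..2 * N} \<Longrightarrow> b \<in> {1..2 * N} \<Longrightarrow> a \<noteq> b \<Longrightarrow> word_matching N F a \<noteq> b
      \<Longrightarrow> crossing_at (word_matching N F) a b
      \<Longrightarrow> \<exists>G. is_word N G \<and> length G \<le> length F \<and> word_matching N G = reconnect (word_matching N F) a b"
    and g: "g = word_matching N (U i # F)"
    and b: "b \<in> {1..2 * N}" "b \<notin> {i, Suc i, word_matching N F i, word_matching N F (Suc i)}"
    and cr: "crossing_at g (word_matching N F i) b"
  shows "\<exists>G. is_word N G \<and> length G \<le> Suc (length F)
    \<and> word_matching N G = reconnect g (word_matching N F i) b"
proof -
  let ?f = "word_matching N F"
  let ?x = "?f i" and ?y = "?f (Suc i)" and ?c = "?f b"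
  have f: "matching N ?f" by (rule word_matching_matching[OF F])
  note fi = matching_invol[OF f] and fe = matching_eq_iff[OF f]
  have ii: "i \<in> {1..2 * N}" "Suc i \<in> {1..2 * N}" "i \<noteq> Suc i" using i by auto
  have rg: "?x \<in> {1..2 * N}" "?y \<in> {1..2 * N}" "?c \<in> {1..2 * N}"
    using ii b matching_in[OF f] by blast+
  have yi: "?y \<noteq> i" using ne fi by metis
  have nf: "?x \<noteq> i" "?y \<noteq> Suc i" "?c \<noteq> b" using ii b matching_fixed[OF f] by blast+
  have c: "?c \<notin> {i, Suc i, ?x, ?y}" using b(2) fi fe by (metis insert_iff empty_iff)
  have gx: "g ?x = ?y" "g b = ?c"
    using reconnect_simps[OF f ii ne] b g by auto
  have "strictly_between ?x ?y b \<noteq> strictly_between ?x ?y ?c"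
    using cr gx by (simp add: crossing_at_def)
  then have "strictly_between ?x i b \<noteq> strictly_between ?x i ?c
    \<or> strictly_between ?y (Suc i) ?c \<noteq> strictly_between ?y (Suc i) b"
    using b(2) c strictly_between_xor[of b ?x] strictly_between_xor[of ?c ?x]
      strictly_between_xor[of b ?y] strictly_between_xor[of ?c ?y] less_Suc_eq[of b i] less_Suc_eq[of ?c i]
    by auto
  then consider "crossing_at ?f ?x b" | "crossing_at ?f ?y ?c"
    using fi by (auto simp: crossing_at_def)
  then show ?thesis
  proof cases
    case 1
    moreover have "?f ?x \<noteq> b" "?x \<noteq> b" using b fi by auto
    ultimately obtain G where G: "is_word N G" "length G \<le> length F" "word_matching N G = reconnect ?f ?x b"
      using IH rg b by blast
    then show ?thesis
      using reconnect_through_U(1)[OF f i ne b] g i by (intro exI[of _ "U i # G"]) simp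
  next
    case 2
    moreover have "?f ?y \<noteq> ?c" "?y \<noteq> ?c" using c fi by auto
    ultimately obtain G where G: "is_word N G" "length G \<le> length F" "word_matching N G = reconnect ?f ?y ?c"
      using IH rg by blast
    then show ?thesis
      using reconnect_through_U(2)[OF f i ne b] g i by (intro exI[of _ "U i # G"]) simp
  qed
qed

text \<open>Every crossing is due to some T in the word. The induction follows the two edges down to
  such a letter and edits the word there. Letters above it are kept, or dropped when they only close
  a loop, so the word does not grow. This is the tool that undoes a merge.\<close>

lemma uncross:
  assumes "is_word N F"
    and "a \<in> {1..2 * N}" "b \<in> {1..2 * N}" "a \<noteq> b" "word_matching N F a \<noteq> b"
    and "crossing_at (word_matching N F) a b"
  shows "\<exists>G. is_word N G \<and> length G \<le> length F
    \<and> word_matching N G = reconnect (word_matching N F) a b"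
  using assms
proof (induction F arbitrary: a b)
  case Nil
  \<comment> \<open>The edges of the identity are nested in the cyclic numbering, so none of them
    cross.\<close>
  have "perm_matching N id k = 2 * N + 1 - k" if "k \<in> {1..2 * N}" for k
    using that by (auto simp: perm_matching_def)
  then have False using Nil.prems by (auto simp: crossing_at_def strictly_between_def)
  then show ?case ..
next
  case (Cons l F)
  have l: "1 \<le> idx l" "idx l < N" and F: "is_word N F" using Cons.prems(1) by auto
  note IH = Cons.IH[OF F]
  show ?case
  proof (cases l)
    case (T i)
    show ?thesis
      using uncross_T[where F = F and N = N and i = i and a = a and b = b, OF F _ _ _ refl] IH l Cons.prems(2-6)
      unfolding T by (simp del: word_matching_simps act.simps)
  next
    case (U i)
    have i: "1 \<le> i" "i < N" using l U by auto
    let ?f = "word_matching N F" and ?g = "word_matching N (l # F)"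
    have f: "matching N ?f" and g: "matching N ?g"
      using word_matching_matching Cons.prems(1) F by blast+
    have ii: "i \<in> {1..2 * N}" "Suc i \<in> {1..2 * N}" "i \<noteq> Suc i" using i by auto
    note ab = Cons.prems(2-5) and cr = Cons.prems(6)
    have cr': "crossing_at ?g b a" by (rule crossing_at_sym[OF g ab(3,4) cr])
    have ba: "b \<noteq> a" "?g b \<noteq> a" using ab matching_invol[OF g] by metis+
    show ?thesis
    proof (cases "?f i = Suc i")
      case True
      then have gf: "?g = ?f" using U by (simp add: reconnect_def)
      then obtain G where "is_word N G" "length G \<le> length F" "word_matching N G = reconnect ?g a b"
        using IH[of a b] ab cr by auto
      then show ?thesis by (intro exI[of _ G]) simp
    next
      case ne: False
      note rs = reconnect_simps[OF f ii ne]
      let ?x = "?f i" and ?y = "?f (Suc i)"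
      have gs: "?g i = Suc i" "?g (Suc i) = i" "?g ?x = ?y" "?g ?y = ?x"
        "\<And>k. k \<notin> {i, Suc i, ?x, ?y} \<Longrightarrow> ?g k = ?f k"
        using rs U by auto
      have xr: "?x \<in> {1..2 * N}" "?y \<in> {1..2 * N}" using ii matching_in[OF f] by blast+
      have nb: "c \<notin> {i, Suc i}" if "crossing_at ?g c d" for c d
        using that gs(1,2) by (auto simp: crossing_at_def strictly_between_def)
      have same_edge: "\<exists>G. is_word N G \<and> length G \<le> Suc (length F) \<and> word_matching N G = reconnect ?g c d"
        if cd: "c \<in> {?x, ?y}" "d \<in> {1..2 * N}" "c \<noteq> d" "?g c \<noteq> d" "crossing_at ?g c d" "crossing_at ?g d c" for c d
      proof -
        have d: "d \<notin> {i, Suc i, ?x, ?y}" using cd nb[OF cd(6)] gs(3,4) by auto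
        have gd: "?g d \<notin> {i, Suc i, ?x, ?y}" "?g d \<in> {1..2 * N}"
          using d gs(1-4) matching_invol[OF g] matching_in[OF g] cd(2) by (metis insert_iff empty_iff, blast)
        have *: "\<exists>G. is_word N G \<and> length G \<le> Suc (length F) \<and> word_matching N G = reconnect ?g ?x e"
          if e: "e \<notin> {i, Suc i, ?x, ?y}" "e \<in> {1..2 * N}" "crossing_at ?g ?x e" for e
          using uncross_U_same_edge[where F = F and N = N and i = i and b = e, OF F i ne _ refl e(2,1)]
            IH e(3) unfolding U by blast
        consider (x) "c = ?x" | (y) "c = ?y" using cd(1) by blast
        then show ?thesis
        proof cases
          case x
          show ?thesis using *[OF d cd(2)] cd(5) unfolding x by blast
        next
          case y
          have "crossing_at ?g ?x (?g d)"
            using cd(5) y crossing_at_partners[OF g] gs(4) by metis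
          moreover have "reconnect ?g c d = reconnect ?g ?x (?g d)"
            using reconnect_partners[OF g xr(2) cd(2)] unfolding y gs(4) by (rule sym)
          ultimately show ?thesis using *[OF gd] by metis
        qed
      qed
      \<comment> \<open>Either one of the two edges is the one glued by U_i, or U_i touches neither
        and the reconnection passes below it.\<close>
      consider "a \<in> {?x, ?y}" | "b \<in> {?x, ?y}" | "a \<notin> {i, Suc i, ?x, ?y}" "b \<notin> {i, Suc i, ?x, ?y}"
        using nb[OF cr] nb[OF cr'] by blast
      then show ?thesis
      proof cases
        case 1
        then show ?thesis using same_edge[OF 1 ab(2,3,4) cr cr'] by simp
      next
        case 2
        then show ?thesis
          using same_edge[OF 2 ab(1) ba cr' cr] reconnect_commute[OF g ab(1,2)] by simp
      next
        case 3
        then have gab: "?g a = ?f a" "?g b = ?f b" using gs(5) by blast+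
        then have "crossing_at ?f a b" "?f a \<noteq> b" using cr ab(4) by (simp_all add: crossing_at_def)
        then obtain G where G: "is_word N G" "length G \<le> length F" "word_matching N G = reconnect ?f a b"
          using IH ab by blast
        have "?f a \<notin> {i, Suc i, ?x, ?y}" "?f b \<notin> {i, Suc i, ?x, ?y}"
          using 3 matching_invol[OF f] matching_eq_iff[OF f] by (metis insert_iff empty_iff)+
        then have "{a, b, ?f a, ?f b} \<inter> {i, Suc i, ?x, ?y} = {}"
          using 3 by blast
        then have "reconnect (reconnect ?f a b) i (Suc i) = reconnect ?g a b"
          using reconnect_disjoint_commute[OF f ab(1-3) \<open>?f a \<noteq> b\<close> ii ne] U by simp
        then show ?thesis using G U i by (intro exI[of _ "U i # G"]) simp
      qed
    qed
  qed
qed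

section \<open>Merging the hooks\<close>

text \<open>Giving u its former partner back restores the edge at v as well. A merge is thus undone
  by resolving the crossing that it created.\<close>

lemma reconnect_back:
  assumes f: "matching N f" "u \<in> {1..2 * N}" "v \<in> {1..2 * N}" "u \<noteq> v" "f u \<noteq> v"
  shows "reconnect (reconnect f u v) u (f u) = f"
proof
  fix k
  let ?g = "reconnect f u v"
  note rf = reconnect_simps[OF f]
  have g: "matching N ?g" by (rule reconnect_matching[OF f(1-3)])
  have ne: "u \<noteq> f u" "?g u \<noteq> f u" using matching_fixed[OF f(1), of u] f rf(1) by auto
  have "f u \<in> {1..2 * N}" using f matching_in by blast
  note rg = reconnect_simps[OF g f(2) this ne, unfolded rf(1,3)]
  show "reconnect ?g u (f u) k = f k"
  proof (cases "k \<in> {u, f u, v, f v}")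
    case True
    then show ?thesis using rg(1-4) matching_invol[OF f(1)] by (elim insertE emptyE) simp_all
  next
    case False
    then show ?thesis using rg(5) rf(5) by simp
  qed
qed

lemma in_side: "x \<in> {1..2 * N} \<Longrightarrow> x \<in> side N p q \<longleftrightarrow> x \<le> p \<or> 2 * N < x + q"
  by (auto simp: side_def)

definition separated :: "nat set \<Rightarrow> (nat \<Rightarrow> nat) \<Rightarrow> nat \<Rightarrow> nat \<Rightarrow> bool" where
  "separated S f u v \<longleftrightarrow> (u \<in> S \<longleftrightarrow> f u \<in> S) \<and> (v \<in> S \<longleftrightarrow> f v \<in> S) \<and> (u \<in> S \<longleftrightarrow> v \<notin> S)"

text \<open>The parallel edges at \<open>u\<close> and \<open>v\<close> can be made to cross without changing \<^term>\<open>through\<close>.\<close>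

definition mergeable :: "nat \<Rightarrow> (nat \<Rightarrow> nat) \<Rightarrow> nat \<Rightarrow> nat \<Rightarrow> bool" where
  "mergeable N f u v \<longleftrightarrow> u \<in> {1..2 * N} \<and> v \<in> {1..2 * N} \<and> u \<noteq> v \<and> f u \<noteq> v
    \<and> strictly_between u v (f u) \<noteq> strictly_between u v (f v)
    \<and> (\<forall>p q. p \<le> N \<longrightarrow> q \<le> N \<longrightarrow> separated (side N p q) f u v \<longrightarrow> leaving N f p q < \<bar>int p - int q\<bar>)
    \<and> (\<exists>p q. p \<le> N \<and> q \<le> N \<and> separated (side N p q) f u v)"

text \<open>The new edges interleave and a side is an arc, so no line can split the four ends into
  u, v and \<open>f u\<close>, \<open>f v\<close>. The splits described by \<open>separated\<close>
  cut both new edges and no old one; every remaining split cuts as many old edges as new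
  ones.\<close>

lemma leaving_merge:
  assumes f: "matching N f" and m: "mergeable N f u v" and pq: "p \<le> N" "q \<le> N"
  shows "leaving N (reconnect f u v) p q =
    leaving N f p q + (if separated (side N p q) f u v then 2 else 0)"
proof -
  let ?S = "side N p q"
  have uv: "u \<in> {1..2 * N}" "v \<in> {1..2 * N}" "u \<noteq> v" "f u \<noteq> v"
    and cr: "strictly_between u v (f u) \<noteq> strictly_between u v (f v)"
    using m by (auto simp: mergeable_def)
  have fuv: "f u \<in> {1..2 * N}" "f v \<in> {1..2 * N}" using uv f matching_in by blast+
  have ne: "f u \<noteq> u" "f v \<noteq> v" "f v \<noteq> u" using uv f matching_fixed[OF f] matching_invol[OF f] by (blast, blast, metis)
  have "\<not> ((u \<in> ?S \<longleftrightarrow> v \<in> ?S) \<and> (f u \<in> ?S \<longleftrightarrow> f v \<in> ?S) \<and> (u \<in> ?S \<longleftrightarrow> f u \<notin> ?S))"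
    unfolding in_side[OF uv(1)] in_side[OF uv(2)] in_side[OF fuv(1)] in_side[OF fuv(2)]
    using cr ne uv pq unfolding strictly_between_def by linarith
  moreover have "cut_size (reconnect f u v) ?S + of_bool ((u \<in> ?S) \<noteq> (f u \<in> ?S)) + of_bool ((v \<in> ?S) \<noteq> (f v \<in> ?S))
      = cut_size f ?S + of_bool ((u \<in> ?S) \<noteq> (v \<in> ?S)) + of_bool ((f u \<in> ?S) \<noteq> (f v \<in> ?S))"
    by (rule cut_reconnect[OF f uv]) (simp add: side_def)
  ultimately show ?thesis
    unfolding leaving_def separated_def
    by (cases "u \<in> ?S"; cases "v \<in> ?S"; cases "f u \<in> ?S"; cases "f v \<in> ?S"; simp)
qed

lemma merge_step:
  assumes f: "matching N f" and m: "mergeable N f u v"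
  defines "g \<equiv> reconnect f u v"
  shows "matching N g"
    and "p \<le> N \<Longrightarrow> q \<le> N \<Longrightarrow> through N g p q = through N f p q"
    and "p \<le> N \<Longrightarrow> q \<le> N \<Longrightarrow> leaving N f p q \<le> leaving N g p q"
    and "\<exists>p q. p \<le> N \<and> q \<le> N \<and> leaving N f p q < leaving N g p q"
    and "u \<in> {1..2 * N}" "f u \<in> {1..2 * N}" "u \<noteq> f u" "g u \<noteq> f u"
    and "crossing_at g u (f u)"
    and "reconnect g u (f u) = f"
proof -
  have uv: "u \<in> {1..2 * N}" "v \<in> {1..2 * N}" "u \<noteq> v" "f u \<noteq> v"
    and cr: "strictly_between u v (f u) \<noteq> strictly_between u v (f v)"
    using m by (auto simp: mergeable_def)
  note rf = reconnect_simps[OF f uv]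
  show "matching N g" unfolding g_def by (rule reconnect_matching[OF f uv(1,2)])
  show "u \<in> {1..2 * N}" "f u \<in> {1..2 * N}" using uv f matching_in by blast+
  show "u \<noteq> f u" using uv(1) matching_fixed[OF f, of u] by metis
  show "g u \<noteq> f u" using rf(1) uv(4) by (simp add: g_def)
  show "crossing_at g u (f u)" using cr rf(1,3) by (simp add: g_def crossing_at_def)
  show "reconnect g u (f u) = f" unfolding g_def by (rule reconnect_back[OF f uv])
  show "leaving N f p q \<le> leaving N g p q" if "p \<le> N" "q \<le> N"
    using leaving_merge[OF f m that] by (simp add: g_def)
  show "\<exists>p q. p \<le> N \<and> q \<le> N \<and> leaving N f p q < leaving N g p q"
  proof -
    obtain p q where "p \<le> N" "q \<le> N" "separated (side N p q) f u v"
      using m by (auto simp: mergeable_def)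
    then show ?thesis
      using leaving_merge[OF f m, of p q] by (intro exI[of _ p] exI[of _ q]) (simp add: g_def)
  qed
  show "through N g p q = through N f p q" if pq: "p \<le> N" "q \<le> N"
  proof (cases "separated (side N p q) f u v")
    case True
    then have "leaving N f p q < \<bar>int p - int q\<bar>" using m pq by (simp add: mergeable_def)
    \<comment> \<open>By parity a deficit is at least 2, which is exactly what the merge
      adds.\<close>
    moreover have "even (leaving N f p q + int p + int q)" by (rule leaving_parity[OF f pq])
    moreover have "even (L + a + b) \<Longrightarrow> L < \<bar>a - b\<bar> \<Longrightarrow> L + 2 \<le> \<bar>a - b\<bar>" for L a b :: int
      by presburger
    ultimately have "leaving N f p q + 2 \<le> \<bar>int p - int q\<bar>" by blast
    then show ?thesis using leaving_merge[OF f m pq] True by (simp add: g_def through_def)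
  next
    case False
    then show ?thesis using leaving_merge[OF f m pq] by (simp add: g_def through_def)
  qed
qed

text \<open>The line from gap a - 1 to gap N has the whole hook on its right, so its cut falls short
  of |p - q|. The number q is the first column with such a deficit; the step into this column must
  go down, so the edge at the lower node of index q stays on the left. When r decreases and s
  increases, |r - s| grows by the full distance moved, so the deficit persists.\<close>

lemma upper_left_end:
  assumes f: "matching N f" and a: "1 \<le> a" "a < f a" "f a \<le> N"
  obtains q where "1 \<le> q" "q \<le> N" "f (2 * N + 1 - q) \<in> side N (a - 1) (q - 1)"
    "\<And>r s. r < a \<Longrightarrow> q \<le> s \<Longrightarrow> s \<le> N \<Longrightarrow> leaving N f r s < \<bar>int r - int s\<bar>"
proof -
  let ?P = "\<lambda>q. q \<le> N \<and> leaving N f (a - 1) q < int q - int (a - 1)"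
  have "cut_size f {a..N} + 2 \<le> card {a..N}"
    by (rule cut_le_with_edge[of _ a]) (use a matching_invol[OF f] in auto)
  moreover have "{1..2 * N} - side N (a - 1) N = {a..N}" using a by (auto simp: side_def)
  then have "cut_size f {a..N} = cut_size f (side N (a - 1) N)"
    using cut_complement[OF f, of "side N (a - 1) N"] a by (auto simp: side_def)
  ultimately have "?P N" using a by (auto simp: leaving_def)
  define q where "q = (LEAST q. ?P q)"
  have q: "?P q" unfolding q_def by (rule LeastI[of ?P, OF \<open>?P N\<close>])
  have min: "\<not> ?P q'" if "q' < q" for q' using that not_less_Least unfolding q_def by blast
  have "q \<noteq> 0" using q leaving_nonneg[of N f "a - 1" 0] by (cases "q = 0") auto
  then obtain q0 where q0: "q = Suc q0" by (cases q) auto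
  have "f (2 * N - q0) \<in> side N (a - 1) q0"
    using leaving_Suc_lower[OF f, of "a - 1" q0] q min[of q0] a q0 by (auto split: if_splits)
  moreover have "leaving N f r s < \<bar>int r - int s\<bar>" if "r < a" "q \<le> s" "s \<le> N" for r s
    using leaving_lipschitz[OF f, of "a - 1" q r s] q that a order.trans[of "a - 1" a N] by auto
  ultimately show ?thesis using that[of q] q q0 by auto
qed

text \<open>The counterpart at the right end of the hook: c - 1 is the last column in deficit, and
  the step out of it must go up, so the edge at the next lower node lies on the right. The last
  conclusion, no deficit from column c on, later locates a row relative to b.\<close>

lemma upper_right_end:
  assumes f: "matching N f" and b: "1 \<le> f b" "f b < b" "b \<le> N"
  obtains c where "1 \<le> c" "c \<le> N" "f (2 * N + 1 - c) \<notin> side N b (c - 1)"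
    "\<And>r s. b \<le> r \<Longrightarrow> r \<le> N \<Longrightarrow> s < c \<Longrightarrow> leaving N f r s < \<bar>int r - int s\<bar>"
    "\<And>s. c \<le> s \<Longrightarrow> s \<le> N \<Longrightarrow> int b - int s \<le> leaving N f b s"
proof -
  let ?P = "\<lambda>c. c \<le> N \<and> leaving N f b c < int b - int c"
  have "cut_size f {1..b} + 2 \<le> card {1..b}"
    by (rule cut_le_with_edge[of _ b]) (use b matching_invol[OF f] in auto)
  then have "?P 0" using b by (auto simp: leaving_def side_def)
  have bound: "\<forall>c. ?P c \<longrightarrow> c \<le> N" by blast
  define c where "c = (GREATEST c. ?P c)"
  have c: "?P c" unfolding c_def by (rule GreatestI_nat[of ?P 0 N, OF \<open>?P 0\<close>]) blast
  have max: "c' \<le> c" if "?P c'" for c'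
    unfolding c_def by (rule Greatest_le_nat[of ?P c' N, OF that]) blast
  have cN: "c < N" using c leaving_nonneg[of N f b N] b by (cases "c = N") auto
  have above: "int b - int s \<le> leaving N f b s" if "c < s" "s \<le> N" for s
    using max[of s] that by force
  have "f (2 * N - c) \<notin> side N b c"
    using leaving_Suc_lower[OF f, of b c] c above[of "Suc c"] cN b by (auto split: if_splits)
  moreover have "leaving N f r s < \<bar>int r - int s\<bar>" if "b \<le> r" "r \<le> N" "s < Suc c" for r s
    using leaving_lipschitz[OF f, of b c r s] c that b by auto
  ultimately show ?thesis using that[of "Suc c"] cN above by auto
qed

text \<open>The lower node of index c is the left end of a hook in the lower row, and the argument
  of \<open>upper_left_end\<close> applies with the rows exchanged: e is the first upper gap whose
  line to gap c - 1 is in deficit.\<close>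

lemma lower_left_end:
  assumes f: "matching N f" and c: "1 \<le> c" "c \<le> N" "N < f (2 * N + 1 - c)" "f (2 * N + 1 - c) < 2 * N + 1 - c"
  obtains e where "1 \<le> e" "e \<le> N" "f e \<in> side N (e - 1) (c - 1)"
    "leaving N f e (c - 1) < int e - int (c - 1)"
    "\<And>r s. e \<le> r \<Longrightarrow> r \<le> N \<Longrightarrow> s < c \<Longrightarrow> leaving N f r s < \<bar>int r - int s\<bar>"
proof -
  let ?P = "\<lambda>e. e \<le> N \<and> leaving N f e (c - 1) < int e - int (c - 1)"
  let ?I = "{N + 1..2 * N + 1 - c}"
  have "cut_size f ?I + 2 \<le> card ?I"
    by (rule cut_le_with_edge[of _ "2 * N + 1 - c"]) (use c matching_invol[OF f] in auto)
  moreover have "{1..2 * N} - side N N (c - 1) = ?I" using c by (auto simp: side_def)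
  then have "cut_size f ?I = cut_size f (side N N (c - 1))"
    using cut_complement[OF f, of "side N N (c - 1)"] c by (force simp: side_def)
  ultimately have "?P N" using c by (auto simp: leaving_def)
  define e where "e = (LEAST e. ?P e)"
  have e: "?P e" unfolding e_def by (rule LeastI[of ?P, OF \<open>?P N\<close>])
  have min: "\<not> ?P e'" if "e' < e" for e' using that not_less_Least unfolding e_def by blast
  have "e \<noteq> 0" using e leaving_nonneg[of N f 0 "c - 1"] by (cases "e = 0") auto
  then obtain e0 where e0: "e = Suc e0" by (cases e) auto
  have "f (Suc e0) \<in> side N e0 (c - 1)"
    using leaving_Suc_upper[OF f, of e0 "c - 1"] e min[of e0] c e0 by (auto split: if_splits)
  moreover have "leaving N f r s < \<bar>int r - int s\<bar>" if "e \<le> r" "r \<le> N" "s < c" for r s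
    using leaving_lipschitz[OF f, of e "c - 1" r s] e that c order.trans[of "c - 1" c N] by auto
  ultimately show ?thesis using that[of e] e e0 by auto
qed

text \<open>A hook must be paired with an edge such that all lines between the two are in deficit.
  Beside the hook from a to b with rightmost b there are two zones of deficit: r < a with s \<ge> q
  on the left, and r \<ge> b with s < c on the right. The edge at \<open>q'\<close> is a suitable
  partner unless it is itself a lower hook starting beyond c; then this lower hook is paired with an
  edge found from its own left end.\<close>

lemma exists_mergeable:
  assumes f: "matching N f" and hook: "\<exists>a\<in>{1..N}. f a \<in> {1..N}"
  shows "\<exists>u v. mergeable N f u v"
proof -
  note fi = matching_invol[OF f] and fx = matching_fixed[OF f] and fin = matching_in[OF f]
  let ?H = "{b \<in> {1..N}. 1 \<le> f b \<and> f b < b}"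
  obtain a0 where a0: "a0 \<in> {1..N}" "f a0 \<in> {1..N}" using hook by blast
  then have "f a0 \<noteq> a0" using fx[of a0] by auto
  then have "a0 \<in> ?H \<or> f a0 \<in> ?H" using a0 fi by auto
  then have ne: "?H \<noteq> {}" by blast
  define b where "b = Max ?H"
  have "b \<in> ?H" unfolding b_def by (rule Max_in) (use ne in auto)
  then have b: "1 \<le> f b" "f b < b" "b \<le> N" by auto
  have bmax: "b' \<le> b" if "b' \<in> ?H" for b' unfolding b_def by (rule Max_ge) (use that in auto)
  define a where "a = f b"
  have a: "1 \<le> a" "a < f a" "f a \<le> N" "f a = b" using b fi by (auto simp: a_def)
  obtain q where q: "1 \<le> q" "q \<le> N" "f (2 * N + 1 - q) \<in> side N (a - 1) (q - 1)"
    and qdef: "\<And>r s. r < a \<Longrightarrow> q \<le> s \<Longrightarrow> s \<le> N \<Longrightarrow> leaving N f r s < \<bar>int r - int s\<bar>"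
    using upper_left_end[OF f a(1-3)] by metis
  obtain c where c: "1 \<le> c" "c \<le> N" "f (2 * N + 1 - c) \<notin> side N b (c - 1)"
    and cdef: "\<And>r s. b \<le> r \<Longrightarrow> r \<le> N \<Longrightarrow> s < c \<Longrightarrow> leaving N f r s < \<bar>int r - int s\<bar>"
    and cmax: "\<And>s. c \<le> s \<Longrightarrow> s \<le> N \<Longrightarrow> int b - int s \<le> leaving N f b s"
    using upper_right_end[OF f b] by metis
  define q' where "q' = 2 * N + 1 - q"
  define x where "x = f q'"
  define c' where "c' = 2 * N + 1 - c"
  define y where "y = f c'"
  have q': "N < q'" "q' \<le> 2 * N" "q' + q = 2 * N + 1" and c': "N < c'" "c' \<le> 2 * N" "c' + c = 2 * N + 1"
    using q c by (auto simp: q'_def c'_def)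
  have xr: "x \<in> {1..2 * N}" and yr: "y \<in> {1..2 * N}"
    using fin[of q'] fin[of c'] q' c' by (auto simp: x_def y_def)
  have ar: "a \<in> {1..2 * N}" and br: "b \<in> {1..2 * N}" and qr: "q' \<in> {1..2 * N}" and cr: "c' \<in> {1..2 * N}"
    using a b q' c' by auto
  have fq: "f q' = x" "f x = q'" and fc: "f c' = y" "f y = c'" by (simp_all add: x_def y_def fi)
  have xne: "x \<noteq> q'" and yne: "y \<noteq> c'" using fx[of q'] fx[of c'] qr cr fq fc by auto
  have xs: "x < a \<or> q' < x"
    using q(3) xr q' a xne unfolding q'_def[symmetric] x_def[symmetric] in_side[OF xr] by linarith
  have ys: "b < y" "y < c'"
    using c(3) yr c' b yne unfolding c'_def[symmetric] y_def[symmetric] in_side[OF yr] by linarith+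
  have m1: "mergeable N f a q'" if one: "x < a \<or> 2 * N + 1 \<le> x + c"
    unfolding mergeable_def fq(1) a(4)
  proof (intro conjI allI impI)
    show "a \<in> {1..2 * N}" "q' \<in> {1..2 * N}" by (fact ar, fact qr)
    show "a \<noteq> q'" "b \<noteq> q'" using a b q' by auto
    show "strictly_between a q' b \<noteq> strictly_between a q' x"
      using a b q' xs by (auto simp: strictly_between_def)
    show "\<exists>p q. p \<le> N \<and> q \<le> N \<and> separated (side N p q) f a q'"
      unfolding separated_def fq(1) a(4) in_side[OF ar] in_side[OF br] in_side[OF qr] in_side[OF xr]
      using xs a b q' q by (intro exI[of _ "a - 1"] exI[of _ q]) auto
    fix r s assume rs: "r \<le> N" "s \<le> N" and sep: "separated (side N r s) f a q'"
    then have "r < a \<and> q \<le> s \<or> b \<le> r \<and> s < c"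
      unfolding separated_def fq(1) a(4) in_side[OF ar] in_side[OF br] in_side[OF qr] in_side[OF xr]
      using one xs a b q' by linarith
    then show "leaving N f r s < \<bar>int r - int s\<bar>" using qdef cdef rs by blast
  qed
  \<comment> \<open>The counterpart of \<open>m1\<close> at the other end of the hook, with the edge
    at \<open>c'\<close> that lies to the right.\<close>
  have m2: "mergeable N f b c'" if two: "y \<le> q'"
    unfolding mergeable_def fc(1) a_def[symmetric]
  proof (intro conjI allI impI)
    show "b \<in> {1..2 * N}" "c' \<in> {1..2 * N}" by (fact br, fact cr)
    show "b \<noteq> c'" "a \<noteq> c'" using a b c' by auto
    show "strictly_between b c' a \<noteq> strictly_between b c' y"
      using a b c' ys by (auto simp: strictly_between_def)
    have sep_eq: "separated S f b c' \<longleftrightarrow> (b \<in> S \<longleftrightarrow> a \<in> S) \<and> (c' \<in> S \<longleftrightarrow> y \<in> S) \<and> (b \<in> S \<longleftrightarrow> c' \<notin> S)" for S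
      by (simp add: separated_def fc(1) a_def)
    show "\<exists>p q. p \<le> N \<and> q \<le> N \<and> separated (side N p q) f b c'"
      unfolding sep_eq in_side[OF ar] in_side[OF br] in_side[OF cr] in_side[OF yr]
      using ys a b c' c by (intro exI[of _ b] exI[of _ "c - 1"]) auto
    fix r s assume rs: "r \<le> N" "s \<le> N" and sep: "separated (side N r s) f b c'"
    then have "r < a \<and> q \<le> s \<or> b \<le> r \<and> s < c"
      unfolding sep_eq in_side[OF ar] in_side[OF br] in_side[OF cr] in_side[OF yr]
      using two ys a b c' q' by linarith
    then show "leaving N f r s < \<bar>int r - int s\<bar>" using qdef cdef rs by blast
  qed
  \<comment> \<open>Now x is the lower node of index d with c < d < q. Lines with r \<ge> b and c
    \<le> s < d separate the upper hook from this lower hook without a known deficit, so the lower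
    hook needs another partner.\<close>
  have m3: "\<exists>u v. mergeable N f u v" if three: "q' < x" "x + c < 2 * N + 1"
  proof -
    define d where "d = 2 * N + 1 - x"
    have d: "1 \<le> d" "d \<le> N" "c < d" "x = 2 * N + 1 - d" "x + d = 2 * N + 1"
      using three xr q' by (auto simp: d_def)
    have fx': "f x = q'" by (fact fq(2))
    obtain e where e: "1 \<le> e" "e \<le> N" "f e \<in> side N (e - 1) (d - 1)"
      "leaving N f e (d - 1) < int e - int (d - 1)"
      and edef: "\<And>r s. e \<le> r \<Longrightarrow> r \<le> N \<Longrightarrow> s < d \<Longrightarrow> leaving N f r s < \<bar>int r - int s\<bar>"
      using lower_left_end[OF f d(1,2)] fx' q' three(1) unfolding d(4)[symmetric] by metis
    \<comment> \<open>If e were at most b, the deficit in column d - 1 would persist from row e to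
      row b, against \<open>cmax\<close>.\<close>
    have eb: "b < e"
    proof (rule ccontr)
      assume "\<not> b < e"
      then have "leaving N f b (d - 1) < int b - int (d - 1)"
        using leaving_lipschitz[OF f, of e "d - 1" b "d - 1"] e d b order.trans[of "d - 1" d N] by auto
      moreover have "c \<le> d - 1" "d - 1 \<le> N" using d by linarith+
      ultimately show False using cmax[of "d - 1"] by linarith
    qed
    define z where "z = f e"
    have er: "e \<in> {1..2 * N}" and zr: "z \<in> {1..2 * N}" using e fin[of e] by (auto simp: z_def)
    \<comment> \<open>Otherwise the edge at e would be an upper hook whose right end e lies beyond
      b, against the choice of b.\<close>
    have zx: "x < z"
    proof (rule ccontr)
      assume "\<not> x < z"
      then have "z < e" using e(1-3) zr d unfolding z_def[symmetric] in_side[OF zr] by linarith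
      then have "e \<in> ?H" using e zr by (auto simp: z_def)
      then show False using bmax eb by fastforce
    qed
    have "mergeable N f e x"
      unfolding mergeable_def fx' z_def[symmetric]
    proof (intro conjI allI impI)
      show "e \<in> {1..2 * N}" "x \<in> {1..2 * N}" by (fact er, fact xr)
      show "e \<noteq> x" "z \<noteq> x" using e three q' zx by auto
      show "strictly_between e x z \<noteq> strictly_between e x q'"
        using e three q' zx by (auto simp: strictly_between_def)
      have sep_eq: "separated S f e x \<longleftrightarrow> (e \<in> S \<longleftrightarrow> z \<in> S) \<and> (x \<in> S \<longleftrightarrow> q' \<in> S) \<and> (e \<in> S \<longleftrightarrow> x \<notin> S)" for S
        by (simp add: separated_def fx' z_def)
      show "\<exists>p q. p \<le> N \<and> q \<le> N \<and> separated (side N p q) f e x"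
        unfolding sep_eq in_side[OF er] in_side[OF zr] in_side[OF xr] in_side[OF qr]
        using e d zx three q' by (intro exI[of _ e] exI[of _ "d - 1"]) auto
      fix r s assume rs: "r \<le> N" "s \<le> N" and sep: "separated (side N r s) f e x"
      then have "e \<le> r \<and> s < d"
        unfolding sep_eq in_side[OF er] in_side[OF zr] in_side[OF xr] in_side[OF qr]
        using e d zx three q' by linarith
      then show "leaving N f r s < \<bar>int r - int s\<bar>" using edef rs by blast
    qed
    then show ?thesis by blast
  qed
  show ?thesis using m1 m2 m3 xs by (meson not_le)
qed

text \<open>N upper nodes with distinct lower partners use up the whole lower row, which rules out
  lower hooks as well.\<close>

lemma no_hook_perm_matching:
  assumes f: "matching N f" and nh: "\<And>a. a \<in> {1..N} \<Longrightarrow> f a \<notin> {1..N}"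
  shows "\<exists>w. w permutes {1..N} \<and> f = perm_matching N w"
proof -
  note fi = matching_invol[OF f] and fx = matching_fixed[OF f] and fin = matching_in[OF f]
  have up: "f a \<in> {N + 1..2 * N}" if "a \<in> {1..N}" for a
    using nh[OF that] fin[of a] that by auto
  have "f ` {1..N} = {N + 1..2 * N}"
    by (rule card_subset_eq) (use up matching_eq_iff[OF f] in \<open>auto simp: card_image inj_on_def\<close>)
  then have down: "f k \<in> {1..N}" if "k \<in> {N + 1..2 * N}" for k
    using that fi by (metis (no_types, lifting) imageE)
  define w where "w = (\<lambda>p. if p \<in> {1..N} then 2 * N + 1 - f p else p)"
  have "w ` {1..N} \<subseteq> {1..N}" using up by (fastforce simp: w_def)
  moreover have "inj_on w {1..N}"
  proof (rule inj_onI)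
    fix x y assume "x \<in> {1..N}" "y \<in> {1..N}" "w x = w y"
    then have "f x = f y" using up[of x] up[of y] by (auto simp: w_def)
    then show "x = y" using matching_eq_iff[OF f] by blast
  qed
  ultimately have "bij_betw w {1..N} {1..N}"
    by (simp add: bij_betw_def endo_inj_surj)
  then have w: "w permutes {1..N}"
    by (rule bij_imp_permutes) (auto simp: w_def)
  moreover have "f = perm_matching N w"
  proof
    fix k
    consider "k \<in> {1..N}" | "k \<in> {N + 1..2 * N}" | "k \<notin> {1..2 * N}" by fastforce
    then show "f k = perm_matching N w k"
    proof cases
      case 1
      then show ?thesis using up[of k] by (auto simp: perm_matching_def w_def)
    next
      case 2
      then have "w (f k) = 2 * N + 1 - k" using down[OF 2] fi by (simp add: w_def)
      then have "inv w (2 * N + 1 - k) = f k" using permutes_inverses(2)[OF w] by metis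
      then show ?thesis using 2 by (auto simp: perm_matching_def)
    next
      case 3
      then show ?thesis using fx[of k] by (auto simp: perm_matching_def)
    qed
  qed
  ultimately show ?thesis by blast
qed

lemma leaving_le: "p \<le> N \<Longrightarrow> q \<le> N \<Longrightarrow> leaving N f p q \<le> 2 * int N"
proof -
  assume "p \<le> N" "q \<le> N"
  then have "cut_size f (side N p q) \<le> card {1..2 * N}"
    unfolding cut_size_def by (intro card_mono) (auto simp: side_def)
  then show ?thesis by (simp add: leaving_def)
qed

text \<open>A merge lowers no value of \<open>leaving\<close> and raises one, and all values are at
  most 2N, so the process terminates. Without hooks \<open>perm_matching_ge\<close> makes
  \<open>leaving\<close> and \<open>through\<close> coincide. The last conclusion carries words back
  to f, each merge being undone by \<open>uncross\<close>.\<close>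

lemma through_perm:
  assumes "matching N f"
  shows "\<exists>w. w permutes {1..N}
    \<and> (\<forall>p q. p \<le> N \<longrightarrow> q \<le> N \<longrightarrow> leaving N (perm_matching N w) p q = through N f p q)
    \<and> (\<forall>F. is_word N F \<longrightarrow> word_matching N F = perm_matching N w
        \<longrightarrow> (\<exists>G. is_word N G \<and> length G \<le> length F \<and> word_matching N G = f))"
  using assms
proof (induction "\<Sum>(p, q)\<in>{..N} \<times> {..N}. nat (2 * int N - leaving N f p q)" arbitrary: f rule: less_induct)
  case less
  note f = less.prems
  show ?case
  proof (cases "\<exists>a\<in>{1..N}. f a \<in> {1..N}")
    case False
    then obtain w where w: "w permutes {1..N}" "f = perm_matching N w"
      using no_hook_perm_matching[OF f] by blast
    then show ?thesis
      using perm_matching_ge[OF w(1)] by (intro exI[of _ w]) (auto simp: through_def)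
  next
    case True
    then obtain u v where m: "mergeable N f u v" using exists_mergeable[OF f] by blast
    define g where "g = reconnect f u v"
    note ms = merge_step[OF f m, folded g_def]
    obtain p0 q0 where pq0: "p0 \<le> N" "q0 \<le> N" "leaving N f p0 q0 < leaving N g p0 q0"
      using ms(4) by blast
    have "(\<Sum>(p, q)\<in>{..N} \<times> {..N}. nat (2 * int N - leaving N g p q))
        < (\<Sum>(p, q)\<in>{..N} \<times> {..N}. nat (2 * int N - leaving N f p q))"
    proof (rule sum_strict_mono_ex1)
      show "\<exists>x\<in>{..N} \<times> {..N}. (case x of (p, q) \<Rightarrow> nat (2 * int N - leaving N g p q))
          < (case x of (p, q) \<Rightarrow> nat (2 * int N - leaving N f p q))"
        using pq0 leaving_le[of p0 N q0 g] by (intro bexI[of _ "(p0, q0)"]) auto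
    qed (use ms(3) in \<open>auto intro!: nat_mono\<close>)
    from less.hyps[OF this ms(1)] obtain w where w: "w permutes {1..N}"
      "\<And>p q. p \<le> N \<Longrightarrow> q \<le> N \<Longrightarrow> leaving N (perm_matching N w) p q = through N g p q"
      and wG: "\<And>F. is_word N F \<Longrightarrow> word_matching N F = perm_matching N w
        \<Longrightarrow> \<exists>G. is_word N G \<and> length G \<le> length F \<and> word_matching N G = g"
      by blast
    have "\<exists>G. is_word N G \<and> length G \<le> length F \<and> word_matching N G = f"
      if F: "is_word N F" "word_matching N F = perm_matching N w" for F
    proof -
      obtain G where G: "is_word N G" "length G \<le> length F" "word_matching N G = g"
        using wG[OF F] by blast
      then obtain G' where "is_word N G'" "length G' \<le> length G" "word_matching N G' = reconnect g u (f u)"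
        using uncross[OF G(1) ms(5,6,7)] ms(8,9) by blast
      then show ?thesis using G(2) ms(10) by (intro exI[of _ G']) simp
    qed
    then show ?thesis using w ms(2) by (intro exI[of _ w]) simp
  qed
qed

text \<open>Minimality forces every inequality in the comparison of the Demazure product of the word
  with the permutation of \<^term>\<open>through\<close> to be an equality.\<close>

lemma tau_word_minimal:
  assumes f: "matching N f" and F: "is_word N F" "word_matching N F = f"
    and min: "\<And>G. is_word N G \<Longrightarrow> word_matching N G = f \<Longrightarrow> length F \<le> length G"
  shows "\<exists>w. w permutes {1..N} \<and> word_matching N (tau_word F) = perm_matching N w
    \<and> (\<forall>p q. p \<le> N \<longrightarrow> q \<le> N \<longrightarrow> leaving N (perm_matching N w) p q = through N f p q)"
proof -
  obtain w where w: "w permutes {1..N}"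
    "\<And>p q. p \<le> N \<Longrightarrow> q \<le> N \<Longrightarrow> leaving N (perm_matching N w) p q = through N f p q"
    and wG: "\<And>F. is_word N F \<Longrightarrow> word_matching N F = perm_matching N w
      \<Longrightarrow> \<exists>G. is_word N G \<and> length G \<le> length F \<and> word_matching N G = f"
    using through_perm[OF f] by blast
  obtain W where "is_word N W" "length W = inv_count N w" "word_matching N W = perm_matching N w"
    using perm_matching_word[OF w(1)] by blast
  \<comment> \<open>A reduced word of w, carried back to f, is a competitor of F.\<close>
  then have len: "length F \<le> inv_count N w" using wG min by (metis le_trans)
  obtain v where v: "v permutes {1..N}" "inv_count N v \<le> length F"
    "\<And>p q. p \<le> N \<Longrightarrow> q \<le> N \<Longrightarrow> leaving N f p q \<le> leaving N (perm_matching N v) p q"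
    "inv_count N v = length F \<Longrightarrow> word_matching N (tau_word F) = perm_matching N v"
    using word_below_demazure[OF F(1)] F(2) by blast
  have "perm_rank w p q \<le> perm_rank v p q" if p: "p \<le> N" for p q
  proof (cases "q \<le> N")
    case True
    have "leaving N (perm_matching N w) p q \<le> leaving N (perm_matching N v) p q"
      using w(2)[OF p True] v(3)[OF p True] perm_matching_ge[OF v(1) p True] by (simp add: through_def)
    then show ?thesis
      using leaving_perm_matching[OF w(1) p True] leaving_perm_matching[OF v(1) p True] by simp
  next
    case False
    \<comment> \<open>Columns beyond N have no line, but no value of w exceeds N.\<close>
    then have "{j \<in> {1..p}. q < w j} = {}" using permutes_bounds(2)[OF w(1)] p by force
    then have "perm_rank w p q = 0" by (simp only: perm_rank_def card.empty)
    then show ?thesis by simp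
  qed
  then have "inv_count N w \<le> inv_count N v \<and> (inv_count N w = inv_count N v \<longrightarrow> w = v)"
    by (rule inv_count_mono_perm_rank[OF w(1) v(1)])
  then show ?thesis using len v w by (intro exI[of _ w]) auto
qed

section \<open>Tangles as matchings\<close>

text \<open>Inverse of \<open>cyc_pos\<close> on the range 1..2N.\<close>

definition node_at :: "nat \<Rightarrow> nat \<Rightarrow> node" where
  "node_at N k = (if k \<le> N then Up k else Lo (2 * N + 1 - k))"

definition tangle_of :: "nat \<Rightarrow> (nat \<Rightarrow> nat) \<Rightarrow> tangle" where
  "tangle_of N f = {{node_at N k, node_at N (f k)} | k. k \<in> {1..2 * N}}"

lemma node_at_eq_iff:
  "k \<in> {1..2 * N} \<Longrightarrow> l \<in> {1..2 * N} \<Longrightarrow> node_at N k = node_at N l \<longleftrightarrow> k = l"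
  by (auto simp: node_at_def)

lemma node_at_in_nodes: "k \<in> {1..2 * N} \<Longrightarrow> node_at N k \<in> nodes N"
  by (auto simp: node_at_def nodes_def image_iff)

lemma node_at_cyc_pos: "v \<in> nodes N \<Longrightarrow> node_at N (cyc_pos N v) = v \<and> cyc_pos N v \<in> {1..2 * N}"
  by (auto simp: node_at_def nodes_def)

lemma edge_tangle_of:
  assumes f: "matching N f"
  shows "{a, b} \<in> tangle_of N f \<longleftrightarrow> (\<exists>k\<in>{1..2 * N}. a = node_at N k \<and> b = node_at N (f k))"
proof
  assume "{a, b} \<in> tangle_of N f"
  then obtain k where k: "k \<in> {1..2 * N}" "{a, b} = {node_at N k, node_at N (f k)}"
    by (auto simp: tangle_of_def)
  then consider "a = node_at N k" "b = node_at N (f k)" | "b = node_at N k" "a = node_at N (f k)"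
    by (auto simp: doubleton_eq_iff)
  then show "\<exists>k\<in>{1..2 * N}. a = node_at N k \<and> b = node_at N (f k)"
  proof cases
    case 2
    then show ?thesis
      using k(1) matching_in[OF f] matching_invol[OF f] by (intro bexI[of _ "f k"]) auto
  qed (use k in auto)
qed (auto simp: tangle_of_def)

lemma partner_tangle_of:
  assumes f: "matching N f" and k: "k \<in> {1..2 * N}"
  shows "partner (tangle_of N f) (node_at N k) = node_at N (f k)"
  unfolding partner_def edge_tangle_of[OF f]
  using k node_at_eq_iff by (intro the_equality) auto

lemma tangle_of_inj:
  assumes f: "matching N f" and g: "matching N g" and eq: "tangle_of N f = tangle_of N g"
  shows "f = g"
proof
  fix k
  show "f k = g k"
  proof (cases "k \<in> {1..2 * N}")
    case True
    then have "node_at N (f k) = node_at N (g k)"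
      using partner_tangle_of[OF f True] partner_tangle_of[OF g True] eq by simp
    then show ?thesis
      using node_at_eq_iff True matching_in[OF f] matching_in[OF g] by blast
  next
    case False
    then show ?thesis using matching_fixed[OF f] matching_fixed[OF g] by metis
  qed
qed

lemma tangle_is_tangle_of:
  assumes X: "is_tangle N X"
  obtains f where "matching N f" "X = tangle_of N f"
proof -
  have edge: "e \<subseteq> nodes N" "card e = 2" if "e \<in> X" for e
    using X that by (auto simp: is_tangle_def)
  have uniq: "\<exists>!e. e \<in> X \<and> v \<in> e" if "v \<in> nodes N" for v
    using X that by (auto simp: is_tangle_def)
  have ex: "\<exists>w. {v, w} \<in> X" if "v \<in> nodes N" for v
  proof -
    obtain e where e: "e \<in> X" "v \<in> e" using uniq[OF \<open>v \<in> nodes N\<close>] by blast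
    then obtain x y where "e = {x, y}" using edge(2) by (meson card_2_iff)
    then show ?thesis using e by (metis insert_commute insertE singletonD)
  qed
  define w where "w v = (SOME w. {v, w} \<in> X)" for v
  have w: "{v, w v} \<in> X" if "v \<in> nodes N" for v
    unfolding w_def using someI_ex[OF ex[OF that]] .
  have w_in: "w v \<in> nodes N" and w_ne: "w v \<noteq> v" if "v \<in> nodes N" for v
    using edge[OF w[OF that]] by (auto simp: card_2_iff)
  have w_eq: "b = w a" if "{a, b} \<in> X" for a b
  proof -
    have "a \<in> nodes N" "a \<noteq> b" using edge[OF that] by auto
    then have "{a, b} = {a, w a}" using uniq[of a] that w by blast
    then show ?thesis by (auto simp: doubleton_eq_iff)
  qed
  have w_w: "w (w v) = v" if "v \<in> nodes N" for v
    using w_eq[of "w v" v] w[OF that] by (simp add: insert_commute)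
  define f where "f k = (if k \<in> {1..2 * N} then cyc_pos N (w (node_at N k)) else k)" for k
  have nf: "node_at N (f k) = w (node_at N k)" "f k \<in> {1..2 * N}" if "k \<in> {1..2 * N}" for k
    using node_at_cyc_pos[OF w_in[OF node_at_in_nodes[OF that]]] that by (auto simp: f_def)
  have "f (f k) = k \<and> (f k = k \<longleftrightarrow> k \<notin> {1..2 * N})" for k
  proof (cases "k \<in> {1..2 * N}")
    case True
    have "node_at N (f (f k)) = node_at N k"
      using nf[OF True] nf(1)[of "f k"] w_w node_at_in_nodes[OF True] by simp
    then have "f (f k) = k" using node_at_eq_iff nf(2) True by blast
    moreover have "f k \<noteq> k" using nf(1)[OF True] w_ne node_at_in_nodes[OF True] by metis
    ultimately show ?thesis using True by simp
  next
    case False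
    then show ?thesis by (auto simp: f_def)
  qed
  then have f: "matching N f" by (simp add: matching_def)
  have "X = tangle_of N f"
  proof
    show "tangle_of N f \<subseteq> X"
      using w node_at_in_nodes nf by (auto simp: tangle_of_def)
    show "X \<subseteq> tangle_of N f"
    proof
      fix e assume e: "e \<in> X"
      then obtain a b where ab: "e = {a, b}" using edge(2) by (meson card_2_iff)
      have a: "a \<in> nodes N" using edge(1)[OF e] ab by auto
      have "b = w a" using w_eq e ab by blast
      then have "e = {node_at N (cyc_pos N a), node_at N (f (cyc_pos N a))}"
        using ab nf node_at_cyc_pos[OF a] by simp
      then show "e \<in> tangle_of N f"
        unfolding tangle_of_def using node_at_cyc_pos[OF a] by blast
    qed
  qed
  then show ?thesis using that f by blast
qed


section \<open>Composition with a prime\<close>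

lemma sym_stack_links: "sym (stack_links X Y)"
  unfolding stack_links_def sym_def by (auto simp: insert_commute; metis insert_commute)

text \<open>\<open>\<phi>\<close> names the component of each point of the stacked diagram.\<close>

lemma compose_eqI:
  assumes g: "matching N g"
    and links: "\<And>x y. (x, y) \<in> stack_links X Y \<Longrightarrow>
      \<phi> x = \<phi> y \<and> snd x \<in> {1..N} \<and> snd y \<in> {1..N}"
    and outer: "\<And>k. k \<in> {1..2 * N} \<Longrightarrow> \<phi> (outer_pos (node_at N k)) = {k, g k}"
    and path: "\<And>k. k \<in> {1..2 * N} \<Longrightarrow>
      (outer_pos (node_at N k), outer_pos (node_at N (g k))) \<in> (stack_links X Y)\<^sup>*"
  shows "Defs.compose X Y = tangle_of N g"
proof
  have outer_inj: "outer_pos a = outer_pos b \<Longrightarrow> a = b" for a b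
    by (cases a; cases b) auto
  have outer_nodes: "a \<in> nodes N" if "snd (outer_pos a) \<in> {1..N}" for a
    using that by (cases a) (auto simp: nodes_def)
  \<comment> \<open>The reflexive closure also relates every point outside the diagram to itself,
    hence the alternative \<open>x = y\<close>; it is excluded later because the ends of an edge are
    distinct.\<close>
  have inv: "\<phi> x = \<phi> y \<and> (x = y \<or> snd x \<in> {1..N} \<and> snd y \<in> {1..N})"
    if "(x, y) \<in> (stack_links X Y)\<^sup>*" for x y
    using that by (induction rule: rtrancl_induct) (use links in blast)+
  show "Defs.compose X Y \<subseteq> tangle_of N g"
  proof
    fix e assume "e \<in> Defs.compose X Y"
    then obtain a b where ab: "e = {a, b}" "a \<noteq> b" "(outer_pos a, outer_pos b) \<in> (stack_links X Y)\<^sup>*"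
      by (auto simp: Defs.compose_def)
    then have "a \<in> nodes N" "b \<in> nodes N" "\<phi> (outer_pos a) = \<phi> (outer_pos b)"
      using inv[OF ab(3)] outer_inj outer_nodes by blast+
    then obtain k l where kl: "k \<in> {1..2 * N}" "l \<in> {1..2 * N}" "a = node_at N k" "b = node_at N l"
      using node_at_cyc_pos by metis
    then have "{k, g k} = {l, g l}" using outer \<open>\<phi> (outer_pos a) = \<phi> (outer_pos b)\<close> by simp
    moreover have "k \<noteq> l" using kl ab(2) by auto
    ultimately have "l = g k" by (auto simp: doubleton_eq_iff)
    then show "e \<in> tangle_of N g" using ab(1) kl by (auto simp: tangle_of_def)
  qed
  show "tangle_of N g \<subseteq> Defs.compose X Y"
  proof
    fix e assume "e \<in> tangle_of N g"
    then obtain k where k: "k \<in> {1..2 * N}" "e = {node_at N k, node_at N (g k)}"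
      by (auto simp: tangle_of_def)
    have "node_at N k \<noteq> node_at N (g k)"
      using k(1) node_at_eq_iff[OF k(1)] matching_in[OF g] matching_fixed[OF g, of k] by metis
    then show "e \<in> Defs.compose X Y"
      unfolding Defs.compose_def using k path[OF k(1)] by blast
  qed
qed

lemma outer_pos_node_at:
  "k \<in> {1..2 * N} \<Longrightarrow> outer_pos (node_at N k) = (if k \<le> N then (0, k) else (2, 2 * N + 1 - k))"
  by (simp add: node_at_def)

lemma bot_pos_node_at:
  "k \<in> {1..2 * N} \<Longrightarrow> bot_pos (node_at N k) = (if k \<le> N then (1, k) else (2, 2 * N + 1 - k))"
  by (simp add: node_at_def)

lemma T_tangle_eq:
  assumes "1 \<le> i" "i < N"
  shows "T_tangle N i = {{Up j, Lo (adj_swap i j)} | j. j \<in> {1..N}}"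
proof (rule set_eqI, rule iffI)
  fix e assume "e \<in> T_tangle N i"
  then consider "e = {Up i, Lo (adj_swap i i)}" | "e = {Up (Suc i), Lo (adj_swap i (Suc i))}"
    | j where "j \<in> {1..N}" "j \<noteq> i" "j \<noteq> Suc i" "e = {Up j, Lo (adj_swap i j)}"
    by (auto simp: T_tangle_def id_tangle_def transpose_def)
  then show "e \<in> {{Up j, Lo (adj_swap i j)} | j. j \<in> {1..N}}"
    by cases (use assms in \<open>fastforce+\<close>)
next
  fix e assume "e \<in> {{Up j, Lo (adj_swap i j)} | j. j \<in> {1..N}}"
  then obtain j where "j \<in> {1..N}" "e = {Up j, Lo (adj_swap i j)}" by blast
  then show "e \<in> T_tangle N i"
    by (auto simp: T_tangle_def id_tangle_def transpose_def doubleton_eq_iff)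
qed

lemma U_tangle_eq:
  assumes "1 \<le> i" "i < N"
  shows "U_tangle N i = {{Up j, Lo j} | j. j \<in> {1..N} - {i, Suc i}} \<union> {{Up i, Up (Suc i)}, {Lo i, Lo (Suc i)}}"
  by (auto simp: U_tangle_def id_tangle_def doubleton_eq_iff)

lemma compose_T:
  assumes f: "matching N f" and i: "1 \<le> i" "i < N"
  shows "Defs.compose (T_tangle N i) (tangle_of N f) = tangle_of N (act (T i) f)"
proof -
  let ?g = "act (T i) f" and ?R = "stack_links (T_tangle N i) (tangle_of N f)"
  have g: "matching N ?g" using act_matching[OF f, of "T i"] i by simp
  let ?e = "\<lambda>k. {k, ?g k}"
  \<comment> \<open>The middle point j hangs on the upper point \<open>adj_swap i j\<close> and
    inherits the name of its component.\<close>
  define \<phi> where "\<phi> = (\<lambda>(r, j). if r = 0 then ?e j else if r = (1::nat) then ?e (adj_swap i j) else ?e (2 * N + 1 - j))"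
  have top: "(\<exists>a b. x = top_pos a \<and> y = top_pos b \<and> {a, b} \<in> T_tangle N i) \<longleftrightarrow>
      (\<exists>j\<in>{1..N}. x = (0, j) \<and> y = (1, adj_swap i j) \<or> y = (0, j) \<and> x = (1, adj_swap i j))" for x y
    unfolding T_tangle_eq[OF i] by (auto simp: doubleton_eq_iff; force)
  have bot: "(\<exists>a b. x = bot_pos a \<and> y = bot_pos b \<and> {a, b} \<in> tangle_of N f) \<longleftrightarrow>
      (\<exists>k\<in>{1..2 * N}. x = bot_pos (node_at N k) \<and> y = bot_pos (node_at N (f k)))" for x y
    unfolding edge_tangle_of[OF f] by blast
  have R: "(x, y) \<in> ?R \<longleftrightarrow> (\<exists>j\<in>{1..N}. x = (0, j) \<and> y = (1, adj_swap i j) \<or> y = (0, j) \<and> x = (1, adj_swap i j))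
      \<or> (\<exists>k\<in>{1..2 * N}. x = bot_pos (node_at N k) \<and> y = bot_pos (node_at N (f k)))" for x y
    unfolding top[symmetric] bot[symmetric] by (auto simp: stack_links_def)
  have swN: "adj_swap i j \<in> {1..N} \<longleftrightarrow> j \<in> {1..N}" for j using i by (auto simp: transpose_def)
  have sw_hi: "adj_swap i k = k" if "N < k" for k using i that by (auto simp: transpose_def)
  have \<phi>_bot: "\<phi> (bot_pos (node_at N k)) = ?e (adj_swap i k)" "snd (bot_pos (node_at N k)) \<in> {1..N}"
    if "k \<in> {1..2 * N}" for k
    using that sw_hi[of k] by (auto simp: bot_pos_node_at \<phi>_def)
  show ?thesis
  proof (rule compose_eqI[OF g, where \<phi> = \<phi>])
    fix x y assume "(x, y) \<in> ?R"
    then consider j where "j \<in> {1..N}" "x = (0, j) \<and> y = (1, adj_swap i j) \<or> y = (0, j) \<and> x = (1, adj_swap i j)"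
      | k where "k \<in> {1..2 * N}" "x = bot_pos (node_at N k)" "y = bot_pos (node_at N (f k))"
      unfolding R by blast
    then show "\<phi> x = \<phi> y \<and> snd x \<in> {1..N} \<and> snd y \<in> {1..N}"
    proof cases
      case 1
      then show ?thesis using swN[of j] by (auto simp: \<phi>_def)
    next
      case 2
      have "f k \<in> {1..2 * N}" using 2(1) matching_in[OF f] by blast
      moreover have "?e (adj_swap i k) = ?e (adj_swap i (f k))"
        using matching_invol[OF f] by auto
      ultimately show ?thesis using \<phi>_bot[OF 2(1)] \<phi>_bot[of "f k"] 2 by simp
    qed
  next
    fix k assume k: "k \<in> {1..2 * N}"
    then show "\<phi> (outer_pos (node_at N k)) = {k, ?g k}"
      by (auto simp: outer_pos_node_at \<phi>_def)
  next
    fix k assume k: "k \<in> {1..2 * N}"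
    have down: "(outer_pos (node_at N k), bot_pos (node_at N (adj_swap i k))) \<in> ?R\<^sup>*" if "k \<in> {1..2 * N}" for k
    proof (cases "k \<le> N")
      case True
      then have "adj_swap i k \<le> N" "adj_swap i k \<in> {1..2 * N}" using swN[of k] that by auto
      then have "bot_pos (node_at N (adj_swap i k)) = (1, adj_swap i k)" "outer_pos (node_at N k) = (0, k)"
        using that True by (simp_all add: bot_pos_node_at outer_pos_node_at)
      then show ?thesis using True that R by (intro r_into_rtrancl) auto
    next
      case False
      then show ?thesis using that sw_hi[of k] by (simp add: bot_pos_node_at outer_pos_node_at)
    qed
    have up: "(bot_pos (node_at N (adj_swap i k)), outer_pos (node_at N k)) \<in> ?R\<^sup>*" if "k \<in> {1..2 * N}" for k
      using down[OF that] sym_rtrancl[OF sym_stack_links] by (meson symD)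
    have "adj_swap i k \<in> {1..2 * N}" using k sw_in[OF i] by blast
    then have "(bot_pos (node_at N (adj_swap i k)), bot_pos (node_at N (f (adj_swap i k)))) \<in> ?R"
      unfolding R by blast
    moreover have "adj_swap i (?g k) = f (adj_swap i k)" by simp
    moreover have "?g k \<in> {1..2 * N}" using k matching_in[OF g] by blast
    ultimately show "(outer_pos (node_at N k), outer_pos (node_at N (?g k))) \<in> ?R\<^sup>*"
      using down[OF k] up[of "?g k"] by (metis rtrancl.rtrancl_into_rtrancl rtrancl_trans)
  qed
qed

lemma compose_U:
  assumes f: "matching N f" and i: "1 \<le> i" "i < N"
  shows "Defs.compose (U_tangle N i) (tangle_of N f) = tangle_of N (act (U i) f)"
proof -
  let ?g = "act (U i) f" and ?R = "stack_links (U_tangle N i) (tangle_of N f)"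
  note fi = matching_invol[OF f] and fin = matching_in[OF f]
  have ii: "i \<in> {1..2 * N}" "Suc i \<in> {1..2 * N}" "i \<noteq> Suc i" using i by auto
  have g: "matching N ?g" using act_matching[OF f, of "U i"] i by simp
  have gi: "?g i = Suc i" "?g (Suc i) = i"
    using fi[of i] reconnect_simps(1,2)[OF f ii] by (cases "f i = Suc i"; simp add: reconnect_def)+
  have gx: "?g (f i) = f (Suc i)" "?g (f (Suc i)) = f i" if "f i \<noteq> Suc i"
    using reconnect_simps(3,4)[OF f ii that] by simp_all
  have go: "?g k = f k" if "k \<notin> {i, Suc i, f i, f (Suc i)}" for k
    using reconnect_simps(5)[OF f ii _ that] by (cases "f i = Suc i"; simp add: reconnect_def)
  let ?e = "\<lambda>k. {k, ?g k}"
  \<comment> \<open>The component of the middle points i and i + 1: the edge glued from their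
    partners, or the empty set if f joins them, since they then lie on a loop that reaches no outer
    point.\<close>
  define m where "m = (if f i = Suc i then {} else ?e (f i))"
  define \<phi> where "\<phi> = (\<lambda>(r, j). if r = 0 then ?e j
    else if r = (1::nat) then (if j \<in> {i, Suc i} then m else ?e j) else ?e (2 * N + 1 - j))"
  have top: "(\<exists>a b. x = top_pos a \<and> y = top_pos b \<and> {a, b} \<in> U_tangle N i) \<longleftrightarrow>
      (\<exists>j\<in>{1..N} - {i, Suc i}. x = (0, j) \<and> y = (1, j) \<or> y = (0, j) \<and> x = (1, j))
      \<or> (\<exists>r\<in>{0, 1}. x = (r, i) \<and> y = (r, Suc i) \<or> y = (r, i) \<and> x = (r, Suc i))" (is "?l x y \<longleftrightarrow> ?r x y") for x y
  proof
    show "?l x y \<Longrightarrow> ?r x y"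
      unfolding U_tangle_eq[OF i] by (auto simp: doubleton_eq_iff)
    assume "?r x y"
    then consider "\<exists>j\<in>{1..N} - {i, Suc i}. x = top_pos (Up j) \<and> y = top_pos (Lo j) \<or> y = top_pos (Up j) \<and> x = top_pos (Lo j)"
      | "x = top_pos (Up i) \<and> y = top_pos (Up (Suc i)) \<or> y = top_pos (Up i) \<and> x = top_pos (Up (Suc i))"
      | "x = top_pos (Lo i) \<and> y = top_pos (Lo (Suc i)) \<or> y = top_pos (Lo i) \<and> x = top_pos (Lo (Suc i))"
      by auto
    then show "?l x y"
    proof cases
      case 1
      then obtain j where j: "j \<in> {1..N} - {i, Suc i}"
        "x = top_pos (Up j) \<and> y = top_pos (Lo j) \<or> y = top_pos (Up j) \<and> x = top_pos (Lo j)" by blast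
      then have "{Up j, Lo j} \<in> U_tangle N i" "{Lo j, Up j} \<in> U_tangle N i"
        unfolding U_tangle_eq[OF i] by (auto simp: insert_commute)
      then show ?thesis using j(2) by blast
    next
      case 2
      have "{Up i, Up (Suc i)} \<in> U_tangle N i" "{Up (Suc i), Up i} \<in> U_tangle N i"
        unfolding U_tangle_eq[OF i] by (auto simp: insert_commute)
      then show ?thesis using 2 by blast
    next
      case 3
      have "{Lo i, Lo (Suc i)} \<in> U_tangle N i" "{Lo (Suc i), Lo i} \<in> U_tangle N i"
        unfolding U_tangle_eq[OF i] by (auto simp: insert_commute)
      then show ?thesis using 3 by blast
    qed
  qed
  have bot: "(\<exists>a b. x = bot_pos a \<and> y = bot_pos b \<and> {a, b} \<in> tangle_of N f) \<longleftrightarrow>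
      (\<exists>k\<in>{1..2 * N}. x = bot_pos (node_at N k) \<and> y = bot_pos (node_at N (f k)))" for x y
    unfolding edge_tangle_of[OF f] by blast
  have R: "(x, y) \<in> ?R \<longleftrightarrow> (\<exists>j\<in>{1..N} - {i, Suc i}. x = (0, j) \<and> y = (1, j) \<or> y = (0, j) \<and> x = (1, j))
      \<or> (\<exists>r\<in>{0, 1}. x = (r, i) \<and> y = (r, Suc i) \<or> y = (r, i) \<and> x = (r, Suc i))
      \<or> (\<exists>k\<in>{1..2 * N}. x = bot_pos (node_at N k) \<and> y = bot_pos (node_at N (f k)))" for x y
    unfolding disj_assoc[symmetric] top[symmetric] bot[symmetric] by (auto simp: stack_links_def)
  have \<phi>_bot: "\<phi> (bot_pos (node_at N k)) = (if k \<in> {i, Suc i} then m else ?e k)"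
      "snd (bot_pos (node_at N k)) \<in> {1..N}"
    if "k \<in> {1..2 * N}" for k
    using that i by (auto simp: bot_pos_node_at \<phi>_def)
  have m_eq: "(if k \<in> {i, Suc i} then m else ?e k) = (if f k \<in> {i, Suc i} then m else ?e (f k))" for k
  proof -
    consider (loop) "f i = Suc i" "k \<in> {i, Suc i}"
      | (at) "k \<in> {i, Suc i}" "f i \<noteq> Suc i" | (to) "f k \<in> {i, Suc i}" "k \<notin> {i, Suc i}"
      | (off) "f k \<notin> {i, Suc i}" "k \<notin> {i, Suc i}" by blast
    then show ?thesis
    proof cases
      case loop
      then have "f k \<in> {i, Suc i}" using fi by (metis insert_iff empty_iff)
      then show ?thesis using loop by simp
    next
      case at
      have "f (Suc i) \<noteq> i" "f i \<noteq> i" "f (Suc i) \<noteq> Suc i"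
        using at(2) fi matching_fixed[OF f] ii by metis+
      then have "f k \<notin> {i, Suc i}" using at by auto
      moreover have "?e (f k) = m" using at gx by (auto simp: m_def)
      ultimately show ?thesis using at by simp
    next
      case to
      have ne: "f i \<noteq> Suc i" using to fi by (metis insert_iff empty_iff)
      have "k = f i \<or> k = f (Suc i)" using to fi by (metis insert_iff empty_iff)
      then have "?e k = m" using gx[OF ne] ne by (auto simp: m_def)
      then show ?thesis using to by simp
    next
      case off
      then have "?g k = f k" "?g (f k) = k"
        using go[of k] go[of "f k"] fi by (metis insert_iff empty_iff)+
      then show ?thesis using off by auto
    qed
  qed
  show ?thesis
  proof (rule compose_eqI[OF g, where \<phi> = \<phi>])
    fix x y assume "(x, y) \<in> ?R"
    then consider j where "j \<in> {1..N} - {i, Suc i}" "x = (0, j) \<and> y = (1, j) \<or> y = (0, j) \<and> x = (1, j)"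
      | r where "r \<in> {0, 1::nat}" "x = (r, i) \<and> y = (r, Suc i) \<or> y = (r, i) \<and> x = (r, Suc i)"
      | k where "k \<in> {1..2 * N}" "x = bot_pos (node_at N k)" "y = bot_pos (node_at N (f k))"
      unfolding R by blast
    then show "\<phi> x = \<phi> y \<and> snd x \<in> {1..N} \<and> snd y \<in> {1..N}"
    proof cases
      case 1
      then show ?thesis by (auto simp: \<phi>_def)
    next
      case 2
      then have "\<phi> (r, i) = \<phi> (r, Suc i)"
        using gi by (auto simp: \<phi>_def)
      then show ?thesis using 2 i by auto
    next
      case 3
      have "f k \<in> {1..2 * N}" using 3(1) fin by blast
      then show ?thesis using \<phi>_bot[OF 3(1)] \<phi>_bot[of "f k"] m_eq[of k] 3 by simp
    qed
  next
    fix k assume k: "k \<in> {1..2 * N}"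
    then show "\<phi> (outer_pos (node_at N k)) = {k, ?g k}"
      by (auto simp: outer_pos_node_at \<phi>_def)
  next
    have rev_path: "(x, y) \<in> ?R\<^sup>* \<Longrightarrow> (y, x) \<in> ?R\<^sup>*" for x y
      using sym_rtrancl[OF sym_stack_links] by (meson symD)
    have down: "(outer_pos (node_at N k), bot_pos (node_at N k)) \<in> ?R\<^sup>*"
      if "k \<in> {1..2 * N}" "k \<notin> {i, Suc i}" for k
    proof (cases "k \<le> N")
      case True
      then have "bot_pos (node_at N k) = (1, k)" "outer_pos (node_at N k) = (0, k)"
        using that True by (simp_all add: bot_pos_node_at outer_pos_node_at)
      then show ?thesis using True that R by (intro r_into_rtrancl) auto
    next
      case False
      then show ?thesis using that by (simp add: bot_pos_node_at outer_pos_node_at)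
    qed
    have mid: "(bot_pos (node_at N k), bot_pos (node_at N (f k))) \<in> ?R\<^sup>*" if "k \<in> {1..2 * N}" for k
      using that unfolding R by (intro r_into_rtrancl) (auto simp: R)
    have mi: "(bot_pos (node_at N i), bot_pos (node_at N (Suc i))) \<in> ?R\<^sup>*"
      using ii i by (intro r_into_rtrancl) (simp add: bot_pos_node_at R)
    have oi: "(outer_pos (node_at N i), outer_pos (node_at N (Suc i))) \<in> ?R\<^sup>*"
      using ii i by (intro r_into_rtrancl) (simp add: outer_pos_node_at R)
    fix k assume k: "k \<in> {1..2 * N}"
    have fk: "f k \<in> {1..2 * N}" using k fin by blast
    show "(outer_pos (node_at N k), outer_pos (node_at N (?g k))) \<in> ?R\<^sup>*"
    proof (cases "k \<in> {i, Suc i}")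
      case True
      then show ?thesis using gi oi rev_path[OF oi] by auto
    next
      case out: False
      show ?thesis
      proof (cases "f k \<in> {i, Suc i}")
        case False
        then have "?g k = f k" using out go[of k] fi by (metis insert_iff empty_iff)
        then show ?thesis
          using down[OF k out] mid[OF k] rev_path[OF down[OF fk False]] by (metis rtrancl_trans)
      next
        case True
        have ne: "f i \<noteq> Suc i" using True out fi by (metis insert_iff empty_iff)
        have rg: "f i \<in> {1..2 * N}" "f (Suc i) \<in> {1..2 * N}" using ii fin by blast+
        have off: "f i \<notin> {i, Suc i}" "f (Suc i) \<notin> {i, Suc i}"
          using ne fi matching_fixed[OF f] ii by (metis insert_iff empty_iff)+
        have di: "(outer_pos (node_at N (f i)), bot_pos (node_at N i)) \<in> ?R\<^sup>*"
          using rtrancl_trans[OF down[OF rg(1) off(1)] rev_path[OF mid[OF ii(1)]]] .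
        have ds: "(outer_pos (node_at N (f (Suc i))), bot_pos (node_at N (Suc i))) \<in> ?R\<^sup>*"
          using rtrancl_trans[OF down[OF rg(2) off(2)] rev_path[OF mid[OF ii(2)]]] .
        \<comment> \<open>The glued edge as a path: from \<open>f i\<close> to the middle point i,
          across to i + 1, and on to \<open>f (Suc i)\<close>.\<close>
        have all: "(outer_pos (node_at N (f i)), outer_pos (node_at N (f (Suc i)))) \<in> ?R\<^sup>*"
          using rtrancl_trans[OF rtrancl_trans[OF di mi] rev_path[OF ds]] .
        have "k = f i \<or> k = f (Suc i)" using True fi by (metis insert_iff empty_iff)
        then show ?thesis using all rev_path[OF all] gx[OF ne] by auto
      qed
    qed
  qed
qed

lemma id_tangle_eq: "id_tangle N = tangle_of N (perm_matching N id)"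
proof -
  have "{{node_at N k, node_at N (perm_matching N id k)} | k. k \<in> {1..2 * N}} = {{Up i, Lo i} | i. i \<in> {1..N}}"
    (is "?L = ?R")
  proof
    show "?L \<subseteq> ?R"
    proof
      fix e assume "e \<in> ?L"
      then obtain k where k: "k \<in> {1..2 * N}" "e = {node_at N k, node_at N (perm_matching N id k)}" by blast
      show "e \<in> ?R"
      proof (cases "k \<le> N")
        case True
        then have "e = {Up k, Lo k}" using k by (auto simp: node_at_def perm_matching_def)
        then show ?thesis using True k by auto
      next
        case False
        then have "e = {Up (2 * N + 1 - k), Lo (2 * N + 1 - k)}"
          using k by (auto simp: node_at_def perm_matching_def)
        then show ?thesis using False k by fastforce
      qed
    qed
    show "?R \<subseteq> ?L"
    proof
      fix e assume "e \<in> ?R"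
      then obtain i where i: "i \<in> {1..N}" "e = {Up i, Lo i}" by blast
      then have "e = {node_at N i, node_at N (perm_matching N id i)}"
        by (auto simp: node_at_def perm_matching_def)
      then show "e \<in> ?L" using i(1) by fastforce
    qed
  qed
  then show ?thesis by (simp add: id_tangle_def tangle_of_def)
qed

lemma word_tangle_eq: "is_word N F \<Longrightarrow> word_tangle N F = tangle_of N (word_matching N F)"
proof (induction F)
  case Nil
  then show ?case by (simp add: word_tangle_def id_tangle_eq)
next
  case (Cons l F)
  then have "word_tangle N (l # F) = Defs.compose (prime_tangle N l) (tangle_of N (word_matching N F))"
    by (simp add: word_tangle_def)
  then show ?case
    using Cons.prems compose_T compose_U word_matching_matching by (cases l) (simp_all del: act.simps)
qed

lemma is_word_tau_word: "is_word N F \<Longrightarrow> is_word N (tau_word F)"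
  by (simp add: is_word_def tau_word_def)

lemma word_tangle_T_sym:
  assumes "is_word N F" "\<forall>l\<in>set F. is_T l"
  shows "word_tangle N F \<in> sym_tangles N"
  using assms
proof (induction F)
  case Nil
  then show ?case by (simp add: word_tangle_def sym_tangles.intros(1))
next
  case (Cons l F)
  then obtain i where l: "l = T i" by (cases l) auto
  have "T_tangle N i \<in> sym_tangles N"
    using Cons.prems l by (intro sym_tangles.intros(2)) auto
  then show ?case
    using Cons l by (simp add: word_tangle_def sym_tangles.intros(3))
qed

text \<open>\<open>tau\<close> selects a minimal factorization by choice, so one has to exist: a
  word for w carried back to f is a factorization, and a shortest one is minimal. As
  \<open>tau_word_minimal\<close> holds for all minimal words, it holds for the selected
  one.\<close>

lemma tau_eq:
  assumes f: "matching N f"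
  shows "\<exists>w. w permutes {1..N} \<and> tau N (tangle_of N f) = tangle_of N (perm_matching N w)
    \<and> (\<forall>p q. p \<le> N \<longrightarrow> q \<le> N \<longrightarrow> leaving N (perm_matching N w) p q = through N f p q)"
    and "tau N (tangle_of N f) \<in> sym_tangles N"
proof -
  let ?X = "tangle_of N f"
  have fac: "factorization N F ?X \<longleftrightarrow> is_word N F \<and> word_matching N F = f" for F
    using word_tangle_eq[of N F] tangle_of_inj[OF word_matching_matching f]
    by (auto simp: factorization_def)
  obtain w where w: "w permutes {1..N}"
    "\<And>F. is_word N F \<Longrightarrow> word_matching N F = perm_matching N w \<Longrightarrow> \<exists>G. is_word N G \<and> word_matching N G = f"
    using through_perm[OF f] by metis
  obtain W where "is_word N W" "word_matching N W = perm_matching N w"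
    using perm_matching_word[OF w(1)] by blast
  then have "\<exists>F. factorization N F ?X" using w(2) fac by blast
  then have "\<exists>F. minimal_factorization N F ?X"
    using ex_has_least_nat[of "\<lambda>F. factorization N F ?X" _ length] by (auto simp: minimal_factorization_def)
  then have "minimal_factorization N (SOME F. minimal_factorization N F ?X) ?X" by (rule someI_ex)
  then obtain F where F: "F = (SOME F. minimal_factorization N F ?X)" "minimal_factorization N F ?X" by simp
  then have "is_word N F" "word_matching N F = f"
      "\<And>G. is_word N G \<Longrightarrow> word_matching N G = f \<Longrightarrow> length F \<le> length G"
    using fac by (auto simp: minimal_factorization_def)
  from tau_word_minimal[OF f this] obtain v where v: "v permutes {1..N}"
    "word_matching N (tau_word F) = perm_matching N v"
    "\<forall>p q. p \<le> N \<longrightarrow> q \<le> N \<longrightarrow> leaving N (perm_matching N v) p q = through N f p q" by blast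
  have tau: "tau N ?X = word_tangle N (tau_word F)" by (simp add: tau_def F(1))
  have tw: "is_word N (tau_word F)" by (rule is_word_tau_word[OF \<open>is_word N F\<close>])
  show "\<exists>w. w permutes {1..N} \<and> tau N ?X = tangle_of N (perm_matching N w)
    \<and> (\<forall>p q. p \<le> N \<longrightarrow> q \<le> N \<longrightarrow> leaving N (perm_matching N w) p q = through N f p q)"
    using v tau word_tangle_eq[OF tw] by (intro exI[of _ v]) simp
  show "tau N ?X \<in> sym_tangles N"
    unfolding tau by (rule word_tangle_T_sym[OF tw]) (auto simp: tau_word_def)
qed

section \<open>The program\<close>

definition halts_with :: "nat \<Rightarrow> (state \<Rightarrow> bool) \<Rightarrow> nat \<Rightarrow> com \<Rightarrow> state \<Rightarrow> bool" where
  "halts_with W Q B c s \<longleftrightarrow> (\<exists>t s'. exec W c s t s' \<and> t \<le> B \<and> Q s')"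

lemma halts_with_Seq:
  assumes "halts_with W R B c s" "\<And>s'. R s' \<Longrightarrow> halts_with W Q B' d s'"
  shows "halts_with W Q (B + B') (Seq c d) s"
  using assms unfolding halts_with_def by (meson exec_Seq add_mono)

text \<open>The index of the invariant fixes the number of rounds in advance: n successful tests
  with their bodies, and one failing test.\<close>

lemma halts_with_While:
  assumes "I 0 s"
    and step: "\<And>k s. k < n \<Longrightarrow> I k s \<Longrightarrow> bval b s \<and> halts_with W (I (Suc k)) B c s"
    and stop: "\<And>s. I n s \<Longrightarrow> \<not> bval b s"
  shows "halts_with W (I n) (n * (1 + bcost b + B) + (1 + bcost b)) (While b c) s"
proof -
  have "halts_with W (I n) ((n - k) * (1 + bcost b + B) + (1 + bcost b)) (While b c) s"
    if "k \<le> n" "I k s" for k s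
    using that
  proof (induction k arbitrary: s rule: inc_induct)
    case base
    then show ?case
      using stop exec_WhileFalse[of b s W c] unfolding halts_with_def by fastforce
  next
    case (step k)
    obtain t s' where 1: "bval b s" "exec W c s t s'" "t \<le> B" "I (Suc k) s'"
      using assms(2)[OF step.hyps(2) step.prems] by (auto simp: halts_with_def)
    obtain t' s'' where 2: "exec W (While b c) s' t' s''"
        "t' \<le> (n - Suc k) * (1 + bcost b + B) + (1 + bcost b)" "I n s''"
      using step.IH[OF 1(4)] by (auto simp: halts_with_def)
    have "n - k = Suc (n - Suc k)" using step.hyps by simp
    then have "1 + bcost b + t + t' \<le> (n - k) * (1 + bcost b + B) + (1 + bcost b)"
      using 1(3) 2(2) by simp
    then show ?case
      using exec_WhileTrue[OF 1(1,2) 2(1)] 2(3) unfolding halts_with_def by blast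
  qed
  then show ?thesis using assms(1) by fastforce
qed

text \<open>For programs without loops the final state, the word bound check and a cost estimate are
  recursive functions, so a loop body can be verified by simplification. The values that these
  functions give to \<open>While\<close> are dummies, excluded by \<open>loop_free\<close>.\<close>

fun loop_free :: "com \<Rightarrow> bool" where
  "loop_free (Seq c d) = (loop_free c \<and> loop_free d)"
| "loop_free (Cond b c d) = (loop_free c \<and> loop_free d)"
| "loop_free (While b c) = False"
| "loop_free _ = True"

fun result_state :: "com \<Rightarrow> state \<Rightarrow> state" where
  "result_state (Assign x e) s = s\<lparr>var := (var s)(x := aval e s)\<rparr>"
| "result_state (Write a i e) s = s\<lparr>arr := (arr s)(a := (arr s a)(aval i s := aval e s))\<rparr>"
| "result_state (Seq c d) s = result_state d (result_state c s)"
| "result_state (Cond b c d) s = (if bval b s then result_state c s else result_state d s)"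
| "result_state _ s = s"

fun in_bounds :: "nat \<Rightarrow> com \<Rightarrow> state \<Rightarrow> bool" where
  "in_bounds W (Assign x e) s = (aval e s \<le> W)"
| "in_bounds W (Write a i e) s = (aval i s \<le> W \<and> aval e s \<le> W)"
| "in_bounds W (Seq c d) s = (in_bounds W c s \<and> in_bounds W d (result_state c s))"
| "in_bounds W (Cond b c d) s = (if bval b s then in_bounds W c s else in_bounds W d s)"
| "in_bounds W _ s = True"

fun cost_bound :: "com \<Rightarrow> nat" where
  "cost_bound (Assign x e) = 1 + acost e"
| "cost_bound (Write a i e) = 1 + acost i + acost e"
| "cost_bound (Seq c d) = cost_bound c + cost_bound d"
| "cost_bound (Cond b c d) = 1 + bcost b + max (cost_bound c) (cost_bound d)"
| "cost_bound _ = 1"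

lemma loop_free_exec:
  assumes "loop_free c" "in_bounds W c s"
  shows "\<exists>t\<le>cost_bound c. exec W c s t (result_state c s)"
  using assms
proof (induction c arbitrary: s)
  case (Seq c d)
  then obtain t t' where "t \<le> cost_bound c" "exec W c s t (result_state c s)"
      "t' \<le> cost_bound d" "exec W d (result_state c s) t' (result_state d (result_state c s))"
    by (metis result_state.simps(3) loop_free.simps(1) in_bounds.simps(3))
  then show ?case using exec_Seq by (intro exI[of _ "t + t'"]) auto
next
  case (Cond b c d)
  show ?case
  proof (cases "bval b s")
    case True
    then obtain t where "t \<le> cost_bound c" "exec W c s t (result_state c s)"
      using Cond.IH(1)[of s] Cond.prems by auto
    then show ?thesis
      using exec_CondTrue[OF True, of W c t _ d] True by (intro exI[of _ "1 + bcost b + t"]) auto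
  next
    case False
    then obtain t where "t \<le> cost_bound d" "exec W d s t (result_state d s)"
      using Cond.IH(2)[of s] Cond.prems by auto
    then show ?thesis
      using exec_CondFalse[OF False, of W d t _ c] False by (intro exI[of _ "1 + bcost b + t"]) auto
  qed
next
  case Skip
  show ?case using exec_Skip[of W s] by auto
next
  case (Assign x e)
  then show ?case using exec_Assign[of e s W x] by auto
next
  case (Write a i e)
  then show ?case using exec_Write[of i s W e a] by auto
qed simp

lemma halts_with_loop_free:
  assumes "loop_free c" "in_bounds W c s" "Q (result_state c s)" "cost_bound c \<le> B"
  shows "halts_with W Q B c s"
  using loop_free_exec[OF assms(1,2)] assms(3,4) unfolding halts_with_def by (meson order_trans)

text \<open>Row 0 of the table of \<open>through\<close>, where the entry in column q is q.\<close>

definition init_step :: com where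
  "init_step =
     Seq (Write ''row'' (Var ''q'') (Var ''q''))
         (Assign ''q'' (Plus (Var ''q'') (Lit 1)))"

text \<open>\<open>c\<close> is \<open>leaving\<close> at (p, 0). Labels of lower nodes exceed N, so
  the partner of upper node p is on the left exactly if its label is less than p. \<open>d\<close>
  and \<open>l\<close> start with the border values p - 1 and p.\<close>

definition row_start :: com where
  "row_start =
     Seq (Assign ''p'' (Plus (Var ''p'') (Lit 1)))
    (Seq (Cond (Less (Read ''in'' (Var ''p'')) (Var ''p''))
           (Assign ''c'' (Minus (Var ''c'') (Lit 1)))
           (Assign ''c'' (Plus (Var ''c'') (Lit 1))))
    (Seq (Assign ''e'' (Var ''c''))
    (Seq (Assign ''d'' (Minus (Var ''p'') (Lit 1)))
    (Seq (Assign ''l'' (Var ''p''))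
         (Assign ''q'' (Lit 0))))))"

text \<open>In column \<open>q\<close> of row \<open>p\<close>, \<open>e\<close> is \<open>leaving p q\<close>, and \<open>d\<close>, \<open>l\<close>, \<open>u\<close>, \<open>x\<close> are \<open>through\<close> at
  \<open>(p - 1, q - 1)\<close>, \<open>(p, q - 1)\<close>, \<open>(p - 1, q)\<close>, \<open>(p, q)\<close>.\<close>

definition column_leaving :: com where
  "column_leaving =
     Seq (Assign ''q'' (Plus (Var ''q'') (Lit 1)))
    (Seq (Assign ''m'' (Read ''in'' (Plus (Var ''N'') (Var ''q''))))
         (Cond (Conj (Less (Var ''p'') (Var ''m''))
                     (Neg (Conj (Less (Var ''N'') (Var ''m'')) (Less (Var ''m'') (Plus (Var ''N'') (Var ''q''))))))
           (Assign ''e'' (Plus (Var ''e'') (Lit 1)))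
           (Assign ''e'' (Minus (Var ''e'') (Lit 1)))))"

text \<open>The two truncated differences add up to |p - q|. At this moment \<open>row\<close> still
  holds the entry of the previous row in column q.\<close>

definition column_through :: com where
  "column_through =
     Seq (Assign ''x'' (Plus (Minus (Var ''p'') (Var ''q'')) (Minus (Var ''q'') (Var ''p''))))
    (Seq (Cond (Less (Var ''x'') (Var ''e'')) (Assign ''x'' (Var ''e'')) Skip)
         (Assign ''u'' (Read ''row'' (Var ''q''))))"

text \<open>The sign test of the second difference is arranged as a comparison of sums to avoid
  negative numbers. An edge occupies two cells of the table of partners.\<close>

definition column_output :: com where
  "column_output =
     Cond (Less (Plus (Var ''d'') (Var ''x'')) (Plus (Var ''l'') (Var ''u'')))
       (Seq (Write ''out'' (Var ''p'') (Plus (Var ''N'') (Var ''q'')))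
            (Write ''out'' (Plus (Var ''N'') (Var ''q'')) (Var ''p'')))
       Skip"

definition column_shift :: com where
  "column_shift =
     Seq (Write ''row'' (Var ''q'') (Var ''x''))
    (Seq (Assign ''d'' (Var ''u''))
         (Assign ''l'' (Var ''x'')))"

definition column_step :: com where
  "column_step = Seq column_leaving (Seq column_through (Seq column_output column_shift))"

definition init_loop :: com where
  "init_loop = While (Less (Var ''q'') (Plus (Var ''N'') (Lit 1))) init_step"

definition column_loop :: com where
  "column_loop = While (Less (Var ''q'') (Var ''N'')) column_step"

definition row_loop :: com where
  "row_loop = While (Less (Var ''p'') (Var ''N'')) (Seq row_start column_loop)"

definition tau_program :: com where
  "tau_program = Seq init_loop row_loop"

lemma label_node_at: "k \<in> {1..2 * N} \<Longrightarrow> label N (node_at N k) = (if k \<le> N then k else 3 * N + 1 - k)"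
  by (auto simp: node_at_def)

lemma table_tangle_of:
  assumes f: "matching N f"
  shows "k \<in> {1..N} \<Longrightarrow> table N (tangle_of N f) k = (if f k \<le> N then f k else 3 * N + 1 - f k)"
    and "q \<in> {1..N} \<Longrightarrow> table N (tangle_of N f) (N + q) =
      (if f (2 * N + 1 - q) \<le> N then f (2 * N + 1 - q) else 3 * N + 1 - f (2 * N + 1 - q))"
proof -
  assume k: "k \<in> {1..N}"
  then have "k \<in> {1..2 * N}" "Up k = node_at N k" by (auto simp: node_at_def)
  moreover from this have "f k \<in> {1..2 * N}" using matching_in[OF f] by blast
  ultimately show "table N (tangle_of N f) k = (if f k \<le> N then f k else 3 * N + 1 - f k)"
    using k partner_tangle_of[OF f, of k] label_node_at[of "f k"] by (simp add: table_def)
next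
  assume q: "q \<in> {1..N}"
  let ?k = "2 * N + 1 - q"
  have "?k \<in> {1..2 * N}" "Lo q = node_at N ?k" using q by (auto simp: node_at_def)
  moreover from this have "f ?k \<in> {1..2 * N}" using matching_in[OF f] by blast
  ultimately show "table N (tangle_of N f) (N + q) = (if f ?k \<le> N then f ?k else 3 * N + 1 - f ?k)"
    using q partner_tangle_of[OF f, of ?k] label_node_at[of "f ?k"] by (simp add: table_def)
qed

section \<open>Correctness of the program\<close>

context
  fixes N :: nat and f w :: "nat \<Rightarrow> nat"
  assumes f: "matching N f" and w: "w permutes {1..N}"
    and through: "\<And>p q. p \<le> N \<Longrightarrow> q \<le> N \<Longrightarrow> leaving N (perm_matching N w) p q = through N f p q"
begin

definition leaving_nat :: "nat \<Rightarrow> nat \<Rightarrow> nat" where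
  "leaving_nat p q = nat (leaving N f p q)"

definition through_nat :: "nat \<Rightarrow> nat \<Rightarrow> nat" where
  "through_nat p q = nat (through N f p q)"

lemma int_leaving_nat: "int (leaving_nat p q) = leaving N f p q"
  using leaving_nonneg by (simp add: leaving_nat_def)

lemma leaving_nat_le: "p \<le> N \<Longrightarrow> q \<le> N \<Longrightarrow> leaving_nat p q \<le> 2 * N"
  using leaving_le[of p N q f] int_leaving_nat[of p q] by linarith

lemma through_nat_eq: "through_nat p q = max (leaving_nat p q) ((p - q) + (q - p))"
  using int_leaving_nat[of p q] by (auto simp: through_nat_def through_def max_def nat_le_iff)

lemma through_nat_le: "p \<le> N \<Longrightarrow> q \<le> N \<Longrightarrow> through_nat p q \<le> 2 * N"
  using leaving_nat_le by (auto simp: through_nat_eq)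

lemma leaving_nat_le_sum: "p \<le> N \<Longrightarrow> q \<le> N \<Longrightarrow> leaving_nat p q \<le> p + q"
  using leaving_lipschitz[OF f, of 0 0 p q] int_leaving_nat[of p q] by (simp add: leaving_0)

lemma through_nat_border: "p \<le> N \<Longrightarrow> through_nat p 0 = p" "q \<le> N \<Longrightarrow> through_nat 0 q = q"
  using leaving_nat_le_sum[of p 0] leaving_nat_le_sum[of 0 q] by (simp_all add: through_nat_eq)

lemma leaving_nat_Suc_upper:
  assumes "p < N"
  shows "leaving_nat (Suc p) 0 = (if table N (tangle_of N f) (Suc p) < Suc p then leaving_nat p 0 - 1 else leaving_nat p 0 + 1)"
proof -
  have fp: "f (Suc p) \<in> {1..2 * N}" using matching_in[OF f, of "Suc p"] assms by simp
  have ne: "f (Suc p) \<noteq> Suc p" using matching_fixed[OF f, of "Suc p"] assms by simp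
  have "table N (tangle_of N f) (Suc p) < Suc p \<longleftrightarrow> f (Suc p) \<in> side N p 0"
    using table_tangle_of(1)[OF f, of "Suc p"] assms fp ne by (auto simp: in_side[OF fp])
  then show ?thesis
    using leaving_Suc_upper[OF f assms, of 0] int_leaving_nat[of p 0] int_leaving_nat[of "Suc p" 0] by auto
qed

text \<open>The next lower node leads to the right if its partner is an upper node beyond p or a
  lower node further right. The interval excluded in the test consists of the labels of the lower
  nodes already on the left.\<close>

lemma leaving_nat_Suc_lower:
  assumes "p \<le> N" "q < N"
  defines "m \<equiv> table N (tangle_of N f) (N + Suc q)"
  shows "leaving_nat p (Suc q) = (if p < m \<and> \<not> (N < m \<and> m < N + Suc q) then leaving_nat p q + 1 else leaving_nat p q - 1)"
proof -
  let ?k = "2 * N - q"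
  have k: "?k \<in> {1..2 * N}" using assms by auto
  have fk: "f ?k \<in> {1..2 * N}" using matching_in[OF f] k by blast
  have ne: "f ?k \<noteq> ?k" using matching_fixed[OF f] k by blast
  have m: "m = (if f ?k \<le> N then f ?k else 3 * N + 1 - f ?k)"
    using table_tangle_of(2)[OF f, of "Suc q"] assms by simp
  have "p < m \<and> \<not> (N < m \<and> m < N + Suc q) \<longleftrightarrow> f ?k \<notin> side N p q"
    unfolding m using assms(1,2) fk ne by (auto simp: in_side[OF fk])
  then show ?thesis
    using leaving_Suc_lower[OF f assms(1,2)] int_leaving_nat[of p q] int_leaving_nat[of p "Suc q"] by auto
qed

text \<open>The linear terms of 2 r - p + q cancel, and of the ranks only the contribution of
  \<open>w (Suc p)\<close> survives; it differs between columns q and q + 1 exactly if this value is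
  q + 1.\<close>

lemma second_difference:
  assumes "p < N" "q < N"
  shows "through_nat p q + through_nat (Suc p) (Suc q) < through_nat (Suc p) q + through_nat p (Suc q) \<longleftrightarrow> w (Suc p) = Suc q"
proof -
  have through_nat: "int (through_nat p q) = 2 * int (perm_rank w p q) - int p + int q" if "p \<le> N" "q \<le> N" for p q
    using through[OF that] leaving_perm_matching[OF w that]
      leaving_nonneg[of N "perm_matching N w" p q] by (simp add: through_nat_def)
  show ?thesis
    using through_nat[of p q] through_nat[of "Suc p" "Suc q"] through_nat[of "Suc p" q] through_nat[of p "Suc q"] assms
    by (auto simp: perm_rank_Suc split: if_splits)
qed

definition written :: "state \<Rightarrow> nat \<Rightarrow> bool" where
  "written s p \<longleftrightarrow> arr s ''out'' p = N + w p \<and> arr s ''out'' (N + w p) = p"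

definition init_inv :: "nat \<Rightarrow> state \<Rightarrow> bool" where
  "init_inv k s \<longleftrightarrow> var s ''N'' = N \<and> var s ''q'' = k \<and> var s ''p'' = 0 \<and> var s ''c'' = 0
    \<and> arr s ''in'' = table N (tangle_of N f) \<and> (\<forall>j<k. arr s ''row'' j = j)"

definition row_inv :: "nat \<Rightarrow> state \<Rightarrow> bool" where
  "row_inv p s \<longleftrightarrow> var s ''N'' = N \<and> var s ''p'' = p \<and> var s ''c'' = leaving_nat p 0
    \<and> arr s ''in'' = table N (tangle_of N f) \<and> (\<forall>j\<in>{1..N}. arr s ''row'' j = through_nat p j)
    \<and> (\<forall>i\<in>{1..p}. written s i)"

text \<open>A single array holds the new row up to column q and the old row beyond it; the one old
  entry still needed after being overwritten is kept in \<open>d\<close>.\<close>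

definition column_inv :: "nat \<Rightarrow> nat \<Rightarrow> state \<Rightarrow> bool" where
  "column_inv p q s \<longleftrightarrow> var s ''N'' = N \<and> var s ''p'' = Suc p \<and> var s ''c'' = leaving_nat (Suc p) 0
    \<and> var s ''q'' = q \<and> var s ''e'' = leaving_nat (Suc p) q \<and> var s ''d'' = through_nat p q \<and> var s ''l'' = through_nat (Suc p) q
    \<and> arr s ''in'' = table N (tangle_of N f)
    \<and> (\<forall>j\<in>{1..N}. arr s ''row'' j = through_nat (if j \<le> q then Suc p else p) j)
    \<and> (\<forall>i\<in>{1..p}. written s i) \<and> (w (Suc p) \<le> q \<longrightarrow> written s (Suc p))"

lemma init_loop_halts:
  assumes "init_inv 0 s"
  shows "halts_with (2 * N + 1) (row_inv 0) ((N + 1) * 13 + 6) init_loop s"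
proof -
  have "halts_with (2 * N + 1) (init_inv (N + 1))
      ((N + 1) * (1 + bcost (Less (Var ''q'') (Plus (Var ''N'') (Lit 1))) + 7)
        + (1 + bcost (Less (Var ''q'') (Plus (Var ''N'') (Lit 1))))) init_loop s"
    unfolding init_loop_def
  proof (rule halts_with_While[where I = init_inv])
    show "init_inv 0 s" by (rule assms)
    fix k s assume k: "k < N + 1" and I: "init_inv k s"
    have "halts_with (2 * N + 1) (init_inv (Suc k)) 7 init_step s"
      by (rule halts_with_loop_free) (use k I in \<open>auto simp: init_step_def init_inv_def less_Suc_eq\<close>)
    then show "bval (Less (Var ''q'') (Plus (Var ''N'') (Lit 1))) s
        \<and> halts_with (2 * N + 1) (init_inv (Suc k)) 7 init_step s"
      using k I by (simp add: init_inv_def)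
  qed (simp add: init_inv_def)
  moreover have "row_inv 0 s" if "init_inv (N + 1) s" for s
    using that leaving_nat_le_sum[of 0 0] by (auto simp: init_inv_def row_inv_def through_nat_border)
  ultimately show ?thesis
    unfolding halts_with_def by force
qed

lemma column_step_inv:
  assumes p: "p < N" and q: "q < N" and I: "column_inv p q s"
  shows "in_bounds (2 * N + 1) column_step s \<and> column_inv p (Suc q) (result_state column_step s)"
proof -
  define m where "m = table N (tangle_of N f) (N + Suc q)"
  have m: "m \<le> 2 * N + 1"
    using table_tangle_of(2)[OF f, of "Suc q"] q matching_in[OF f, of "2 * N - q"] by (auto simp: m_def)
  define A where "A \<longleftrightarrow> Suc p < m \<and> \<not> (N < m \<and> m < N + Suc q)"
  have A: "(Suc p < m \<and> (N < m \<longrightarrow> \<not> m < Suc (N + q))) = A" by (simp add: A_def)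
  have Lq: "leaving_nat (Suc p) (Suc q) = (if A then leaving_nat (Suc p) q + 1 else leaving_nat (Suc p) q - 1)"
    using leaving_nat_Suc_lower[of "Suc p" q] p q by (simp add: m_def A_def)
  have Eq: "through_nat (Suc p) (Suc q) = (if (Suc p - Suc q) + (Suc q - Suc p) < leaving_nat (Suc p) (Suc q)
      then leaving_nat (Suc p) (Suc q) else (Suc p - Suc q) + (Suc q - Suc p))"
    by (simp add: through_nat_eq max_def)
  have C: "through_nat p q + through_nat (Suc p) (Suc q) < through_nat (Suc p) q + through_nat p (Suc q) \<longleftrightarrow> w (Suc p) = Suc q"
    by (rule second_difference[OF p q])
  note I' = I[unfolded column_inv_def]
  have vals: "var s ''N'' = N" "var s ''p'' = Suc p" "var s ''q'' = q" "var s ''e'' = leaving_nat (Suc p) q"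
      "var s ''d'' = through_nat p q" "var s ''l'' = through_nat (Suc p) q" "arr s ''in'' (Suc (N + q)) = m"
      "arr s ''row'' (Suc q) = through_nat p (Suc q)"
    using I' q by (simp_all add: m_def)
  have le: "leaving_nat (Suc p) (Suc q) \<le> 2 * N" "through_nat (Suc p) (Suc q) \<le> 2 * N" "through_nat p (Suc q) \<le> 2 * N"
    using leaving_nat_le[of "Suc p" "Suc q"] through_nat_le[of "Suc p" "Suc q"] through_nat_le[of p "Suc q"] p q by simp_all
  define s1 where "s1 = result_state column_leaving s"
  have s1: "in_bounds (2 * N + 1) column_leaving s"
      "var s1 = (var s)(''q'' := Suc q, ''m'' := m, ''e'' := leaving_nat (Suc p) (Suc q))" "arr s1 = arr s"
    using q m le(1) unfolding s1_def column_leaving_def by (cases A; simp add: vals A Lq)+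
  define s2 where "s2 = result_state column_through s1"
  have s2: "in_bounds (2 * N + 1) column_through s1"
      "var s2 = (var s1)(''x'' := through_nat (Suc p) (Suc q), ''u'' := through_nat p (Suc q))" "arr s2 = arr s"
    using p q le(2,3) unfolding s2_def column_through_def
    by (cases "(Suc p - Suc q) + (Suc q - Suc p) < leaving_nat (Suc p) (Suc q)"; simp add: vals s1 Eq)+
  define s3 where "s3 = result_state column_output s2"
  have s3: "in_bounds (2 * N + 1) column_output s2" "var s3 = var s2"
      "arr s3 = (arr s)(''out'' := if w (Suc p) = Suc q
         then (arr s ''out'')(Suc p := N + Suc q, N + Suc q := Suc p) else arr s ''out'')"
    using p q unfolding s3_def column_output_def
    by (cases "w (Suc p) = Suc q"; simp add: vals s1 s2 C)+
  define s4 where "s4 = result_state column_shift s3"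
  have s4: "in_bounds (2 * N + 1) column_shift s3"
      "var s4 = (var s2)(''d'' := through_nat p (Suc q), ''l'' := through_nat (Suc p) (Suc q))"
      "arr s4 = (arr s3)(''row'' := (arr s ''row'')(Suc q := through_nat (Suc p) (Suc q)))"
    using p q le unfolding s4_def column_shift_def by (simp_all add: vals s1 s2 s3)
  have fin: "result_state column_step s = s4"
    by (simp add: column_step_def s1_def s2_def s3_def s4_def)
  have out: "arr s4 ''out'' = (if w (Suc p) = Suc q
         then (arr s ''out'')(Suc p := N + Suc q, N + Suc q := Suc p) else arr s ''out'')"
    by (simp add: s3 s4)
  have wr: "1 \<le> w i \<and> w i \<le> N" if "i \<in> {1..N}" for i
    using permutes_bounds[OF w, of i] that by simp
  \<comment> \<open>Injectivity of w separates the two cells written now from those of the other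
    rows.\<close>
  have keep: "written s4 i" if "written s i" "i \<in> {1..N}" "i \<noteq> Suc p" for i
  proof -
    have "w i \<noteq> w (Suc p)" using that(3) inj_eq[OF permutes_inj[OF w]] by blast
    then show ?thesis
      using that wr[OF that(2)] p q by (auto simp: written_def out)
  qed
  have new: "written s4 (Suc p)" if "w (Suc p) \<le> Suc q"
  proof (cases "w (Suc p) = Suc q")
    case True
    then show ?thesis using p by (simp add: written_def out)
  next
    case False
    then show ?thesis using that I' by (simp add: written_def out)
  qed
  have row: "arr s4 ''row'' j = through_nat (if j \<le> Suc q then Suc p else p) j" if "j \<in> {1..N}" for j
    using that I' by (auto simp: s3 s4 le_Suc_eq)
  have "column_inv p (Suc q) s4"
    unfolding column_inv_def using I' keep new row p by (auto simp: s1 s2 s3 s4)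
  moreover have "in_bounds (2 * N + 1) column_step s"
    unfolding column_step_def using s1(1) s2(1) s3(1) s4(1)
    by (simp add: s1_def[symmetric] s2_def[symmetric] s3_def[symmetric])
  ultimately show ?thesis using fin by simp
qed

lemma column_loop_halts:
  assumes p: "p < N" and I: "column_inv p 0 s"
  shows "halts_with (2 * N + 1) (column_inv p N) (N * 100 + 4) column_loop s"
proof -
  \<comment> \<open>A generous bound, chosen so that a column costs a round 100 once the 4 units of
    the loop test are added.\<close>
  have "cost_bound column_step \<le> 96"
    by (simp add: column_step_def column_leaving_def column_through_def column_output_def column_shift_def)
  moreover have "loop_free column_step"
    by (simp add: column_step_def column_leaving_def column_through_def column_output_def column_shift_def)
  ultimately have step: "halts_with (2 * N + 1) (column_inv p (Suc q)) 96 column_step s"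
    if "q < N" "column_inv p q s" for q s
    using halts_with_loop_free column_step_inv[OF p that] by blast
  have time: "N * (1 + bcost (Less (Var ''q'') (Var ''N'')) + 96)
      + (1 + bcost (Less (Var ''q'') (Var ''N''))) = N * 100 + 4" by simp
  have "halts_with (2 * N + 1) (column_inv p N)
      (N * (1 + bcost (Less (Var ''q'') (Var ''N'')) + 96) + (1 + bcost (Less (Var ''q'') (Var ''N'')))) column_loop s"
    unfolding column_loop_def
    by (intro halts_with_While[where I = "column_inv p"]) (use I step in \<open>auto simp: column_inv_def\<close>)
  then show ?thesis unfolding time .
qed

lemma row_start_inv:
  assumes p: "p < N" and I: "row_inv p s"
  shows "in_bounds (2 * N + 1) row_start s \<and> column_inv p 0 (result_state row_start s)"
proof -
  note I' = I[unfolded row_inv_def]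
  define m where "m = table N (tangle_of N f) (Suc p)"
  have vals: "var s ''N'' = N" "var s ''p'' = p" "var s ''c'' = leaving_nat p 0" "arr s ''in'' (Suc p) = m"
    using I' by (simp_all add: m_def)
  have Lp: "leaving_nat (Suc p) 0 = (if m < Suc p then leaving_nat p 0 - 1 else leaving_nat p 0 + 1)"
    using leaving_nat_Suc_upper[OF p] by (simp add: m_def)
  have le: "leaving_nat (Suc p) 0 \<le> 2 * N" using leaving_nat_le p by simp
  have wpos: "w (Suc p) \<noteq> 0" using permutes_bounds(1)[OF w, of "Suc p"] p by simp
  define t where "t = result_state row_start s"
  have "in_bounds (2 * N + 1) row_start s \<and> var t = (var s)(''p'' := Suc p, ''c'' := leaving_nat (Suc p) 0,
      ''e'' := leaving_nat (Suc p) 0, ''d'' := p, ''l'' := Suc p, ''q'' := 0) \<and> arr t = arr s"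
    using p le unfolding t_def row_start_def by (cases "m < Suc p"; simp add: vals Lp)
  moreover from this have "column_inv p 0 t"
    using I' through_nat_border p wpos by (simp add: column_inv_def written_def)
  ultimately show ?thesis by (simp add: t_def)
qed

lemma row_loop_halts:
  assumes "row_inv 0 s"
  shows "halts_with (2 * N + 1) (row_inv N) (N * (N * 100 + 44) + 4) row_loop s"
proof -
  have row: "halts_with (2 * N + 1) (row_inv (Suc p)) (36 + (N * 100 + 4)) (Seq row_start column_loop) s"
    if p: "p < N" and I: "row_inv p s" for p s
  proof (rule halts_with_Seq)
    have "loop_free row_start" "cost_bound row_start \<le> 36" by (simp_all add: row_start_def)
    then show "halts_with (2 * N + 1) (column_inv p 0) 36 row_start s"
      using halts_with_loop_free row_start_inv[OF p I] by blast
    fix s' assume "column_inv p 0 s'"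
    then have "halts_with (2 * N + 1) (column_inv p N) (N * 100 + 4) column_loop s'"
      by (rule column_loop_halts[OF p])
    moreover have "row_inv (Suc p) t" if "column_inv p N t" for t
      using that[unfolded column_inv_def] permutes_bounds(2)[OF w, of "Suc p"] p
      unfolding row_inv_def by (simp add: atLeastAtMostSuc_conv)
    ultimately show "halts_with (2 * N + 1) (row_inv (Suc p)) (N * 100 + 4) column_loop s'"
      unfolding halts_with_def by blast
  qed
  have time: "N * (1 + bcost (Less (Var ''p'') (Var ''N'')) + (36 + (N * 100 + 4)))
      + (1 + bcost (Less (Var ''p'') (Var ''N''))) = N * (N * 100 + 44) + 4" by (simp add: algebra_simps)
  have "halts_with (2 * N + 1) (row_inv N)
      (N * (1 + bcost (Less (Var ''p'') (Var ''N'')) + (36 + (N * 100 + 4))) + (1 + bcost (Less (Var ''p'') (Var ''N'')))) row_loop s"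
    unfolding row_loop_def
    by (intro halts_with_While[where I = row_inv]) (use assms row in \<open>auto simp: row_inv_def\<close>)
  then show ?thesis unfolding time .
qed

lemma tau_program_halts:
  "halts_with (2 * N + 1) (\<lambda>s. output_is N s (tangle_of N (perm_matching N w)))
    ((N + 1) * 13 + 6 + (N * (N * 100 + 44) + 4)) tau_program (input_state N (tangle_of N f))"
  unfolding tau_program_def
proof (rule halts_with_Seq)
  show "halts_with (2 * N + 1) (row_inv 0) ((N + 1) * 13 + 6) init_loop (input_state N (tangle_of N f))"
    by (rule init_loop_halts) (simp add: init_inv_def input_state_def)
  fix s assume "row_inv 0 s"
  then have "halts_with (2 * N + 1) (row_inv N) (N * (N * 100 + 44) + 4) row_loop s"
    by (rule row_loop_halts)
  moreover have "output_is N t (tangle_of N (perm_matching N w))" if "row_inv N t" for t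
    unfolding output_is_def
  proof
    fix k assume k: "k \<in> {1..2 * N}"
    note pm = perm_matching_matching[OF w]
    have wr: "written t i" if "i \<in> {1..N}" for i
      using \<open>row_inv N t\<close> that by (simp add: row_inv_def)
    show "arr t ''out'' k = table N (tangle_of N (perm_matching N w)) k"
    proof (cases "k \<le> N")
      case True
      then have "1 \<le> w k" "w k \<le> N" using permutes_bounds[OF w, of k] k by auto
      then show ?thesis
        using table_tangle_of(1)[OF pm, of k] wr[of k] True k by (auto simp: written_def perm_matching_def)
    next
      case False
      \<comment> \<open>A lower cell was filled in the row \<open>inv w q\<close> of its upper
        partner.\<close>
      define q where "q = k - N"
      have q: "q \<in> {1..N}" "k = N + q" using False k by (auto simp: q_def)
      have i: "inv w q \<in> {1..N}" "w (inv w q) = q"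
        using permutes_bounds[OF w, of q] permutes_inverses(1)[OF w] q by auto
      have "perm_matching N w (2 * N + 1 - q) = inv w q"
        using q by (auto simp: perm_matching_def)
      then show ?thesis
        using table_tangle_of(2)[OF pm q(1)] wr[OF i(1)] i q by (simp add: written_def)
    qed
  qed
  ultimately show "halts_with (2 * N + 1) (\<lambda>s. output_is N s (tangle_of N (perm_matching N w)))
      (N * (N * 100 + 44) + 4) row_loop s"
    unfolding halts_with_def by blast
qed

end

theorem mainTheorem5:
  assumes "assumption1" and "assumption2"
  shows "\<exists>(P :: com) (time :: nat \<Rightarrow> nat) (W :: nat \<Rightarrow> nat).
    (\<lambda>N. real (time N)) \<in> O(\<lambda>N. real N ^ 2) \<and>
    (\<lambda>N. real (W N)) \<in> O(\<lambda>N. real N ^ 2) \<and>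
    (\<forall>N X. is_tangle N X \<longrightarrow>
      tau N X \<in> sym_tangles N \<and>
      (\<exists>t s. exec (W N) P (input_state N X) t s \<and> t \<le> time N \<and> output_is N s (tau N X)))"
proof -
  \<comment> \<open>Labels and table entries stay within 2N. The extra 1 is for N = 0, where the
    first loop drives its counter to N + 1 = 1.\<close>
  let ?time = "\<lambda>N. (N + 1) * 13 + 6 + (N * (N * 100 + 44) + 4)" and ?W = "\<lambda>N. 2 * N + 1 :: nat"
  have bound: "(\<lambda>N. real (g N)) \<in> O(\<lambda>N. real N ^ 2)"
    if "\<And>N. 1 \<le> N \<Longrightarrow> g N \<le> K * N\<^sup>2" for g :: "nat \<Rightarrow> nat" and K :: nat
  proof (rule bigoI)
    show "\<forall>\<^sub>F N in sequentially. norm (real (g N)) \<le> real K * norm (real N ^ 2)"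
      using eventually_ge_at_top[of 1]
    proof eventually_elim
      case (elim N)
      then have "real (g N) \<le> real (K * N\<^sup>2)" using that by (intro of_nat_mono) blast
      then show ?case by simp
    qed
  qed
  have sq: "N \<le> N\<^sup>2" "1 \<le> N\<^sup>2" if "1 \<le> N" for N :: nat
    using that by (simp_all add: power2_eq_square)
  have "(\<lambda>N. real (?time N)) \<in> O(\<lambda>N. real N ^ 2)"
  proof (rule bound[of _ 200])
    fix N :: nat assume "1 \<le> N"
    have "?time N = 100 * N\<^sup>2 + 57 * N + 23" by (simp add: power2_eq_square algebra_simps)
    then show "?time N \<le> 200 * N\<^sup>2" using sq[OF \<open>1 \<le> N\<close>] by linarith
  qed
  moreover have "(\<lambda>N. real (?W N)) \<in> O(\<lambda>N. real N ^ 2)"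
  proof (rule bound[of _ 3])
    fix N :: nat assume "1 \<le> N"
    then show "?W N \<le> 3 * N\<^sup>2" using sq[OF \<open>1 \<le> N\<close>] by linarith
  qed
  moreover have "tau N X \<in> sym_tangles N \<and>
      (\<exists>t s. exec (?W N) tau_program (input_state N X) t s \<and> t \<le> ?time N \<and> output_is N s (tau N X))"
    if "is_tangle N X" for N X
  proof -
    obtain f where f: "matching N f" and X: "X = tangle_of N f"
      by (rule tangle_is_tangle_of[OF \<open>is_tangle N X\<close>])
    obtain w where w: "w permutes {1..N}" "tau N X = tangle_of N (perm_matching N w)"
      "\<And>p q. p \<le> N \<Longrightarrow> q \<le> N \<Longrightarrow> leaving N (perm_matching N w) p q = through N f p q"
      using tau_eq(1)[OF f] X by blast
    show ?thesis
      using tau_eq(2)[OF f] tau_program_halts[OF f w(1,3)] unfolding X halts_with_def w(2)[unfolded X] by simp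
  qed
  ultimately show ?thesis
    by (intro exI[of _ tau_program] exI[of _ ?time] exI[of _ ?W]) blast
qed

end
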